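(* Let $q>1$, $0<p\le q<\infty$, $\alpha>p-1$ and $\beta>q$, and let $\mu$ be a positive Borel measure on $[0,1)$ satisfying condition $(W_{p,\alpha})$. (i) If $\mathcal{H}_{\mu,\beta}$ is a compact operator from $\mathcal{D}^p_\alpha$ into $\mathcal{D}^q_{\beta-1}$, then $\mu$ is a vanishing $\left(\frac{\alpha+2}{p}+\frac{\beta+1}{q'}-1\right)$-Carleson measure. (ii) If $\mu$ is a vanishing $\left(\max\{\alpha+2-p,\beta+1\}\left(\frac1p+\frac1{q'}\right)\right)$-Carleson measure, then $\mathcal{H}_{\mu,\beta}$ is a compact operator from $\mathcal{D}^p_\alpha$ into $\mathcal{D}^q_{\beta-1}$.
   Context: $\mathbb{D}$ is the open unit disc, $dA=\frac1\pi dx\,dy$. For $0<p<\infty$, $\alpha>-1$, $A^p_\alpha$ is the space of analytic $f$ on $\mathbb{D}$ with $\|f\|_{A^p_\alpha}=\left((\alpha+1)\int_{\mathbb{D}}|f|^p(1-|z|^2)^\alpha dA\right)^{1/p}<\infty$, and $\mathcal{D}^p_\alpha$ consists of analytic $f$ with $f'\in A^p_\alpha$, normed by $\|f\|_{\mathcal{D}^p_\alpha}=|f(0)|+\|f'\|_{A^p_\alpha}$. $1/q+1/q'=1$. For a positive Borel measure $\mu$ on $[0,1)$ and $\beta>0$, $\mu_{n,k,\beta}=\frac{\Gamma(n+\beta)}{n!\Gamma(\beta)}\int_{[0,1)}t^{n+k}d\mu(t)$ and for $f(z)=\sum_k a_kz^k$ analytic, $\mathcal{H}_{\mu,\beta}(f)(z)=\sum_n\left(\sum_k\mu_{n,k,\beta}a_k\right)z^n$.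 Compactness from $X$ into $Y$ means $\mathcal{H}_{\mu,\beta}$ maps $X$ into $Y$ and takes bounded sets to relatively compact sets. For $s>0$, $\mu$ is an $s$-Carleson measure if $\mu([t,1))\le C(1-t)^s$ for $0\le t<1$, and a vanishing $s$-Carleson measure if $\mu([t,1))=o((1-t)^s)$ as $t\to1^-$. Condition $(W_{p,\alpha})$: if $0<p\le1$, $\mu$ is a $\frac{\alpha+2}{p}$-Carleson measure; if $1\le p\le 2$, $\mu$ is a $\frac{\alpha+2-(p-1)^2}{p}$-Carleson measure; if $2\le p<\infty$, $\mu$ is a $\frac{\alpha+1}{p}$-Carleson measure. *)

theory Defs
  imports "HOL-Complex_Analysis.Complex_Analysis"
begin

text \<open>Weighted area integral: (alpha+1) * int_D |f|^p (1-|z|^2)^alpha dA, with dA = (1/pi) dx dy.\<close>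
definition A_int :: "real \<Rightarrow> real \<Rightarrow> (complex \<Rightarrow> complex) \<Rightarrow> ennreal" where
  "A_int p \<alpha> f = ennreal (\<alpha> + 1) *
     (\<integral>\<^sup>+ z. indicator (ball 0 1) z *
        ennreal (cmod (f z) powr p * (1 - (cmod z)\<^sup>2) powr \<alpha> / pi) \<partial>lborel)"

definition in_Dirichlet :: "real \<Rightarrow> real \<Rightarrow> (complex \<Rightarrow> complex) \<Rightarrow> bool" where
  "in_Dirichlet p \<alpha> f \<longleftrightarrow> f holomorphic_on ball 0 1 \<and> A_int p \<alpha> (deriv f) < \<infinity>"

definition Dirichlet_norm :: "real \<Rightarrow> real \<Rightarrow> (complex \<Rightarrow> complex) \<Rightarrow> real" where
  "Dirichlet_norm p \<alpha> f = cmod (f 0) + enn2real (A_int p \<alpha> (deriv f)) powr (1 / p)"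

definition taylor_coeff :: "(complex \<Rightarrow> complex) \<Rightarrow> nat \<Rightarrow> complex" where
  "taylor_coeff f k = (deriv ^^ k) f 0 / of_nat (fact k)"

definition mu_coef :: "real measure \<Rightarrow> real \<Rightarrow> nat \<Rightarrow> nat \<Rightarrow> real" where
  "mu_coef \<mu> \<beta> n k = Gamma (real n + \<beta>) / (fact n * Gamma \<beta>) * (\<integral>t. t ^ (n + k) \<partial>\<mu>)"

definition H_coef :: "real measure \<Rightarrow> real \<Rightarrow> (complex \<Rightarrow> complex) \<Rightarrow> nat \<Rightarrow> complex" where
  "H_coef \<mu> \<beta> f n = (\<Sum>k. of_real (mu_coef \<mu> \<beta> n k) * taylor_coeff f k)"

definition Hilbert_op :: "real measure \<Rightarrow> real \<Rightarrow> (complex \<Rightarrow> complex) \<Rightarrow> complex \<Rightarrow> complex" where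
  "Hilbert_op \<mu> \<beta> f z = (\<Sum>n. H_coef \<mu> \<beta> f n * z ^ n)"

definition Hilbert_maps :: "real measure \<Rightarrow> real \<Rightarrow> real \<Rightarrow> real \<Rightarrow> real \<Rightarrow> real \<Rightarrow> bool" where
  "Hilbert_maps \<mu> \<beta> p \<alpha> q \<gamma> \<longleftrightarrow>
     (\<forall>f. in_Dirichlet p \<alpha> f \<longrightarrow>
        (\<forall>n. summable (\<lambda>k. of_real (mu_coef \<mu> \<beta> n k) * taylor_coeff f k)) \<and>
        (\<forall>z\<in>ball 0 1. summable (\<lambda>n. H_coef \<mu> \<beta> f n * z ^ n)) \<and>
        in_Dirichlet q \<gamma> (Hilbert_op \<mu> \<beta> f))"

definition Hilbert_compact :: "real measure \<Rightarrow> real \<Rightarrow> real \<Rightarrow> real \<Rightarrow> real \<Rightarrow> real \<Rightarrow> bool" where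
  "Hilbert_compact \<mu> \<beta> p \<alpha> q \<gamma> \<longleftrightarrow>
     Hilbert_maps \<mu> \<beta> p \<alpha> q \<gamma> \<and>
     (\<forall>(F :: nat \<Rightarrow> complex \<Rightarrow> complex) (M::real). (\<forall>j. in_Dirichlet p \<alpha> (F j) \<and> Dirichlet_norm p \<alpha> (F j) \<le> M) \<longrightarrow>
        (\<exists>r g. strict_mono r \<and> in_Dirichlet q \<gamma> g \<and>
           (\<lambda>i. Dirichlet_norm q \<gamma> (\<lambda>z. Hilbert_op \<mu> \<beta> (F (r i)) z - g z)) \<longlonglongrightarrow> 0))"

definition carleson :: "real measure \<Rightarrow> real \<Rightarrow> bool" where
  "carleson \<mu> s \<longleftrightarrow> (\<exists>C. \<forall>t\<in>{0..<1}. emeasure \<mu> {t..<1} \<le> ennreal (C * (1 - t) powr s))"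

definition vanishing_carleson :: "real measure \<Rightarrow> real \<Rightarrow> bool" where
  "vanishing_carleson \<mu> s \<longleftrightarrow>
     (\<forall>e>0. \<exists>d>0. \<forall>t. 1 - d < t \<and> t < 1 \<longrightarrow> emeasure \<mu> {t..<1} \<le> ennreal (e * (1 - t) powr s))"

definition cond_W :: "real \<Rightarrow> real \<Rightarrow> real measure \<Rightarrow> bool" where
  "cond_W p \<alpha> \<mu> \<longleftrightarrow>
     (0 < p \<and> p \<le> 1 \<longrightarrow> carleson \<mu> ((\<alpha> + 2) / p)) \<and>
     (1 \<le> p \<and> p \<le> 2 \<longrightarrow> carleson \<mu> ((\<alpha> + 2 - (p - 1)\<^sup>2) / p)) \<and>
     (2 \<le> p \<longrightarrow> carleson \<mu> ((\<alpha> + 1) / p))"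

end

theory Submission
  imports Defs
begin

text \<open>
Summing the series turns the operator into \<open>f \<mapsto> \<integral> f(t) (1 - t z)\<^sup>-\<^sup>\<beta> d\<mu>(t)\<close>. Both parts are
scale-by-scale estimates at the boundary point 1, with critical Carleson exponent
\<open>N = \<gamma> + (\<beta>+1)/q'\<close>, where \<open>\<gamma> = (\<alpha>+2)/p - 1\<close>.

Necessity: the functions \<open>f\<^sub>b(z) = (1-b)\<^sup>s (1-bz)\<^sup>-\<^sup>\<gamma>\<^sup>-\<^sup>s\<close> with \<open>s = 1/p\<close> are bounded in norm, and the derivatives of
their images tend to 0 pointwise, so by compactness the images tend to 0 in norm modulo constants. The derivative of the
image at \<open>z = b\<close> is at least \<open>c (1-b)\<^sup>-\<^sup>\<gamma>\<^sup>-\<^sup>\<beta>\<^sup>-\<^sup>1 \<mu>[b,1)\<close>, and the growth estimate in the target space bounds it by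
\<open>o(1) \<cdot> (1-b) powr (-(\<beta>+1)/q)\<close>.

Sufficiency: put \<open>t\<^sub>k = 1 - 1/2\<^sup>k\<close>. The numbers \<open>c\<^sub>k = 2 powr (-k\<gamma>) \<cdot> max |f|\<close>, the maximum over \<open>[t\<^sub>k, t\<^sub>k\<^sub>+\<^sub>1]\<close>,
are bounded in \<open>\<ell>\<^sup>q\<close> by the norm of \<open>f\<close> (mean value inequality, discrete Young inequality and \<open>p \<le> q\<close>). The norm of
the image is at most a multiple of the \<open>\<ell>\<^sup>q\<close> norm of \<open>\<theta>\<^sub>k c\<^sub>k\<close> with \<open>\<theta>\<^sub>k = 2\<^sup>k\<^sup>N \<mu>[t\<^sub>k, 1)\<close>, because on the shell
\<open>|1 - z| \<approx> 1/2\<^sup>J\<close> the contribution of scale \<open>k\<close> decays geometrically in \<open>|k - J|\<close>; no duality is needed. The exponent in the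
hypothesis is at least \<open>N\<close>, so \<open>\<theta>\<^sub>k \<rightarrow> 0\<close>, and a normal family argument finishes the proof.
\<close>

subsection \<open>Rotation invariance of area and circle averages\<close>

text \<open>The exponent \<open>N\<close> is a balance of powers of 1 - t. Functions in the source
  grow along the radius with exponent \<gamma>, the derivative of the kernel has exponent \<beta> +
  1, and the target allows growth of exponent (\<beta> + 1)/q only; \<mu> has to make up for the
  rest. The target weight \<beta> - 1 is the one for which weight plus dimension, (\<beta> - 1) + 2,
  equals the kernel exponent, so all powers of 2 cancel on a shell.

  Two obstacles shape the proof. First, p may be less than 1: neither Jensen nor duality is
  available, so L^p estimates rest on pointwise inequalities or on maxima, and the step from p to q
  is made in sequence spaces. Second, the operator is given by series in Taylor coefficients, whose
  convergence must precede the integral formula; in the sufficiency part coefficient growth is set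
  against moment decay. Condition (W) yields a Carleson exponent above \<gamma>: it makes \<mu>
  finite and \<open>(1 - t) powr (-\<gamma>)\<close> integrable, which gives the pointwise
  convergence in the necessity part.\<close>

lemma complex_pair_measurable [measurable]:
  "(\<lambda>x::real \<times> real. Complex (fst x) (snd x)) \<in> borel_measurable borel"
  unfolding complex_eq_iff by (intro borel_measurable_continuous_onI continuous_on_Complex continuous_intros)

text \<open>Agreement on boxes identifies the two measures. This opens the way to Fubini, and so to
  shears, which move one real coordinate at a time.\<close>

lemma lborel_complex: "(lborel :: complex measure) = distr (lborel \<Otimes>\<^sub>M lborel) borel (\<lambda>x. Complex (fst x) (snd x))"
proof (rule lborel_eqI)
  fix l u :: complex
  assume le: "\<And>b. b \<in> Basis \<Longrightarrow> l \<bullet> b \<le> u \<bullet> b"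
  have 1: "Re l \<le> Re u" "Im l \<le> Im u"
    using le[of 1] le[of \<i>] by (auto simp: Basis_complex_def)
  have "emeasure (distr (lborel \<Otimes>\<^sub>M lborel) borel (\<lambda>x. Complex (fst x) (snd x))) (box l u)
     = emeasure (lborel \<Otimes>\<^sub>M lborel) ({Re l<..<Re u} \<times> {Im l<..<Im u})"
    by (subst emeasure_distr)
       (auto intro!: arg_cong[where f="emeasure _"] simp: in_box_complex_iff space_pair_measure lborel_prod)
  also have "\<dots> = ennreal (Re u - Re l) * ennreal (Im u - Im l)"
    using 1 by (subst lborel.emeasure_pair_measure_Times) auto
  also have "\<dots> = ennreal (\<Prod>b\<in>Basis. (u - l) \<bullet> b)"
    using 1 by (simp add: Basis_complex_def ennreal_mult)
  finally show "emeasure (distr (lborel \<Otimes>\<^sub>M lborel) borel (\<lambda>x. Complex (fst x) (snd x))) (box l u) =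
      ennreal (\<Prod>b\<in>Basis. (u - l) \<bullet> b)" .
qed simp

text \<open>Both orders of integration are kept because the two kinds of shear translate different
  coordinates, and the translated one has to be the inner variable.\<close>

lemma nn_integral_complex:
  fixes F :: "complex \<Rightarrow> ennreal"
  assumes [measurable]: "F \<in> borel_measurable borel"
  shows "(\<integral>\<^sup>+z. F z \<partial>lborel) = (\<integral>\<^sup>+y. \<integral>\<^sup>+x. F (Complex x y) \<partial>lborel \<partial>lborel)"
    and "(\<integral>\<^sup>+z. F z \<partial>lborel) = (\<integral>\<^sup>+x. \<integral>\<^sup>+y. F (Complex x y) \<partial>lborel \<partial>lborel)"
proof -
  have m: "(\<lambda>x::real \<times> real. Complex (fst x) (snd x)) \<in> (lborel \<Otimes>\<^sub>M lborel) \<rightarrow>\<^sub>M borel"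
    unfolding lborel_prod by simp
  have e: "(\<integral>\<^sup>+z. F z \<partial>lborel) = (\<integral>\<^sup>+x. F (Complex (fst x) (snd x)) \<partial>(lborel \<Otimes>\<^sub>M lborel))"
    by (subst lborel_complex, subst nn_integral_distr[OF m]) auto
  have m2: "(\<lambda>x. F (Complex (fst x) (snd x))) \<in> borel_measurable (lborel \<Otimes>\<^sub>M lborel)"
    using m by measurable
  show "(\<integral>\<^sup>+z. F z \<partial>lborel) = (\<integral>\<^sup>+x. \<integral>\<^sup>+y. F (Complex x y) \<partial>lborel \<partial>lborel)"
    unfolding e using lborel.nn_integral_fst[OF m2] by simp
  show "(\<integral>\<^sup>+z. F z \<partial>lborel) = (\<integral>\<^sup>+y. \<integral>\<^sup>+x. F (Complex x y) \<partial>lborel \<partial>lborel)"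
    unfolding e using lborel_pair.nn_integral_snd[OF m2] by simp
qed

lemma Complex_measurable [measurable]:
  "Complex x \<in> borel_measurable borel" "(\<lambda>x. Complex x y) \<in> borel_measurable borel"
  by (intro borel_measurable_continuous_onI continuous_on_Complex continuous_intros)+

text \<open>Once the other coordinate is frozen, a shear is a translation of the line.\<close>

lemma nn_integral_shear:
  fixes F :: "complex \<Rightarrow> ennreal"
  assumes [measurable]: "F \<in> borel_measurable borel"
  shows "(\<integral>\<^sup>+z. F (z + of_real (a * Im z)) \<partial>lborel) = (\<integral>\<^sup>+z. F z \<partial>lborel)"
    and "(\<integral>\<^sup>+z. F (z + \<i> * of_real (a * Re z)) \<partial>lborel) = (\<integral>\<^sup>+z. F z \<partial>lborel)"
proof -
  have "(\<integral>\<^sup>+z. F (z + of_real (a * Im z)) \<partial>lborel)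
      = (\<integral>\<^sup>+y. \<integral>\<^sup>+x. F (Complex (a * y + 1 * x) y) \<partial>lborel \<partial>lborel)"
    by (subst nn_integral_complex(1)) (auto intro!: nn_integral_cong arg_cong[where f=F] simp: complex_eq_iff)
  also have "\<dots> = (\<integral>\<^sup>+y. \<integral>\<^sup>+x. F (Complex x y) \<partial>lborel \<partial>lborel)"
  proof (rule nn_integral_cong)
    fix y
    show "(\<integral>\<^sup>+x. F (Complex (a * y + 1 * x) y) \<partial>lborel) = (\<integral>\<^sup>+x. F (Complex x y) \<partial>lborel)"
      using nn_integral_real_affine[of "\<lambda>x. F (Complex x y)" 1 "a * y"] by simp
  qed
  finally show "(\<integral>\<^sup>+z. F (z + of_real (a * Im z)) \<partial>lborel) = (\<integral>\<^sup>+z. F z \<partial>lborel)"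
    by (simp add: nn_integral_complex(1))
  have "(\<integral>\<^sup>+z. F (z + \<i> * of_real (a * Re z)) \<partial>lborel)
      = (\<integral>\<^sup>+x. \<integral>\<^sup>+y. F (Complex x (a * x + 1 * y)) \<partial>lborel \<partial>lborel)"
    by (subst nn_integral_complex(2)) (auto intro!: nn_integral_cong arg_cong[where f=F] simp: complex_eq_iff)
  also have "\<dots> = (\<integral>\<^sup>+x. \<integral>\<^sup>+y. F (Complex x y) \<partial>lborel \<partial>lborel)"
  proof (rule nn_integral_cong)
    fix x
    show "(\<integral>\<^sup>+y. F (Complex x (a * x + 1 * y)) \<partial>lborel) = (\<integral>\<^sup>+y. F (Complex x y) \<partial>lborel)"
      using nn_integral_real_affine[of "\<lambda>y. F (Complex x y)" 1 "a * x"] by simp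
  qed
  finally show "(\<integral>\<^sup>+z. F (z + \<i> * of_real (a * Re z)) \<partial>lborel) = (\<integral>\<^sup>+z. F z \<partial>lborel)"
    by (simp add: nn_integral_complex(2))
qed

lemma nn_integral_rotate:
  fixes F :: "complex \<Rightarrow> ennreal"
  assumes [measurable]: "F \<in> borel_measurable borel" and "cmod u = 1"
  shows "(\<integral>\<^sup>+z. F (u * z) \<partial>lborel) = (\<integral>\<^sup>+z. F z \<partial>lborel)"
proof -
  have rot: "(\<integral>\<^sup>+z. G (v * z) \<partial>lborel) = (\<integral>\<^sup>+z. G z \<partial>lborel)"
    if [measurable]: "G \<in> borel_measurable borel" and v: "cmod v = 1" "Im v \<noteq> 0" for G :: "complex \<Rightarrow> ennreal" and v
  proof -
    \<comment> \<open>A rotation with nonreal multiplier is a product of three shears, each measure preserving by Fubini.\<close>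
    define a where "a = (Re v - 1) / Im v"
    define S where "S = (\<lambda>z. z + complex_of_real (a * Im z))"
    define T where "T = (\<lambda>z. z + \<i> * complex_of_real (Im v * Re z))"
    have n: "(Re v)\<^sup>2 + (Im v)\<^sup>2 = 1" using v(1) by (metis cmod_power2 one_power2)
    have as: "a * Im v = Re v - 1" using v(2) by (simp add: a_def)
    have a2: "a * (Re v + 1) = - Im v"
      using v(2) n by (simp add: a_def field_simps power2_eq_square)
    have eq: "v * z = S (T (S z))" for z
    proof -
      have s1: "Re z + a * Im z + a * (Im z + Im v * (Re z + a * Im z))
          = Re z + (a * Im v) * Re z + a * Im z * (1 + (1 + a * Im v))" by (simp add: algebra_simps)
      also have "\<dots> = Re z + (Re v - 1) * Re z + (a * (Re v + 1)) * Im z"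
        unfolding as by (simp add: algebra_simps)
      also have "\<dots> = Re v * Re z - Im v * Im z" unfolding a2 by (simp add: algebra_simps)
      finally have re: "Re (v * z) = Re (S (T (S z)))" by (simp add: S_def T_def)
      have "Im z + Im v * (Re z + a * Im z) = Im z + Im v * Re z + (a * Im v) * Im z"
        by (simp add: algebra_simps)
      also have "\<dots> = Re v * Im z + Im v * Re z" unfolding as by (simp add: algebra_simps)
      finally have im: "Im (v * z) = Im (S (T (S z)))" by (simp add: S_def T_def)
      show ?thesis using re im complex_eqI by blast
    qed
    have [measurable]: "S \<in> borel_measurable borel" "T \<in> borel_measurable borel"
      unfolding S_def T_def by measurable
    have "(\<integral>\<^sup>+z. G (v * z) \<partial>lborel) = (\<integral>\<^sup>+z. G (S (T (S z))) \<partial>lborel)" by (simp add: eq)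
    also have "\<dots> = (\<integral>\<^sup>+z. G (S (T z)) \<partial>lborel)"
      using nn_integral_shear(1)[of "\<lambda>z. G (S (T z))" a] unfolding S_def by simp
    also have "\<dots> = (\<integral>\<^sup>+z. G (S z) \<partial>lborel)"
      using nn_integral_shear(2)[of "\<lambda>z. G (S z)" "Im v"] unfolding T_def by simp
    also have "\<dots> = (\<integral>\<^sup>+z. G z \<partial>lborel)"
      using nn_integral_shear(1)[of G a] unfolding S_def by simp
    finally show ?thesis .
  qed
  show ?thesis
  proof (cases "Im u = 0")
    case False then show ?thesis using rot assms by auto
  next
    case True
    then have "\<bar>Re u\<bar> = 1" using assms(2) by (simp add: cmod_def)
    \<comment> \<open>For u = 1 or u = -1, rotate by -i u and by i instead, which are both
      nonreal.\<close>
    then have "cmod (- \<i> * u) = 1" "Im (- \<i> * u) \<noteq> 0" using assms(2) True by (auto simp: norm_mult)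
    from rot[OF _ this, of "\<lambda>z. F (\<i> * z)"] rot[of F \<i>] show ?thesis
      by (simp add: mult.assoc[symmetric])
  qed
qed

text \<open>Parametrised over [0,1] like \<open>circlepath\<close>, so that averages over the circle
  carry no normalising factor.\<close>

definition circ :: "real \<Rightarrow> complex" where "circ \<theta> = exp (2 * of_real pi * \<i> * of_real \<theta>)"

lemma norm_circ [simp]: "cmod (circ \<theta>) = 1"
  by (simp add: circ_def norm_exp_eq_Re)

lemma circ_measurable [measurable]: "circ \<in> borel_measurable borel"
  unfolding circ_def by (intro borel_measurable_continuous_onI continuous_intros)

text \<open>Rotation invariance under a Fubini interchange. It stands in for polar coordinates:
  estimates of circular means become estimates of area integrals.\<close>

lemma nn_integral_circle_average:
  fixes F :: "complex \<Rightarrow> ennreal"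
  assumes [measurable]: "F \<in> borel_measurable borel"
  shows "(\<integral>\<^sup>+z. F z \<partial>lborel) = (\<integral>\<^sup>+z. (\<integral>\<^sup>+\<theta>\<in>{0..1}. F (circ \<theta> * z) \<partial>lborel) \<partial>lborel)"
proof -
  have "(\<integral>\<^sup>+z. (\<integral>\<^sup>+\<theta>\<in>{0..1}. F (circ \<theta> * z) \<partial>lborel) \<partial>lborel)
      = (\<integral>\<^sup>+\<theta>. (\<integral>\<^sup>+z. F (circ \<theta> * z) * indicator {0..1} \<theta> \<partial>lborel) \<partial>lborel)"
    by (rule lborel_pair.Fubini') measurable
  also have "\<dots> = (\<integral>\<^sup>+\<theta>. (\<integral>\<^sup>+z. F z \<partial>lborel) * indicator {0..1::real} \<theta> \<partial>lborel)"
    by (intro nn_integral_cong) (simp add: nn_integral_multc nn_integral_rotate)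
  also have "\<dots> = (\<integral>\<^sup>+z. F z \<partial>lborel)" by (simp add: nn_integral_cmult)
  finally show ?thesis by simp
qed

text \<open>Cauchy's formula for the k-th derivative at 0, applied on the unit circle to the
  function sending w to h (z w); the chain rule contributes z ^ k.\<close>

lemma circle_mean_value:
  assumes "h holomorphic_on ball 0 R" "cmod z < R"
  shows "((\<lambda>\<theta>. h (circ \<theta> * z) / circ \<theta> ^ k) has_integral z ^ k * ((deriv ^^ k) h 0 / fact k)) {0..1}"
proof -
  have R: "R > 0" using assms(2) norm_ge_zero[of z] by linarith
  have sub: "z * w \<in> ball 0 R" if "cmod w < R / (if z = 0 then 1 else cmod z)" "z \<noteq> 0 " for w
    using that by (auto simp: norm_mult field_simps)
  \<comment> \<open>A radius beyond 1 keeps the closed unit disc, dilated by z, inside the domain.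
    The natural radius R / |z| forces z = 0 to be separated.\<close>
  have "\<exists>S>1. \<forall>w\<in>ball 0 S. z * w \<in> ball 0 R"
  proof (cases "z = 0")
    case True then show ?thesis using R by (intro exI[of _ 2]) auto
  next
    case False
    then show ?thesis using assms(2) by (intro exI[of _ "R / cmod z"]) (auto simp: norm_mult field_simps)
  qed
  then obtain S where S: "S > 1" "\<And>w. w \<in> ball 0 S \<Longrightarrow> z * w \<in> ball 0 R" by blast
  define g where "g = (\<lambda>w. h (z * w))"
  have holg: "g holomorphic_on ball 0 S"
    unfolding g_def using S by (intro holomorphic_on_compose_gen[OF _ assms(1), unfolded o_def] holomorphic_intros) auto
  have gk: "(deriv ^^ k) g 0 = z ^ k * (deriv ^^ k) h 0"
    unfolding g_def using higher_deriv_compose_linear[OF assms(1), of "ball 0 S" 0 z k] S by auto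
  have "((\<lambda>u. g u / (u - 0) ^ Suc k) has_contour_integral ((2 * pi * \<i>) / (fact k) * (deriv ^^ k) g 0)) (circlepath 0 1)"
    using S by (intro Cauchy_has_contour_integral_higher_derivative_circlepath holomorphic_on_imp_continuous_on
        holomorphic_on_subset[OF holg]) auto
  then have "((\<lambda>x. g (circlepath 0 1 x) / (circlepath 0 1 x) ^ Suc k * (2 * pi * \<i> * exp (2 * of_real pi * \<i> * x)))
     has_integral ((2 * pi * \<i>) / (fact k) * (deriv ^^ k) g 0)) {0..1}"
    unfolding has_contour_integral_def
    by (rule has_integral_eq_rhs[OF has_integral_eq[rotated]])
       (auto simp: vector_derivative_circlepath01)
  moreover have cp: "g (circlepath 0 1 x) / (circlepath 0 1 x) ^ Suc k * (2 * pi * \<i> * exp (2 * of_real pi * \<i> * x))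
      = (2 * pi * \<i>) * (g (circ x) / circ x ^ k)" for x
  proof -
    have "circlepath 0 1 x = circ x" "exp (2 * of_real pi * \<i> * x) = circ x" "circ x \<noteq> 0"
      by (auto simp: circlepath circ_def)
    then show ?thesis by simp
  qed
  ultimately have "((\<lambda>x. (2 * pi * \<i>) * (g (circ x) / circ x ^ k))
     has_integral (2 * pi * \<i>) * ((deriv ^^ k) g 0 / (fact k))) {0..1}"
    by (rule has_integral_eq_rhs[OF has_integral_eq[rotated]])
       (auto simp: cp)
  then have "((\<lambda>x. (g (circ x) / circ x ^ k)) has_integral ((deriv ^^ k) g 0 / (fact k))) {0..1}"
    by (subst (asm) has_integral_mult_right_iff) auto
  then show ?thesis unfolding gk by (simp add: g_def mult.commute)
qed

subsection \<open>Mean value inequalities and radial integrals\<close>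

lemma measurable_indicator_continuous:
  fixes \<phi> :: "'a::topological_space \<Rightarrow> real"
  assumes "continuous_on A \<phi>" "A \<in> sets borel"
  shows "(\<lambda>z. indicator A z * ennreal (\<phi> z)) \<in> borel_measurable borel"
proof -
  have "(\<lambda>z. indicator A z *\<^sub>R \<phi> z) \<in> borel_measurable borel"
    by (rule borel_measurable_continuous_on_indicator[OF assms(2,1)])
  then have "(\<lambda>z. ennreal (indicator A z *\<^sub>R \<phi> z)) \<in> borel_measurable borel" by measurable
  also have "(\<lambda>z. ennreal (indicator A z *\<^sub>R \<phi> z)) = (\<lambda>z. indicator A z * ennreal (\<phi> z))"
    by (auto simp: indicator_def)
  finally show ?thesis .
qed

text \<open>The divisor \<open>circ \<theta> ^ k\<close> has modulus 1, so the coefficient formula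
  survives taking absolute values. For k = 0 this is the sub-mean value property of |h|; general k
  serves the coefficient bounds.\<close>

lemma taylor_coeff_le_circle_average:
  assumes h: "h holomorphic_on ball 0 R" and z: "cmod z < R"
  shows "ennreal (cmod (taylor_coeff h k) * cmod z ^ k) \<le> (\<integral>\<^sup>+\<theta>\<in>{0..1}. ennreal (cmod (h (circ \<theta> * z))) \<partial>lborel)"
proof -
  note hi = circle_mean_value[OF h z, of k]
  have cont: "continuous_on {0..1} (\<lambda>\<theta>. cmod (h (circ \<theta> * z)))"
    by (intro continuous_intros continuous_on_compose2[OF holomorphic_on_imp_continuous_on[OF h]])
       (use z in \<open>auto simp: norm_mult circ_def intro!: continuous_intros\<close>)
  obtain J where J: "((\<lambda>\<theta>. cmod (h (circ \<theta> * z))) has_integral J) {0..1}"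
    using integrable_continuous_real[OF cont] by blast
  have "cmod (z ^ k * ((deriv ^^ k) h 0 / fact k)) \<le> J"
  proof -
    have "cmod (h (circ x * z) / circ x ^ k) \<le> cmod (h (circ x * z))" for x
      by (simp add: norm_divide norm_power)
    then show ?thesis
      using integral_norm_bound_integral[OF has_integral_integrable[OF hi] has_integral_integrable[OF J]]
      unfolding integral_unique[OF hi] integral_unique[OF J] by blast
  qed
  then have "cmod (taylor_coeff h k) * cmod z ^ k \<le> J"
    by (simp add: taylor_coeff_def norm_divide norm_mult norm_power mult.commute)
  moreover have "(\<integral>\<^sup>+\<theta>\<in>{0..1}. ennreal (cmod (h (circ \<theta> * z))) \<partial>lborel) = ennreal J"
    using nn_integral_has_integral_lebesgue[OF _ J]
    by (simp add: mult.commute ennreal_mult'' flip: ennreal_indicator)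
  ultimately show ?thesis by (simp add: ennreal_leI)
qed

text \<open>Move the centre to 0 and integrate the circle estimate with k = 0 over the disc.\<close>

lemma area_mean_value:
  assumes h: "h holomorphic_on ball z0 R" and "R > 0"
  shows "ennreal (pi * R\<^sup>2 * cmod (h z0)) \<le> (\<integral>\<^sup>+z. indicator (ball z0 R) z * ennreal (cmod (h z)) \<partial>lborel)"
proof -
  define g where "g = (\<lambda>w. h (z0 + w))"
  have g: "g holomorphic_on ball 0 R"
    unfolding g_def by (intro holomorphic_on_compose_gen[OF _ h, unfolded o_def] holomorphic_intros) (auto simp: dist_norm)
  have [measurable]: "(\<lambda>z. indicator (ball z0 R) z * ennreal (cmod (h z))) \<in> borel_measurable borel"
    by (intro measurable_indicator_continuous continuous_intros holomorphic_on_imp_continuous_on h) auto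
  have m[measurable]: "(\<lambda>z. indicator (ball 0 R) z * ennreal (cmod (g z))) \<in> borel_measurable borel"
    by (intro measurable_indicator_continuous continuous_intros holomorphic_on_imp_continuous_on g) auto
  have "(\<integral>\<^sup>+z. indicator (ball z0 R) z * ennreal (cmod (h z)) \<partial>lborel)
      = (\<integral>\<^sup>+z. indicator (ball z0 R) (z0 + z) * ennreal (cmod (h (z0 + z))) \<partial>lborel)"
    by (subst lborel_distr_plus[of z0, symmetric], subst nn_integral_distr) auto
  also have "\<dots> = (\<integral>\<^sup>+z. indicator (ball 0 R) z * ennreal (cmod (g z)) \<partial>lborel)"
    by (intro nn_integral_cong) (auto simp: g_def indicator_def dist_norm)
  also have "\<dots> = (\<integral>\<^sup>+z. (\<integral>\<^sup>+\<theta>\<in>{0..1}. indicator (ball 0 R) (circ \<theta> * z) * ennreal (cmod (g (circ \<theta> * z))) \<partial>lborel) \<partial>lborel)"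
    by (rule nn_integral_circle_average[OF m])
  also have "\<dots> \<ge> (\<integral>\<^sup>+z. ennreal (cmod (g 0)) * indicator (ball (0::complex) R) z \<partial>lborel)"
  proof (rule nn_integral_mono)
    fix z :: complex
    show "ennreal (cmod (g 0)) * indicator (ball 0 R) z \<le>
        (\<integral>\<^sup>+\<theta>\<in>{0..1}. indicator (ball 0 R) (circ \<theta> * z) * ennreal (cmod (g (circ \<theta> * z))) \<partial>lborel)"
      using taylor_coeff_le_circle_average[OF g, of z 0] by (auto simp: indicator_def norm_mult taylor_coeff_def)
  qed
  also have "(\<integral>\<^sup>+z. ennreal (cmod (g 0)) * indicator (ball (0::complex) R) z \<partial>lborel) = ennreal (pi * R\<^sup>2 * cmod (h z0))"
    using assms(2) by (simp add: nn_integral_cmult_indicator emeasure_ball g_def unit_ball_vol_2 ennreal_mult'' mult_ac)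
  finally show ?thesis .
qed

text \<open>Integrating this with the optimal \<open>l\<close> gives Jensen's inequality up to a constant.\<close>

lemma le_add_powr:
  fixes x l p :: real
  assumes "x \<ge> 0" "l > 0" "p \<ge> 1"
  shows "x \<le> l + l powr (1 - p) * x powr p"
proof (cases "x \<le> l")
  case True
  then show ?thesis using assms by (simp add: add_increasing2)
next
  case False
  then have "x = x powr (1 - p) * x powr p" using assms by (simp flip: powr_add)
  also have "\<dots> \<le> l powr (1 - p) * x powr p"
    using False assms by (intro mult_right_mono powr_mono2') auto
  finally show ?thesis using assms by linarith
qed

text \<open>The inequality for exponent 1, with |h| split by \<open>le_add_powr\<close> at the level
  of its p-th mean.\<close>

lemma norm_powr_area_mean_value_ge1:
  assumes h: "h holomorphic_on ball z0 R" and "R > 0" and p: "p \<ge> 1"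
  shows "ennreal (cmod (h z0) powr p * R\<^sup>2) \<le> ennreal (2 powr p) *
    (\<integral>\<^sup>+z. indicator (ball z0 R) z * ennreal (cmod (h z) powr p) \<partial>lborel)"
proof -
  define I where "I = (\<integral>\<^sup>+z. indicator (ball z0 R) z * ennreal (cmod (h z) powr p) \<partial>lborel)"
  have "(\<lambda>z. indicator (ball z0 R) z * ennreal (cmod (h z) powr p)) \<in> borel_measurable borel"
    using p by (intro measurable_indicator_continuous continuous_intros continuous_on_powr' holomorphic_on_imp_continuous_on h) auto
  then have mp: "(\<lambda>z. indicator (ball z0 R) z * ennreal (cmod (h z) powr p)) \<in> borel_measurable lborel" by simp
  have [measurable]: "ball z0 R \<in> sets borel" by simp
  have mi: "(\<lambda>z. ennreal l * indicator (ball z0 R) z) \<in> borel_measurable lborel" for l by measurable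
  \<comment> \<open>Stated for positive majorants D of I, because I may be 0 and the level l would
    then vanish; an epsilon leads back to I.\<close>
  have key: "cmod (h z0) powr p * R\<^sup>2 \<le> 2 powr p * D" if D: "I \<le> ennreal D" "D > 0" for D
  proof -
    \<comment> \<open>At this level both terms of the split integrate to at most a multiple of l
      R^2.\<close>
    define l where "l = (D / R\<^sup>2) powr (1 / p)"
    have l: "l > 0" using D assms by (simp add: l_def)
    have lp: "l powr p = D / R\<^sup>2" using D assms by (simp add: l_def powr_powr)
    have l1: "l powr (1 - p) * D = l * R\<^sup>2"
      using l lp \<open>R > 0\<close> D(2) by (simp add: powr_diff field_simps)
    have "ennreal (pi * R\<^sup>2 * cmod (h z0)) \<le> (\<integral>\<^sup>+z. indicator (ball z0 R) z * ennreal (cmod (h z)) \<partial>lborel)"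
      by (rule area_mean_value) fact+
    also have "\<dots> \<le> (\<integral>\<^sup>+z. ennreal l * indicator (ball z0 R) z
        + ennreal (l powr (1 - p)) * (indicator (ball z0 R) z * ennreal (cmod (h z) powr p)) \<partial>lborel)"
    proof (rule nn_integral_mono)
      fix z
      have "ennreal (cmod (h z)) \<le> ennreal (l + l powr (1 - p) * cmod (h z) powr p)"
        using le_add_powr[of "cmod (h z)" l p] l p by (intro ennreal_leI) auto
      then show "indicator (ball z0 R) z * ennreal (cmod (h z)) \<le> ennreal l * indicator (ball z0 R) z
        + ennreal (l powr (1 - p)) * (indicator (ball z0 R) z * ennreal (cmod (h z) powr p))"
        using l by (simp add: indicator_def ennreal_mult)
    qed
    also have "\<dots> = ennreal l * ennreal (pi * R\<^sup>2) + ennreal (l powr (1 - p)) * I"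
      using \<open>R > 0\<close>
      by (simp add: nn_integral_add[OF mi borel_measurable_times_ennreal[OF borel_measurable_const mp]]
          nn_integral_cmult[OF mp] nn_integral_cmult_indicator emeasure_ball unit_ball_vol_2 I_def)
    also have "\<dots> \<le> ennreal l * ennreal (pi * R\<^sup>2) + ennreal (l powr (1 - p)) * ennreal D"
      by (intro add_left_mono mult_left_mono D) auto
    also have "\<dots> = ennreal (l * (pi * R\<^sup>2) + l powr (1 - p) * D)"
      using l D by (simp add: ennreal_mult)
    finally have "pi * R\<^sup>2 * cmod (h z0) \<le> l * (pi * R\<^sup>2) + l * R\<^sup>2"
      using l D by (subst (asm) ennreal_le_iff) (auto simp: l1)
    also have "\<dots> \<le> l * (pi * R\<^sup>2) + l * (pi * R\<^sup>2)"
      using l pi_ge_two by (intro add_left_mono mult_left_mono) (auto simp: mult_le_cancel_right1)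
    also have "\<dots> = pi * R\<^sup>2 * (2 * l)" by simp
    finally have "cmod (h z0) \<le> 2 * l"
      using \<open>R > 0\<close> by (subst (asm) mult_le_cancel_left_pos) auto
    then have "cmod (h z0) powr p \<le> (2 * l) powr p" using p by (intro powr_mono2) auto
    also have "\<dots> = 2 powr p * (D / R\<^sup>2)" using l by (simp add: powr_mult lp)
    finally show ?thesis using \<open>R > 0\<close> by (simp add: field_simps)
  qed
  show ?thesis
  proof (cases "I = \<infinity>")
    case True
    then show ?thesis using I_def by (simp add: ennreal_mult_top)
  next
    case False
    then obtain d where d: "I = ennreal d" "d \<ge> 0" by (cases I) auto
    have "cmod (h z0) powr p * R\<^sup>2 \<le> 2 powr p * d"
    proof (rule field_le_epsilon)
      fix e :: real assume e: "e > 0"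
      have "cmod (h z0) powr p * R\<^sup>2 \<le> 2 powr p * (d + e / 2 powr p)"
        using d e by (intro key) (auto intro: ennreal_leI add_nonneg_pos)
      then show "cmod (h z0) powr p * R\<^sup>2 \<le> 2 powr p * d + e" by (simp add: algebra_simps)
    qed
    then show ?thesis unfolding I_def[symmetric] d(1) using d(2) by (simp add: ennreal_leI flip: ennreal_mult)
  qed
qed

text \<open>Jensen's inequality points the wrong way for p < 1, so the inequality for exponent 1 is
  combined with a maximum argument.\<close>

lemma norm_powr_area_mean_value_le1:
  assumes h: "h holomorphic_on ball z0 R" and "R > 0" and p: "0 < p" "p \<le> 1"
  shows "ennreal (cmod (h z0) powr p * R\<^sup>2) \<le> ennreal (4 * 2 powr (2 / p)) *
    (\<integral>\<^sup>+z. indicator (ball z0 R) z * ennreal (cmod (h z) powr p) \<partial>lborel)"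
proof -
  define I where "I = (\<integral>\<^sup>+z. indicator (ball z0 R) z * ennreal (cmod (h z) powr p) \<partial>lborel)"
  \<comment> \<open>With half the radius the closed disc is compact inside the domain, so the
    maximum below exists.\<close>
  define r where "r = R / 2"
  have r: "r > 0" "r < R" using \<open>R > 0\<close> by (auto simp: r_def)
  \<comment> \<open>At a maximum point \<open>w\<close> of \<open>m\<close> the factor \<open>|h|\<^sup>1\<^sup>-\<^sup>p\<close> is controlled on a ball around \<open>w\<close> by a power of \<open>m w\<close>, which can be divided out.\<close>
  define m where "m = (\<lambda>z. (r - dist z0 z) powr (2 / p) * cmod (h z))"
  have hc: "continuous_on (ball z0 R) h" by (intro holomorphic_on_imp_continuous_on h)
  have "continuous_on (cball z0 r) m"
    unfolding m_def using p r
    by (intro continuous_intros continuous_on_powr' continuous_on_subset[OF hc]) auto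
  then obtain w where w: "w \<in> cball z0 r" "\<And>z. z \<in> cball z0 r \<Longrightarrow> m z \<le> m w"
    using continuous_attains_sup[of "cball z0 r" m] r by auto
  have "(\<lambda>z. indicator (ball z0 R) z * ennreal (cmod (h z) powr p)) \<in> borel_measurable borel"
    using p by (intro measurable_indicator_continuous continuous_intros continuous_on_powr' hc) auto
  then have mp: "(\<lambda>z. indicator (ball z0 R) z * ennreal (cmod (h z) powr p)) \<in> borel_measurable lborel" by simp
  define S where "S = m w"
  have mz0: "m z0 \<le> S" using w(2)[of z0] r by (simp add: S_def)
  have r2: "(r powr (2 / p)) powr p = r\<^sup>2" using r p by (simp add: powr_powr powr_numeral)
  have m0: "(m z0) powr p = r\<^sup>2 * cmod (h z0) powr p"
    using r by (simp add: m_def powr_mult r2)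
  show ?thesis
  proof (cases "S = 0 \<or> I = \<infinity>")
    case True
    then show ?thesis
    proof
      assume "S = 0"
      then have "h z0 = 0" using mz0 r by (simp add: m_def mult_le_0_iff)
      then show ?thesis using p by simp
    next
      assume "I = \<infinity>"
      then show ?thesis using I_def by (simp add: ennreal_mult_top)
    qed
  next
    case False
    then obtain d where d: "I = ennreal d" "d \<ge> 0" by (cases I) auto
    have Spos: "S > 0" using False mz0 r by (auto simp: m_def S_def less_le)
    \<comment> \<open>Half the distance from w to the boundary: on this ball the weight in
      \<open>m\<close> is at least \<open>\<rho> powr (2 / p)\<close>, so comparison with the
      maximum bounds |h|.\<close>
    define \<rho> where "\<rho> = (r - dist z0 w) / 2"
    have rho: "\<rho> > 0" using Spos w(1) by (auto simp: S_def m_def \<rho>_def less_le)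
    have tri: "dist z0 z \<le> dist z0 w + dist w z" for z by (rule dist_triangle)
    have bs: "ball w \<rho> \<subseteq> ball z0 r"
    proof
      fix z assume "z \<in> ball w \<rho>"
      then show "z \<in> ball z0 r" using tri[of z] rho by (simp add: \<rho>_def)
    qed
    have bound: "cmod (h z) \<le> S * \<rho> powr (- 2 / p)" if z: "z \<in> ball w \<rho>" for z
    proof -
      have dz: "dist z0 z < r" using bs z by auto
      have ge: "\<rho> \<le> r - dist z0 z" using tri[of z] z by (simp add: \<rho>_def)
      have "\<rho> powr (2 / p) * cmod (h z) \<le> m z"
        unfolding m_def using rho ge p by (intro mult_right_mono powr_mono2) auto
      also have "\<dots> \<le> S" unfolding S_def using dz by (intro w(2)) auto
      finally show ?thesis using rho by (simp add: powr_minus field_simps)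
    qed
    have "ennreal (pi * \<rho>\<^sup>2 * cmod (h w)) \<le> (\<integral>\<^sup>+z. indicator (ball w \<rho>) z * ennreal (cmod (h z)) \<partial>lborel)"
      using bs r by (intro area_mean_value holomorphic_on_subset[OF h] rho) auto
    also have "\<dots> \<le> (\<integral>\<^sup>+z. ennreal ((S * \<rho> powr (- 2 / p)) powr (1 - p)) * (indicator (ball z0 R) z * ennreal (cmod (h z) powr p)) \<partial>lborel)"
    proof (rule nn_integral_mono)
      fix z
      show "indicator (ball w \<rho>) z * ennreal (cmod (h z)) \<le>
         ennreal ((S * \<rho> powr (- 2 / p)) powr (1 - p)) * (indicator (ball z0 R) z * ennreal (cmod (h z) powr p))"
      proof (cases "z \<in> ball w \<rho>")
        case True
        then have "z \<in> ball z0 R" using bs r by auto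
        moreover have "cmod (h z) \<le> (S * \<rho> powr (- 2 / p)) powr (1 - p) * cmod (h z) powr p"
        proof -
          have "cmod (h z) = cmod (h z) powr (1 - p) * cmod (h z) powr p" by (simp flip: powr_add)
          also have "\<dots> \<le> (S * \<rho> powr (- 2 / p)) powr (1 - p) * cmod (h z) powr p"
            using bound[OF True] p by (intro mult_right_mono powr_mono2) auto
          finally show ?thesis .
        qed
        ultimately show ?thesis using True by (auto simp: simp flip: ennreal_mult intro!: ennreal_leI)
      qed simp
    qed
    also have "\<dots> = ennreal ((S * \<rho> powr (- 2 / p)) powr (1 - p)) * I"
      by (simp add: nn_integral_cmult[OF mp] I_def)
    also have "\<dots> = ennreal ((S * \<rho> powr (- 2 / p)) powr (1 - p) * d)" by (simp add: d ennreal_mult)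
    finally have 1: "pi * \<rho>\<^sup>2 * cmod (h w) \<le> (S * \<rho> powr (- 2 / p)) powr (1 - p) * d"
      using d by (subst (asm) ennreal_le_iff) auto
    have hw: "cmod (h w) = S * (2 * \<rho>) powr (- 2 / p)"
    proof -
      have "r - dist z0 w = 2 * \<rho>" by (simp add: \<rho>_def)
      then have "S = (2 * \<rho>) powr (2 / p) * cmod (h w)" by (simp add: S_def m_def)
      then show ?thesis using rho by (simp add: powr_minus)
    qed
    \<comment> \<open>The leftover \<rho>^2 matches the area of the ball, so every power of \<rho>
      cancels in the comparison below and a bound for S^p remains.\<close>
    have e1: "(S * \<rho> powr (- 2 / p)) powr (1 - p) = S powr (1 - p) * \<rho> powr (- 2 / p) * \<rho>\<^sup>2"
    proof -
      have "(- 2 / p) * (1 - p) = - 2 / p + 2" using p by (simp add: field_simps)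
      then have "(\<rho> powr (- 2 / p)) powr (1 - p) = \<rho> powr (- 2 / p) * \<rho>\<^sup>2"
        using rho unfolding powr_powr by (simp only: powr_add powr_numeral)
      then show ?thesis using Spos rho by (simp add: powr_mult)
    qed
    have e2: "S = S powr (1 - p) * S powr p" using Spos by (simp flip: powr_add)
    have "(S powr (1 - p) * \<rho> powr (- 2 / p) * \<rho>\<^sup>2) * (pi * 2 powr (- 2 / p) * S powr p)
       = pi * \<rho>\<^sup>2 * ((S powr (1 - p) * S powr p) * (2 powr (- 2 / p) * \<rho> powr (- 2 / p)))" by (simp only: mult_ac)
    also have "\<dots> = pi * \<rho>\<^sup>2 * cmod (h w)" using rho by (subst e2[symmetric]) (simp add: hw powr_mult)
    also note 1
    finally have "(S powr (1 - p) * \<rho> powr (- 2 / p) * \<rho>\<^sup>2) * (pi * 2 powr (- 2 / p) * S powr p)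
       \<le> (S powr (1 - p) * \<rho> powr (- 2 / p) * \<rho>\<^sup>2) * d" by (simp only: e1)
    then have "pi * 2 powr (- 2 / p) * S powr p \<le> d"
      using Spos rho by (subst (asm) mult_le_cancel_left_pos) auto
    moreover have "1 * (2 powr (- 2 / p) * S powr p) \<le> pi * (2 powr (- 2 / p) * S powr p)"
      using pi_ge_two by (intro mult_right_mono) auto
    ultimately have "2 powr (- 2 / p) * S powr p \<le> d" by (simp only: mult.assoc mult_1_left)
    then have "S powr p \<le> 2 powr (2 / p) * d" by (simp add: powr_minus field_simps)
    moreover have "(m z0) powr p \<le> S powr p" using mz0 p by (intro powr_mono2) (auto simp: m_def)
    ultimately have "cmod (h z0) powr p * R\<^sup>2 \<le> 4 * 2 powr (2 / p) * d"
      unfolding m0 by (simp add: r_def power2_eq_square field_simps)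
    then show ?thesis unfolding I_def[symmetric] d(1) using d(2) by (simp add: ennreal_leI flip: ennreal_mult)
  qed
qed

lemma norm_powr_area_mean_value:
  fixes p :: real
  assumes "p > 0"
  obtains C :: real where "C > 0"
    "\<And>h z0 R. h holomorphic_on ball z0 R \<Longrightarrow> R > 0 \<Longrightarrow>
      ennreal (cmod (h z0) powr p * R\<^sup>2) \<le> ennreal C *
        (\<integral>\<^sup>+z. indicator (ball z0 R) z * ennreal (cmod (h z) powr p) \<partial>lborel)"
proof (cases "p \<ge> 1")
  case True
  show ?thesis by (rule that[of "2 powr p"]) (use norm_powr_area_mean_value_ge1 True in auto)
next
  case False
  show ?thesis by (rule that[of "4 * 2 powr (2 / p)"]) (use norm_powr_area_mean_value_le1 False assms in auto)
qed

text \<open>\<alpha> may have either sign, so either endpoint may give the smaller power; hence min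
  and max.\<close>

lemma powr_between:
  fixes x y a b \<alpha> :: real
  assumes "0 < a" "0 < x" "a * x \<le> y" "y \<le> b * x"
  shows "y powr \<alpha> \<ge> min (a powr \<alpha>) (b powr \<alpha>) * x powr \<alpha>"
    and "y powr \<alpha> \<le> max (a powr \<alpha>) (b powr \<alpha>) * x powr \<alpha>"
proof -
  have y: "0 < y" using assms by (smt (verit) mult_pos_pos)
  have b: "0 < b" using assms y by (smt (verit) mult_nonpos_nonneg)
  have ab: "(a * x) powr \<alpha> = a powr \<alpha> * x powr \<alpha>" "(b * x) powr \<alpha> = b powr \<alpha> * x powr \<alpha>"
    using assms b by (simp_all add: powr_mult)
  have xx: "x powr \<alpha> \<ge> 0" by simp
  have "((a * x) powr \<alpha> \<le> y powr \<alpha> \<and> y powr \<alpha> \<le> (b * x) powr \<alpha>) \<or>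
        ((b * x) powr \<alpha> \<le> y powr \<alpha> \<and> y powr \<alpha> \<le> (a * x) powr \<alpha>)"
    using assms y b powr_mono2[of \<alpha> "a * x" y] powr_mono2[of \<alpha> y "b * x"]
      powr_mono2'[of \<alpha> "a * x" y] powr_mono2'[of \<alpha> y "b * x"]
    by (cases "\<alpha> \<ge> 0") auto
  moreover have "min (a powr \<alpha>) (b powr \<alpha>) * x powr \<alpha> \<le> a powr \<alpha> * x powr \<alpha>"
    "min (a powr \<alpha>) (b powr \<alpha>) * x powr \<alpha> \<le> b powr \<alpha> * x powr \<alpha>"
    "max (a powr \<alpha>) (b powr \<alpha>) * x powr \<alpha> \<ge> a powr \<alpha> * x powr \<alpha>"
    "max (a powr \<alpha>) (b powr \<alpha>) * x powr \<alpha> \<ge> b powr \<alpha> * x powr \<alpha>"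
    by (intro mult_right_mono xx; simp)+
  ultimately show "y powr \<alpha> \<ge> min (a powr \<alpha>) (b powr \<alpha>) * x powr \<alpha>"
    "y powr \<alpha> \<le> max (a powr \<alpha>) (b powr \<alpha>) * x powr \<alpha>"
    unfolding ab by linarith+
qed

text \<open>On the ball whose radius is half the distance to the circle the weight is constant up to
  a factor, so the unweighted inequality absorbs it.\<close>

lemma weighted_local_bound:
  fixes p \<alpha> :: real
  assumes "p > 0"
  obtains C :: real where "C > 0"
    "\<And>h z. h holomorphic_on ball 0 1 \<Longrightarrow> z \<in> ball 0 1 \<Longrightarrow>
      ennreal (cmod (h z) powr p * (1 - cmod z) powr (\<alpha> + 2)) \<le> ennreal C *
        (\<integral>\<^sup>+w. indicator (ball z ((1 - cmod z) / 2)) w * ennreal (cmod (h w) powr p * (1 - (cmod w)\<^sup>2) powr \<alpha>) \<partial>lborel)"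
proof -
  obtain C where C: "C > 0" "\<And>h z0 R. h holomorphic_on ball z0 R \<Longrightarrow> R > 0 \<Longrightarrow>
      ennreal (cmod (h z0) powr p * R\<^sup>2) \<le> ennreal C *
        (\<integral>\<^sup>+z. indicator (ball z0 R) z * ennreal (cmod (h z) powr p) \<partial>lborel)"
    by (rule norm_powr_area_mean_value[OF assms]) (rule that)
  \<comment> \<open>On that ball 1 - |w|^2 lies between 1/2 and 3 times 1 - |z|: the factor 1 - |w|
    between 1/2 and 3/2 of it, the factor 1 + |w| between 1 and 2.\<close>
  define c where "c = min ((1/2) powr \<alpha>) (3 powr \<alpha>)"
  have c: "c > 0" by (auto simp: c_def)
  show ?thesis
  proof (rule that[of "4 * C / c"])
    show "4 * C / c > 0" using C c by simp
    fix h z assume h: "h holomorphic_on ball 0 1" and z: "z \<in> ball (0::complex) 1"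
    define x where "x = 1 - cmod z"
    have x: "x > 0" using z by (simp add: x_def)
    define F where "F = (\<lambda>w. indicator (ball z (x / 2)) w * ennreal (cmod (h w) powr p * (1 - (cmod w)\<^sup>2) powr \<alpha>))"
    have nw: "cmod w < cmod z + x / 2" "cmod z < cmod w + x / 2" if "w \<in> ball z (x / 2)" for w
    proof -
      have "\<bar>cmod w - cmod z\<bar> \<le> dist z w" using norm_triangle_ineq3[of w z] by (simp add: dist_norm norm_minus_commute)
      moreover have "dist z w < x / 2" using that by simp
      ultimately show "cmod w < cmod z + x / 2" "cmod z < cmod w + x / 2" by linarith+
    qed
    have sub: "ball z (x / 2) \<subseteq> ball 0 1"
    proof
      fix w assume w: "w \<in> ball z (x / 2)"
      have "cmod w < 1" using nw[OF w] x x_def by linarith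
      then show "w \<in> ball 0 1" by simp
    qed
    have hb: "h holomorphic_on ball z (x / 2)" by (rule holomorphic_on_subset[OF h sub])
    have mF: "F \<in> borel_measurable borel"
    proof -
      have "(cmod w)\<^sup>2 \<noteq> 1" if "w \<in> ball z (x / 2)" for w
        using subsetD[OF sub that] norm_ge_zero[of w] by (auto simp: power2_eq_1_iff simp del: norm_ge_zero)
      then show ?thesis
      unfolding F_def using assms
      by (intro measurable_indicator_continuous continuous_intros continuous_on_powr' holomorphic_on_imp_continuous_on hb) 
         auto
    qed
    have w: "c * x powr \<alpha> \<le> (1 - (cmod w)\<^sup>2) powr \<alpha>" if "w \<in> ball z (x / 2)" for w
    proof -
      have 1: "cmod w < 1" using subsetD[OF sub that] by simp
      have eq: "1 - (cmod w)\<^sup>2 = (1 - cmod w) * (1 + cmod w)" by (simp add: power2_eq_square algebra_simps)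
      have "1/2 * x \<le> (1 - cmod w) * 1" using nw[OF that] x_def by argo
      also have "\<dots> \<le> (1 - cmod w) * (1 + cmod w)" using 1 by (intro mult_left_mono) auto
      finally have a: "1/2 * x \<le> 1 - (cmod w)\<^sup>2" unfolding eq .
      have "1 - cmod w \<le> 3/2 * x" using nw[OF that] x_def by argo
      then have "(1 - cmod w) * (1 + cmod w) \<le> (3/2 * x) * 2"
        using 1 x by (intro mult_mono) auto
      then have "1 - (cmod w)\<^sup>2 \<le> 3 * x" unfolding eq by simp
      from powr_between(1)[OF _ x a this] show ?thesis by (simp add: c_def)
    qed
    have mf: "(\<lambda>w. indicator (ball z (x / 2)) w * ennreal (cmod (h w) powr p)) \<in> borel_measurable borel"
      using assms by (intro measurable_indicator_continuous continuous_intros continuous_on_powr'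
            holomorphic_on_imp_continuous_on hb) auto
    have "ennreal (c * x powr \<alpha>) * ennreal (cmod (h z) powr p * (x / 2)\<^sup>2) \<le> ennreal (c * x powr \<alpha>) * (ennreal C *
        (\<integral>\<^sup>+w. indicator (ball z (x / 2)) w * ennreal (cmod (h w) powr p) \<partial>lborel))"
      using x by (intro mult_left_mono C hb) auto
    also have "\<dots> = ennreal C * (\<integral>\<^sup>+w. ennreal (c * x powr \<alpha>) * (indicator (ball z (x / 2)) w * ennreal (cmod (h w) powr p)) \<partial>lborel)"
      by (simp add: nn_integral_cmult mf mult.left_commute)
    also have "\<dots> \<le> ennreal C * (\<integral>\<^sup>+w. F w \<partial>lborel)"
    proof (intro mult_left_mono nn_integral_mono)
      fix u
      have "c * x powr \<alpha> * cmod (h u) powr p \<le> cmod (h u) powr p * (1 - (cmod u)\<^sup>2) powr \<alpha>" if "u \<in> ball z (x / 2)"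
        using mult_right_mono[OF w[OF that], of "cmod (h u) powr p"] by (simp add: mult_ac)
      then show "ennreal (c * x powr \<alpha>) * (indicator (ball z (x / 2)) u * ennreal (cmod (h u) powr p)) \<le> F u"
        using c by (auto simp: F_def indicator_def simp flip: ennreal_mult intro!: ennreal_leI)
    qed auto
    finally have *: "ennreal (c * x powr \<alpha> * (cmod (h z) powr p * (x / 2)\<^sup>2)) \<le> ennreal C * (\<integral>\<^sup>+w. F w \<partial>lborel)"
      using c by (simp add: ennreal_mult)
    have "ennreal (cmod (h z) powr p * x powr (\<alpha> + 2)) = ennreal (4 / c) * ennreal (c * x powr \<alpha> * (cmod (h z) powr p * (x / 2)\<^sup>2))"
      using c x by (subst ennreal_mult[symmetric]) (auto simp: powr_add powr_numeral power2_eq_square field_simps)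
    also have "\<dots> \<le> ennreal (4 / c) * (ennreal C * (\<integral>\<^sup>+w. F w \<partial>lborel))"
      by (intro mult_left_mono *) auto
    also have "\<dots> = ennreal (4 * C / c) * (\<integral>\<^sup>+w. F w \<partial>lborel)"
      using C c by (simp add: ennreal_mult[symmetric] mult.assoc[symmetric])
    finally show "ennreal (cmod (h z) powr p * (1 - cmod z) powr (\<alpha> + 2)) \<le> ennreal (4 * C / c) *
        (\<integral>\<^sup>+w. indicator (ball z ((1 - cmod z) / 2)) w * ennreal (cmod (h w) powr p * (1 - (cmod w)\<^sup>2) powr \<alpha>) \<partial>lborel)"
      by (simp add: F_def x_def)
  qed
qed

text \<open>The disc of radius sqrt x has area pi x, so |z|^2 is uniformly distributed. Half-lines
  determine the image measure.\<close>

lemma nn_integral_radial: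
  fixes \<phi> :: "real \<Rightarrow> ennreal"
  assumes [measurable]: "\<phi> \<in> borel_measurable borel"
  shows "(\<integral>\<^sup>+z. indicator (ball (0::complex) 1) z * \<phi> ((cmod z)\<^sup>2) \<partial>lborel) = ennreal pi * (\<integral>\<^sup>+u\<in>{0..<1}. \<phi> u \<partial>lborel)"
proof -
  define M where "M = distr (density lborel (indicator (ball (0::complex) 1))) borel (\<lambda>z. (cmod z)\<^sup>2)"
  define N where "N = density lborel (\<lambda>u::real. ennreal pi * indicator {0..<1} u)"
  have em: "emeasure M {x<..} = emeasure lborel (ball 0 1 \<inter> {z. x < (cmod z)\<^sup>2})" for x
  proof -
    have [measurable]: "{z::complex. x < (cmod z)\<^sup>2} \<in> sets borel" "ball (0::complex) 1 \<in> sets borel"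
      by measurable
    have "emeasure M {x<..} = emeasure (density lborel (indicator (ball (0::complex) 1))) {z. x < (cmod z)\<^sup>2}"
      unfolding M_def by (subst emeasure_distr) (auto simp: vimage_def)
    also have "\<dots> = (\<integral>\<^sup>+z. indicator (ball 0 1) z * indicator {z. x < (cmod z)\<^sup>2} z \<partial>lborel)"
      by (rule emeasure_density) auto
    also have "\<dots> = (\<integral>\<^sup>+z. indicator (ball 0 1 \<inter> {z. x < (cmod z)\<^sup>2}) z \<partial>lborel)"
      by (simp only: indicator_inter_arith)
    also have "\<dots> = emeasure lborel (ball 0 1 \<inter> {z. x < (cmod z)\<^sup>2})"
      by (rule nn_integral_indicator) measurable
    finally show ?thesis .
  qed
  have en: "emeasure N {x<..} = ennreal pi * emeasure lborel ({0..<1} \<inter> {x<..})" for x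
    unfolding N_def by (auto simp: emeasure_density nn_integral_cmult mult.assoc simp flip: indicator_inter_arith)
  have b1: "emeasure lborel (ball 0 1 :: complex set) = ennreal pi" by (simp add: emeasure_ball unit_ball_vol_2)
  have "M = N"
  proof (rule measure_eqI_lessThan)
    show "sets M = sets borel" "sets N = sets borel" by (auto simp: M_def N_def)
    show "emeasure M {x<..} < \<infinity>" for x
    proof -
      have "emeasure M {x<..} \<le> emeasure lborel (ball 0 1 :: complex set)" unfolding em by (rule emeasure_mono) auto
      then show ?thesis using b1 by (simp add: le_less_trans)
    qed
    show "emeasure M {x<..} = emeasure N {x<..}" for x
    proof -
      consider "x < 0" | "0 \<le> x" "x < 1" | "x \<ge> 1" by linarith
      then show ?thesis
      proof cases
        case 1
        then have "ball 0 1 \<inter> {z::complex. x < (cmod z)\<^sup>2} = ball 0 1" "{0..<1} \<inter> {x<..} = {0..<1}"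
          using zero_le_power2 by (auto intro: less_le_trans)
        then show ?thesis unfolding em en by (simp add: b1)
      next
        case 2
        have iff: "(cmod z)\<^sup>2 \<le> x \<longleftrightarrow> cmod z \<le> sqrt x" for z
          using 2 by (metis norm_ge_zero real_le_rsqrt real_sqrt_le_iff real_sqrt_unique sqrt_le_D)
        have "ball 0 1 \<inter> {z::complex. x < (cmod z)\<^sup>2} = ball 0 1 - cball 0 (sqrt x)" "{0..<1} \<inter> {x<..} = {x<..<1}"
          using 2 iff by (auto simp: not_le[symmetric])
        moreover have "emeasure lborel (ball 0 1 - cball (0::complex) (sqrt x)) = ennreal pi - ennreal (pi * x)"
          using 2 real_sqrt_lt_1_iff[of x]
          by (subst emeasure_Diff) (auto simp: b1 emeasure_cball unit_ball_vol_2 simp del: real_sqrt_lt_1_iff)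
        ultimately show ?thesis unfolding em en using 2
          by (simp add: ennreal_minus right_diff_distrib flip: ennreal_mult)
      next
        case 3
        have "ball 0 1 \<inter> {z::complex. x < (cmod z)\<^sup>2} = {}" "{0..<1} \<inter> {x<..} = {}"
        proof -
          have "(cmod z)\<^sup>2 \<le> 1" if "cmod z < 1" for z using that by (simp add: power_le_one)
          then show "ball 0 1 \<inter> {z::complex. x < (cmod z)\<^sup>2} = {}" using 3 by force
        qed (use 3 in auto)
        then show ?thesis unfolding em en by simp
      qed
    qed
  qed
  have "(\<integral>\<^sup>+z. indicator (ball (0::complex) 1) z * \<phi> ((cmod z)\<^sup>2) \<partial>lborel) = (\<integral>\<^sup>+u. \<phi> u \<partial>M)"
  proof -
    have [measurable]: "ball (0::complex) 1 \<in> sets borel" by simp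
    show ?thesis
      unfolding M_def by (subst nn_integral_distr, measurable, subst nn_integral_density) measurable
  qed
  also have "\<dots> = (\<integral>\<^sup>+u. ennreal pi * (\<phi> u * indicator {0..<1} u) \<partial>lborel)"
    unfolding \<open>M = N\<close> N_def by (subst nn_integral_density) (auto simp: mult_ac)
  also have "\<dots> = ennreal pi * (\<integral>\<^sup>+u\<in>{0..<1}. \<phi> u \<partial>lborel)"
    by (rule nn_integral_cmult) measurable
  finally show ?thesis .
qed

subsection \<open>Growth and Taylor coefficients in weighted Bergman spaces\<close>

lemma weighted_integral_eq_A_int:
  assumes "\<alpha> > -1" "p > 0" "h holomorphic_on ball 0 1"
  shows "(\<integral>\<^sup>+ z. indicator (ball 0 1) z * ennreal (cmod (h z) powr p * (1 - (cmod z)\<^sup>2) powr \<alpha>) \<partial>lborel)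
      = ennreal (pi / (\<alpha> + 1)) * A_int p \<alpha> h"
    and "(\<lambda>z. indicator (ball 0 1) z * ennreal (cmod (h z) powr p * (1 - (cmod z)\<^sup>2) powr \<alpha>)) \<in> borel_measurable borel"
proof -
  have "(cmod w)\<^sup>2 \<noteq> 1" if "w \<in> ball 0 1" for w
    using that norm_ge_zero[of w] by (auto simp: power2_eq_1_iff simp del: norm_ge_zero)
  then show m: "(\<lambda>z. indicator (ball 0 1) z * ennreal (cmod (h z) powr p * (1 - (cmod z)\<^sup>2) powr \<alpha>)) \<in> borel_measurable borel"
    using assms(2) by (intro measurable_indicator_continuous continuous_intros continuous_on_powr'
            holomorphic_on_imp_continuous_on assms) auto
  have "(\<integral>\<^sup>+ z. indicator (ball 0 1) z * ennreal (cmod (h z) powr p * (1 - (cmod z)\<^sup>2) powr \<alpha> / pi) \<partial>lborel)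
     = (\<integral>\<^sup>+ z. ennreal (1 / pi) * (indicator (ball 0 1) z * ennreal (cmod (h z) powr p * (1 - (cmod z)\<^sup>2) powr \<alpha>)) \<partial>lborel)"
    by (intro nn_integral_cong) (auto simp: indicator_def simp flip: ennreal_mult)
  also have "\<dots> = ennreal (1 / pi) * (\<integral>\<^sup>+ z. (indicator (ball 0 1) z * ennreal (cmod (h z) powr p * (1 - (cmod z)\<^sup>2) powr \<alpha>)) \<partial>lborel)"
    by (rule nn_integral_cmult) (use m in simp)
  finally have "A_int p \<alpha> h = ennreal ((\<alpha> + 1) / pi) * (\<integral>\<^sup>+ z. (indicator (ball 0 1) z * ennreal (cmod (h z) powr p * (1 - (cmod z)\<^sup>2) powr \<alpha>)) \<partial>lborel)"
    using assms(1) by (simp add: A_int_def ennreal_mult[symmetric] mult.assoc[symmetric])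
  then show "(\<integral>\<^sup>+ z. indicator (ball 0 1) z * ennreal (cmod (h z) powr p * (1 - (cmod z)\<^sup>2) powr \<alpha>) \<partial>lborel)
      = ennreal (pi / (\<alpha> + 1)) * A_int p \<alpha> h"
    using assms(1) by (simp add: ennreal_mult[symmetric] mult.assoc[symmetric])
qed

lemma A_int_eq:
  assumes "\<alpha> > -1" "p > 0" "h holomorphic_on ball 0 1"
  shows "A_int p \<alpha> h = ennreal ((\<alpha> + 1) / pi) *
    (\<integral>\<^sup>+ z. indicator (ball 0 1) z * ennreal (cmod (h z) powr p * (1 - (cmod z)\<^sup>2) powr \<alpha>) \<partial>lborel)"
  unfolding weighted_integral_eq_A_int(1)[OF assms] using assms(1) by (simp add: mult.assoc[symmetric] ennreal_mult[symmetric])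

text \<open>Enlarging the ball of the local bound to the whole disc. It serves the coefficient bound
  for p < 1, the normal family argument and the necessity part.\<close>

lemma growth_estimate:
  fixes p \<alpha> :: real
  assumes "p > 0" "\<alpha> > -1"
  obtains C :: real where "C > 0"
    "\<And>h z. h holomorphic_on ball 0 1 \<Longrightarrow> z \<in> ball 0 1 \<Longrightarrow>
      ennreal (cmod (h z) powr p * (1 - cmod z) powr (\<alpha> + 2)) \<le> ennreal C * A_int p \<alpha> h"
proof -
  obtain C where C: "C > 0" "\<And>h z. h holomorphic_on ball 0 1 \<Longrightarrow> z \<in> ball 0 1 \<Longrightarrow>
      ennreal (cmod (h z) powr p * (1 - cmod z) powr (\<alpha> + 2)) \<le> ennreal C *
        (\<integral>\<^sup>+w. indicator (ball z ((1 - cmod z) / 2)) w * ennreal (cmod (h w) powr p * (1 - (cmod w)\<^sup>2) powr \<alpha>) \<partial>lborel)"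
    by (rule weighted_local_bound[OF assms(1), of \<alpha>]) (rule that)
  show ?thesis
  proof (rule that[of "C * (pi / (\<alpha> + 1))"])
    show "C * (pi / (\<alpha> + 1)) > 0" using C assms by simp
    fix h and z :: complex assume h: "h holomorphic_on ball 0 1" and z: "z \<in> ball 0 1"
    have sub: "ball z ((1 - cmod z) / 2) \<subseteq> ball 0 1"
    proof
      fix w assume "w \<in> ball z ((1 - cmod z) / 2)"
      then have "dist z w < (1 - cmod z) / 2" by simp
      moreover have "cmod w \<le> cmod z + dist z w" using norm_triangle_ineq[of z "w - z"] by (simp add: dist_norm norm_minus_commute)
      moreover have "cmod z < 1" using z by simp
      ultimately have "cmod w < 1" by argo
      then show "w \<in> ball 0 1" by simp
    qed
    have "ennreal (cmod (h z) powr p * (1 - cmod z) powr (\<alpha> + 2)) \<le> ennreal C *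
        (\<integral>\<^sup>+w. indicator (ball z ((1 - cmod z) / 2)) w * ennreal (cmod (h w) powr p * (1 - (cmod w)\<^sup>2) powr \<alpha>) \<partial>lborel)"
      by (rule C) fact+
    also have "\<dots> \<le> ennreal C * (\<integral>\<^sup>+w. indicator (ball 0 1) w * ennreal (cmod (h w) powr p * (1 - (cmod w)\<^sup>2) powr \<alpha>) \<partial>lborel)"
      using sub by (intro mult_left_mono nn_integral_mono mult_right_mono) (auto simp: indicator_def)
    also have "\<dots> = ennreal (C * (pi / (\<alpha> + 1))) * A_int p \<alpha> h"
      unfolding weighted_integral_eq_A_int(1)[OF assms(2,1) h] using C(1) assms by (subst ennreal_mult) (simp_all add: mult.assoc)
    finally show "ennreal (cmod (h z) powr p * (1 - cmod z) powr (\<alpha> + 2)) \<le> ennreal (C * (pi / (\<alpha> + 1))) * A_int p \<alpha> h" .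
  qed
qed

text \<open>The inverse of k/(k+2) is 1 + 2/k, which is at most exp (2/k). The shift by 2 keeps the
  inner radius nonnegative at k = 0.\<close>

lemma power_annulus_lower:
  fixes k :: nat
  assumes "x \<ge> 1 - 2 / real (k + 2)"
  shows "x ^ k \<ge> exp (- 2)"
proof (cases "k = 0")
  case False
  have e: "1 - 2 / real (k + 2) = real k / (k + 2)" by (simp add: field_simps)
  have pos: "0 < real k / (k + 2)" using False by simp
  have "1 + 2 / real k \<le> exp (2 / real k)" by (rule exp_ge_add_one_self)
  moreover have "1 + 2 / real k = inverse (real k / (k + 2))" using False by (simp add: field_simps)
  ultimately have "inverse (real k / (k + 2)) \<le> exp (2 / real k)" by simp
  then have "inverse (exp (2 / real k)) \<le> inverse (inverse (real k / (k + 2)))"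
    by (rule le_imp_inverse_le[OF _ positive_imp_inverse_positive[OF pos]])
  then have "exp (- (2 / real k)) \<le> real k / (k + 2)"
    by (simp only: inverse_inverse_eq exp_minus)
  then have "exp (- (2 / real k)) \<le> x" using assms e by simp
  then have "exp (- (2 / real k)) ^ k \<le> x ^ k" by (intro power_mono) auto
  moreover have "exp (- (2 / real k)) ^ k = exp (- 2)" using False by (simp flip: exp_of_nat_mult)
  ultimately show ?thesis by simp
qed auto

text \<open>The order in k allowed for Taylor coefficients; the branches agree at p = 1. For p \<ge>
  1 integral means near radius 1 - 1/k decide, for p < 1 pointwise growth has to help.\<close>

definition coeff_exponent :: "real \<Rightarrow> real \<Rightarrow> real" where
  "coeff_exponent p \<alpha> = (if p \<ge> 1 then (\<alpha> + 1) / p else (\<alpha> + 2) / p - 1)"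

text \<open>Integrate the circle estimate over an annulus at distance about 1/k from the circle.
  There |z| ^ k is bounded below and the weight is comparable to a power of k, so finiteness of
  \<open>A_int\<close> is enough.\<close>

lemma taylor_coeff_bound_of_A_int:
  fixes p \<alpha> :: real
  assumes p: "p > 0" and \<alpha>: "\<alpha> > -1" and h: "h holomorphic_on ball 0 1" and fin: "A_int p \<alpha> h < \<infinity>"
  obtains C where "C > 0" "\<And>k. cmod (taylor_coeff h k) \<le> C * real (k + 2) powr coeff_exponent p \<alpha>"
proof -
  define F where "F = (\<lambda>z. indicator (ball 0 1) z * ennreal (cmod (h z) powr p * (1 - (cmod z)\<^sup>2) powr \<alpha>))"
  have mF: "F \<in> borel_measurable borel" unfolding F_def by (rule weighted_integral_eq_A_int(2)[OF \<alpha> p h])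
  have "(\<integral>\<^sup>+z. F z \<partial>lborel) < \<infinity>"
    unfolding F_def weighted_integral_eq_A_int(1)[OF \<alpha> p h] using fin by (simp add: ennreal_mult_less_top)
  then obtain M where M: "(\<integral>\<^sup>+z. F z \<partial>lborel) = ennreal M" "M \<ge> 0"
    by (cases "(\<integral>\<^sup>+z. F z \<partial>lborel)") auto
  obtain a where a: "A_int p \<alpha> h = ennreal a" "a \<ge> 0" using fin by (cases "A_int p \<alpha> h") auto
  obtain C0 where C0: "C0 > 0" "\<And>h z. h holomorphic_on ball 0 1 \<Longrightarrow> z \<in> ball 0 1 \<Longrightarrow>
      ennreal (cmod (h z) powr p * (1 - cmod z) powr (\<alpha> + 2)) \<le> ennreal C0 * A_int p \<alpha> h"
    by (rule growth_estimate[OF p \<alpha>]) (rule that)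
  define G where "G = (C0 * a) powr (1 / p)"
  have G0: "G \<ge> 0" by (simp add: G_def)
  have growth: "cmod (h z) \<le> G * (1 - cmod z) powr (- (\<alpha> + 2) / p)" if "cmod z < 1" for z
  proof -
    have "ennreal (cmod (h z) powr p * (1 - cmod z) powr (\<alpha> + 2)) \<le> ennreal (C0 * a)"
      using C0(2)[OF h, of z] that C0(1) a by (simp add: ennreal_mult)
    then have "cmod (h z) powr p * (1 - cmod z) powr (\<alpha> + 2) \<le> C0 * a"
      using C0(1) a by (subst (asm) ennreal_le_iff) auto
    then have "cmod (h z) powr p \<le> C0 * a * (1 - cmod z) powr (- (\<alpha> + 2))"
      using that by (subst powr_minus) (simp add: field_simps)
    then have "(cmod (h z) powr p) powr (1 / p) \<le> (C0 * a * (1 - cmod z) powr (- (\<alpha> + 2))) powr (1 / p)"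
      using p by (intro powr_mono2) auto
    then show ?thesis using p C0(1) a by (simp add: powr_powr powr_mult G_def)
  qed
  \<comment> \<open>On the annulus used below n (1 - |z|^2) lies between 1 and 4.\<close>
  define c where "c = min 1 (4 powr \<alpha>)"
  have c: "c > 0" by (simp add: c_def)
  define \<kappa> where "\<kappa> = coeff_exponent p \<alpha>"
  \<comment> \<open>On the annulus the integrand satisfies \<open>|h| \<le> l + L |h|\<^sup>p\<close>, which replaces Hoelder for \<open>p \<ge> 1\<close> and uses the growth of \<open>h\<close> for \<open>p < 1\<close>.\<close>
  define l where "l = (\<lambda>n::real. if p \<ge> 1 then n powr ((\<alpha> + 1) / p) else 0)"
  define L where "L = (\<lambda>n::real. if p \<ge> 1 then n powr ((\<alpha> + 1) / p * (1 - p)) else G powr (1 - p) * n powr ((\<alpha> + 2) / p * (1 - p)))"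
  define K where "K = (if p \<ge> 1 then 1 else G powr (1 - p))"
  \<comment> \<open>The annulus has area of order 1/n, so dividing by it multiplies the second term
    by n. After that both terms have at most the order \<open>n powr \<kappa>\<close>.\<close>
  have lK: "l n \<le> n powr \<kappa>" "l n \<ge> 0" "L n \<ge> 0" "L n * n powr \<alpha> * n = K * n powr \<kappa>" if "n > 0" for n
  proof -
    have 1: "(\<alpha> + 1) / p * (1 - p) + \<alpha> + 1 = (\<alpha> + 1) / p" "(\<alpha> + 2) / p * (1 - p) + \<alpha> + 1 = (\<alpha> + 2) / p - 1"
      using p by (simp_all add: field_simps)
    show "l n \<le> n powr \<kappa>" "l n \<ge> 0" "L n \<ge> 0" by (auto simp: l_def L_def \<kappa>_def coeff_exponent_def)
    have n1: "x * n powr \<alpha> * n = x * n powr (\<alpha> + 1)" for x using that by (simp add: powr_add)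
    have "n powr ((\<alpha> + 1) / p * (1 - p)) * n powr (\<alpha> + 1) = n powr ((\<alpha> + 1) / p)"
      "n powr ((\<alpha> + 2) / p * (1 - p)) * n powr (\<alpha> + 1) = n powr ((\<alpha> + 2) / p - 1)"
      by (simp_all only: powr_add[symmetric] add.assoc[symmetric] 1)
    then show "L n * n powr \<alpha> * n = K * n powr \<kappa>"
      unfolding n1 L_def K_def \<kappa>_def coeff_exponent_def by (simp only: mult.assoc split: if_split) simp
  qed
  have hl: "cmod (h z) \<le> l n + L n * cmod (h z) powr p" if "n > 0" "1 / n < 1 - cmod z" "cmod z < 1" for z n
  proof (cases "p \<ge> 1")
    case True
    then show ?thesis
      using le_add_powr[of "cmod (h z)" "n powr ((\<alpha> + 1) / p)" p] that by (simp add: l_def L_def powr_powr)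
  next
    case False
    have "cmod (h z) \<le> G * (1 - cmod z) powr (- (\<alpha> + 2) / p)" by (rule growth) fact
    also have "\<dots> \<le> G * (1 / n) powr (- (\<alpha> + 2) / p)"
    proof -
      have "- (\<alpha> + 2) / p \<le> 0" using p \<alpha> by (simp add: divide_nonpos_pos)
      then show ?thesis using that G0 by (intro mult_left_mono powr_mono2') auto
    qed
    also have "(1 / n) powr (- (\<alpha> + 2) / p) = n powr ((\<alpha> + 2) / p)"
      using that powr_minus_divide[of n "(\<alpha> + 2) / p"] by (simp add: powr_divide minus_divide_left)
    finally have b: "cmod (h z) \<le> G * n powr ((\<alpha> + 2) / p)" .
    have "cmod (h z) = cmod (h z) powr (1 - p) * cmod (h z) powr p" by (simp flip: powr_add)
    also have "\<dots> \<le> (G * n powr ((\<alpha> + 2) / p)) powr (1 - p) * cmod (h z) powr p"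
      using b False by (intro mult_right_mono powr_mono2) auto
    finally show ?thesis using False G0 by (simp add: l_def L_def powr_mult powr_powr)
  qed
  have bound: "cmod (taylor_coeff h k) \<le> (2 * exp 2 * (2 + K * M / c)) * real (k + 2) powr \<kappa>" for k
  proof -
    define n where "n = real (k + 2)"
    have n: "n \<ge> 2" by (simp add: n_def)
    define S where "S = ball (0::complex) (1 - 1 / n) - cball 0 (1 - 2 / n)"
    have S[measurable]: "S \<in> sets borel" by (simp add: S_def)
    have Sin: "z \<in> S \<longleftrightarrow> 1 - 2 / n < cmod z \<and> cmod z < 1 - 1 / n" for z by (auto simp: S_def)
    have emS: "emeasure lborel S = ennreal (pi / n * (2 - 3 / n))"
    proof -
      have "1 - 2 / n < 1 - 1 / n" "0 \<le> 1 - 2 / n" "0 < 1 - 1 / n" using n by (auto simp: field_simps)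
      then have "emeasure lborel S = ennreal (pi * (1 - 1 / n)\<^sup>2) - ennreal (pi * (1 - 2 / n)\<^sup>2)"
        unfolding S_def by (subst emeasure_Diff) (auto simp: emeasure_ball emeasure_cball unit_ball_vol_2)
      also have "\<dots> = ennreal (pi * (1 - 1 / n)\<^sup>2 - pi * (1 - 2 / n)\<^sup>2)"
        by (simp add: ennreal_minus)
      also have "pi * (1 - 1 / n)\<^sup>2 - pi * (1 - 2 / n)\<^sup>2 = pi / n * (2 - 3 / n)"
        using n by (simp add: field_simps power2_eq_square)
      finally show ?thesis .
    qed
    have 3: "3 / n \<le> 3/2" using n by (simp add: field_simps)
    have emS1: "pi / (2 * n) \<le> pi / n * (2 - 3 / n)" 
    proof -
      have "pi / n * (1/2) \<le> pi / n * (2 - 3 / n)" using n 3 by (intro mult_left_mono) auto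
      then show ?thesis by simp
    qed
    have emS2: "pi / n * (2 - 3 / n) \<le> 2 * pi / n"
    proof -
      have "pi / n * (2 - 3 / n) \<le> pi / n * 2" using n by (intro mult_left_mono) auto
      then show ?thesis by simp
    qed
    have SF: "indicator S z * ennreal (cmod (h z)) \<le> ennreal (l n) * indicator S z + ennreal (L n * n powr \<alpha> / c) * F z" for z
    proof (cases "z \<in> S")
      case True
      then have z: "1 - 2 / n < cmod z" "cmod z < 1 - 1 / n" by (auto simp: Sin)
      have "1 / n > 0" using n by simp
      then have z1: "cmod z < 1" using z by linarith
      have eq: "1 - (cmod z)\<^sup>2 = (1 - cmod z) * (1 + cmod z)" by (simp add: power2_eq_square algebra_simps)
      have 1: "1 * (1 / n) \<le> 1 - (cmod z)\<^sup>2"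
        unfolding eq using z z1 \<open>1 / n > 0\<close> by (subst mult.commute, intro mult_mono) auto
      have "1 - cmod z \<le> 2 * (1 / n)" using z by simp
      then have "(1 - cmod z) * (1 + cmod z) \<le> (2 * (1 / n)) * 2"
        using z z1 \<open>1 / n > 0\<close> by (intro mult_mono) auto
      then have 2: "1 - (cmod z)\<^sup>2 \<le> 4 * (1 / n)" unfolding eq by simp
      have "c * (1 / n) powr \<alpha> \<le> (1 - (cmod z)\<^sup>2) powr \<alpha>"
        using powr_between(1)[OF _ _ 1 2, of \<alpha>] n by (simp add: c_def)
      then have w: "1 \<le> n powr \<alpha> / c * (1 - (cmod z)\<^sup>2) powr \<alpha>"
        using n c by (simp add: powr_divide field_simps)
      have "cmod (h z) \<le> l n + L n * (cmod (h z) powr p * 1)" using hl[of n z] z z1 n by simp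
      also have "\<dots> \<le> l n + L n * (cmod (h z) powr p * (n powr \<alpha> / c * (1 - (cmod z)\<^sup>2) powr \<alpha>))"
        using lK[of n] n by (intro add_left_mono mult_left_mono w) auto
      also have "\<dots> = l n + L n * n powr \<alpha> / c * (cmod (h z) powr p * (1 - (cmod z)\<^sup>2) powr \<alpha>)" by simp
      finally show ?thesis using True z1 lK[of n] n c
        by (simp add: F_def flip: ennreal_mult ennreal_plus) 
    qed simp
    define J where "J = (\<lambda>z. indicator S z * ennreal (cmod (h z)))"
    have ssub: "S \<subseteq> ball 0 1"
    proof
      fix z assume "z \<in> S"
      then have "cmod z < 1 - 1 / n" by (simp add: Sin)
      moreover have "1 / n > 0" using n by simp
      ultimately have "cmod z < 1" by linarith
      then show "z \<in> ball 0 1" by simp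
    qed
    have mJ[measurable]: "J \<in> borel_measurable borel"
      unfolding J_def by (intro measurable_indicator_continuous continuous_intros holomorphic_on_imp_continuous_on
          holomorphic_on_subset[OF h ssub] S)
    define t where "t = cmod (taylor_coeff h k)"
    have "ennreal (t * exp (-2)) * emeasure lborel S = (\<integral>\<^sup>+z. ennreal (t * exp (-2)) * indicator S z \<partial>lborel)"
      by (simp add: nn_integral_cmult_indicator)
    also have "\<dots> \<le> (\<integral>\<^sup>+z. (\<integral>\<^sup>+\<theta>\<in>{0..1}. J (circ \<theta> * z) \<partial>lborel) \<partial>lborel)"
    proof (rule nn_integral_mono)
      fix z :: complex
      show "ennreal (t * exp (-2)) * indicator S z \<le> (\<integral>\<^sup>+\<theta>\<in>{0..1}. J (circ \<theta> * z) \<partial>lborel)"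
      proof (cases "z \<in> S")
        case True
        then have z: "1 - 2 / n \<le> cmod z" "cmod z < 1" using ssub by (auto simp: Sin)
        have "exp (-2) \<le> cmod z ^ k" using z(1) by (intro power_annulus_lower) (simp add: n_def)
        then have "ennreal (t * exp (-2)) \<le> ennreal (t * cmod z ^ k)"
          by (intro ennreal_leI mult_left_mono) (auto simp: t_def)
        also have "\<dots> \<le> (\<integral>\<^sup>+\<theta>\<in>{0..1}. ennreal (cmod (h (circ \<theta> * z))) \<partial>lborel)"
          unfolding t_def by (rule taylor_coeff_le_circle_average[OF h z(2)])
        also have "\<dots> = (\<integral>\<^sup>+\<theta>\<in>{0..1}. J (circ \<theta> * z) \<partial>lborel)"
          using True by (intro nn_integral_cong) (auto simp: J_def Sin norm_mult indicator_def)
        finally show ?thesis using True by simp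
      qed simp
    qed
    also have "\<dots> = (\<integral>\<^sup>+z. J z \<partial>lborel)" by (rule nn_integral_circle_average[symmetric, OF mJ])
    also have "\<dots> \<le> (\<integral>\<^sup>+z. ennreal (l n) * indicator S z + ennreal (L n * n powr \<alpha> / c) * F z \<partial>lborel)"
      unfolding J_def by (intro nn_integral_mono SF)
    also have "\<dots> = ennreal (l n) * emeasure lborel S + ennreal (L n * n powr \<alpha> / c) * ennreal M"
      using mF by (subst nn_integral_add) (auto simp: nn_integral_cmult_indicator nn_integral_cmult M)
    finally have ineq: "ennreal (t * exp (-2)) * emeasure lborel S \<le> ennreal (l n) * emeasure lborel S + ennreal (L n * n powr \<alpha> / c) * ennreal M" .
    have nonneg: "0 \<le> t * exp (-2)" "0 \<le> pi / n * (2 - 3 / n)" "0 \<le> l n" "0 \<le> L n * n powr \<alpha> / c"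
      using lK[of n] n c 3 by (auto simp: t_def)
    have "ennreal (t * exp (-2) * (pi / n * (2 - 3 / n))) \<le> ennreal (l n * (pi / n * (2 - 3 / n)) + L n * n powr \<alpha> / c * M)"
      using ineq unfolding emS ennreal_mult[OF nonneg(1,2)] ennreal_plus[OF mult_nonneg_nonneg[OF nonneg(3,2)] mult_nonneg_nonneg[OF nonneg(4) M(2)]]
        ennreal_mult[OF nonneg(3,2)] ennreal_mult[OF nonneg(4) M(2)] .
    then have "t * exp (-2) * (pi / n * (2 - 3 / n)) \<le> l n * (pi / n * (2 - 3 / n)) + L n * n powr \<alpha> / c * M"
      by (simp only: ennreal_le_iff[OF add_nonneg_nonneg[OF mult_nonneg_nonneg[OF nonneg(3,2)] mult_nonneg_nonneg[OF nonneg(4) M(2)]]])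
    moreover have "t * exp (-2) * (pi / (2 * n)) \<le> t * exp (-2) * (pi / n * (2 - 3 / n))"
      by (intro mult_left_mono emS1) (auto simp: t_def)
    moreover have "l n * (pi / n * (2 - 3 / n)) \<le> n powr \<kappa> * (2 * pi / n)"
      using lK[of n] n 3 by (intro mult_mono emS2) auto
    ultimately have "t * exp (-2) * (pi / (2 * n)) \<le> n powr \<kappa> * (2 * pi / n) + L n * n powr \<alpha> / c * M" by linarith
    then have "t * exp (-2) * (pi / (2 * n)) * (2 * n) \<le> (n powr \<kappa> * (2 * pi / n) + L n * n powr \<alpha> / c * M) * (2 * n)"
      using n by (intro mult_right_mono) auto
    also have "\<dots> = n powr \<kappa> * (4 * pi) + 2 * (L n * n powr \<alpha> * n) / c * M" using n by (simp add: field_simps)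
    also have "\<dots> = n powr \<kappa> * (4 * pi) + 2 * (K * n powr \<kappa>) / c * M" using lK[of n] n by simp
    finally have "t * exp (-2) * pi \<le> n powr \<kappa> * (4 * pi + 2 * K * M / c)" using n by (simp add: field_simps)
    also have "\<dots> \<le> n powr \<kappa> * (4 * pi + 2 * K * M / c * pi)"
    proof -
      have "2 * K * M / c * 1 \<le> 2 * K * M / c * pi" using pi_ge_two M c by (intro mult_left_mono) (auto simp: K_def)
      then show ?thesis by (intro mult_left_mono) auto
    qed
    also have "\<dots> = n powr \<kappa> * (4 + 2 * K * M / c) * pi" by (simp add: algebra_simps)
    finally have "t * exp (-2) \<le> n powr \<kappa> * (4 + 2 * K * M / c)" by (simp add: mult_le_cancel_right)
    then have "t * exp (-2) * exp 2 \<le> n powr \<kappa> * (4 + 2 * K * M / c) * exp 2" by (intro mult_right_mono) auto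
    also have "t * exp (-2) * exp 2 = t" by (simp add: exp_minus)
    finally show ?thesis by (simp add: t_def n_def algebra_simps)
  qed
  have "K \<ge> 0" by (simp add: K_def)
  then show ?thesis using bound M c
    by (intro that[of "2 * exp 2 * (2 + K * M / c)"]) (auto simp: \<kappa>_def intro!: mult_pos_pos add_pos_nonneg)
qed

subsection \<open>The operator as an integral against a power kernel\<close>

text \<open>The Taylor coefficients of \<open>(1 - w) powr (-\<beta>)\<close>: a rising factorial
  divided by n!.\<close>

definition kernel_coeff :: "real \<Rightarrow> nat \<Rightarrow> real" where
  "kernel_coeff \<beta> n = Gamma (real n + \<beta>) / (fact n * Gamma \<beta>)"

lemma kernel_coeff_pochhammer:
  assumes "\<beta> > 0" shows "kernel_coeff \<beta> n = pochhammer \<beta> n / fact n"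
proof -
  have "\<beta> \<notin> \<int>\<^sub>\<le>\<^sub>0" using assms nonpos_Ints_nonpos[of \<beta>] by auto
  then show ?thesis using pochhammer_Gamma[of \<beta> n] by (simp add: kernel_coeff_def add.commute)
qed

lemma kernel_coeff_pos: "\<beta> > 0 \<Longrightarrow> kernel_coeff \<beta> n > 0"
  by (simp add: kernel_coeff_def)

text \<open>Coefficient form of the derivative rule for
  \<open>(1 - w) powr (-\<beta>)\<close>.\<close>

lemma kernel_coeff_Suc:
  assumes "\<beta> > 0" shows "real (Suc n) * kernel_coeff \<beta> (Suc n) = \<beta> * kernel_coeff (\<beta> + 1) n"
  using assms by (simp add: kernel_coeff_pochhammer pochhammer_rec field_simps del: of_nat_Suc)

lemma kernel_series:
  assumes "\<beta> > 0" "cmod w < 1"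
  shows "(\<lambda>n. of_real (kernel_coeff \<beta> n) * w ^ n) sums (1 - w) powr (- of_real \<beta>)"
proof -
  have "(\<lambda>n. ((- of_real \<beta>) gchoose n) * (- w) ^ n) sums (1 + (- w)) powr (- of_real \<beta>)"
    by (rule gen_binomial_complex) (use assms in simp)
  moreover have "((- complex_of_real \<beta>) gchoose n) * (- w) ^ n = of_real (kernel_coeff \<beta> n) * w ^ n" for n
  proof -
    have "((- complex_of_real \<beta>) gchoose n) = (- 1) ^ n * of_real (kernel_coeff \<beta> n)"
      using assms by (simp add: gbinomial_pochhammer kernel_coeff_pochhammer pochhammer_of_real)
    moreover have "(- w) ^ n = (- 1) ^ n * w ^ n" by (rule power_minus)
    moreover have "(- 1) ^ n * (- 1) ^ n = (1 :: complex)" by (simp flip: power_mult_distrib)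
    ultimately show ?thesis
      by (metis (no_types, lifting) mult.assoc mult.commute mult.right_neutral)
  qed
  ultimately show ?thesis by simp
qed

lemma kernel_series_summable:
  assumes "\<beta> > 0" "cmod w < 1"
  shows "summable (\<lambda>n. kernel_coeff \<beta> n * cmod w ^ n)"
proof -
  have "summable (\<lambda>n. Re (of_real (kernel_coeff \<beta> n) * of_real (cmod w) ^ n))"
    by (intro summable_Re sums_summable[OF kernel_series]) (use assms in auto)
  then show ?thesis by (simp flip: of_real_power)
qed

lemma norm_kernel:
  assumes "0 \<le> t" "t < 1" "cmod z < 1"
  shows "cmod ((1 - of_real t * z) powr (- of_real \<beta>)) = cmod (1 - of_real t * z) powr (- \<beta>)"
  using norm_powr_real_powr'[of "- of_real \<beta>" "1 - of_real t * z"] by simp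

section \<open>The measure, its moments and the integral formula\<close>

locale unit_interval_measure = finite_measure \<mu> for \<mu> :: "real measure" +
  assumes sets_mu [measurable_cong, simp]: "sets \<mu> = sets borel"
    and null: "emeasure \<mu> (UNIV - {0..<1}) = 0"
begin

lemma space_mu [simp]: "space \<mu> = UNIV"
  using sets_eq_imp_space_eq[OF sets_mu] by simp

lemma AE_unit: "AE t in \<mu>. 0 \<le> t \<and> t < 1"
  by (rule AE_I[of _ _ "UNIV - {0..<1}"]) (use null in auto)

definition moment :: "nat \<Rightarrow> real" where "moment k = (\<integral>t. t ^ k \<partial>\<mu>)"

lemma integrable_moment: "integrable \<mu> (\<lambda>t. t ^ k)"
proof (rule integrable_const_bound[where B=1])
  show "AE t in \<mu>. norm (t ^ k) \<le> 1" using AE_unit by eventually_elim (simp add: power_le_one)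
qed simp

lemma moment_nonneg: "moment k \<ge> 0"
  unfolding moment_def by (rule integral_nonneg_AE) (use AE_unit in \<open>auto elim!: eventually_mono\<close>)

lemma moment_antimono: "moment (n + k) \<le> moment k"
  unfolding moment_def
proof (intro integral_mono_AE integrable_moment)
  show "AE t in \<mu>. t ^ (n + k) \<le> t ^ k"
    using AE_unit by eventually_elim (simp add: power_add power_le_one mult_left_le_one_le)
qed

text \<open>Cutting off to \<open>[0,1)\<close> makes the function measurable: \<open>f\<close> is arbitrary off the disc, and \<open>\<mu>\<close> need not be complete.\<close>

definition radial :: "(complex \<Rightarrow> complex) \<Rightarrow> real \<Rightarrow> complex" where
  "radial f t = indicator {0..<1} t *\<^sub>R f (of_real t)"

lemma radial_measurable:
  assumes "f holomorphic_on ball 0 1"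
  shows "radial f \<in> borel_measurable \<mu>"
proof -
  have "radial f \<in> borel_measurable borel"
    unfolding radial_def
    by (intro borel_measurable_continuous_on_indicator continuous_on_compose2[OF holomorphic_on_imp_continuous_on[OF assms]] continuous_intros) auto
  then show ?thesis by simp
qed

text \<open>Since \<open>moment (n + k)\<close> is at most \<open>moment k\<close>, the hypothesis
  bounds the sum of the L^1 norms of the terms, uniformly in n. So sum and integral may be
  interchanged, and f is integrable along the radius.\<close>

lemma radial_sums:
  assumes f: "f holomorphic_on ball 0 1" and S: "summable (\<lambda>k. cmod (taylor_coeff f k) * moment k)"
  shows "integrable \<mu> (\<lambda>t. of_real (t ^ n) * radial f t)"
    and "(\<lambda>k. of_real (moment (n + k)) * taylor_coeff f k) sums (\<integral>t. of_real (t ^ n) * radial f t \<partial>\<mu>)"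
proof -
  define F where "F = (\<lambda>k t. indicator {0..<1::real} t *\<^sub>R (complex_of_real (t ^ (n + k)) * taylor_coeff f k))"
  have m[measurable]: "F k \<in> borel_measurable \<mu>" for k unfolding F_def by measurable
  have AEF: "AE t in \<mu>. F k t = of_real (t ^ (n + k)) * taylor_coeff f k" for k
    using AE_unit by eventually_elim (simp add: F_def)
  have AEn: "AE t in \<mu>. norm (F k t) = t ^ (n + k) * cmod (taylor_coeff f k)" for k
    using AE_unit by eventually_elim (simp add: F_def norm_mult norm_power)
  have i0: "integrable \<mu> (\<lambda>t. of_real (t ^ (n + k)) * taylor_coeff f k)" for k
    by (intro integrable_mult_left integrable_of_real integrable_moment)
  have iF: "integrable \<mu> (F k)" for k
    using i0[of k] AEF[of k] by (subst integrable_cong_AE[where g="\<lambda>t. of_real (t ^ (n + k)) * taylor_coeff f k"]) auto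
  have intF: "(\<integral>t. F k t \<partial>\<mu>) = of_real (moment (n + k)) * taylor_coeff f k" for k
  proof -
    have "(\<integral>t. F k t \<partial>\<mu>) = (\<integral>t. of_real (t ^ (n + k)) * taylor_coeff f k \<partial>\<mu>)"
      using AEF[of k] by (intro integral_cong_AE) auto
    then show ?thesis by (simp only: moment_def integral_mult_left_zero integral_complex_of_real)
  qed
  have intn: "(\<integral>t. norm (F k t) \<partial>\<mu>) = cmod (taylor_coeff f k) * moment (n + k)" for k
  proof -
    have "(\<integral>t. norm (F k t) \<partial>\<mu>) = (\<integral>t. t ^ (n + k) * cmod (taylor_coeff f k) \<partial>\<mu>)"
      using AEn[of k] by (intro integral_cong_AE) auto
    then show ?thesis by (simp add: moment_def)
  qed
  have pt: "(\<lambda>k. F k t) sums (of_real (t ^ n) * radial f t)" for t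
  proof (cases "t \<in> {0..<1}")
    case True
    have "(\<lambda>k. (deriv ^^ k) f 0 / fact k * (of_real t - 0) ^ k) sums f (of_real t)"
      by (rule holomorphic_power_series[OF f]) (use True in auto)
    from sums_mult[OF this, of "of_real (t ^ n)"] show ?thesis
      using True by (simp add: F_def radial_def taylor_coeff_def power_add mult_ac)
  qed (simp add: F_def radial_def)
  have eqsum: "(\<Sum>k. F k t) = of_real (t ^ n) * radial f t" for t using pt sums_unique by metis
  have s1: "AE t in \<mu>. summable (\<lambda>k. norm (F k t))"
  proof (rule AE_I2)
    fix t
    show "summable (\<lambda>k. norm (F k t))"
    proof (cases "t \<in> {0..<1}")
      case True
      \<comment> \<open>Convergence at the larger radius r gives absolute convergence at t.\<close>
      define r where "r = (1 + t) / 2"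
      have r: "0 \<le> t" "t < r" "r < 1" using True by (auto simp: r_def)
      have "(\<lambda>k. (deriv ^^ k) f 0 / fact k * (of_real r - 0) ^ k) sums f (of_real r)"
        by (rule holomorphic_power_series[OF f]) (use r in auto)
      then have "summable (\<lambda>k. taylor_coeff f k * of_real r ^ k)"
        by (simp add: taylor_coeff_def sums_iff)
      then have "summable (\<lambda>k. cmod (taylor_coeff f k * of_real t ^ k))"
        by (rule powser_insidea) (use r in auto)
      then have "summable (\<lambda>k. t ^ n * cmod (taylor_coeff f k * of_real t ^ k))" by (rule summable_mult)
      moreover have "norm (F k t) = t ^ n * cmod (taylor_coeff f k * of_real t ^ k)" for k
        using True by (simp add: F_def norm_mult norm_power power_add)
      ultimately show ?thesis by simp
    qed (simp add: F_def)
  qed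
  have s2: "summable (\<lambda>k. \<integral>t. norm (F k t) \<partial>\<mu>)"
    unfolding intn
    by (rule summable_comparison_test[OF _ S])
       (auto intro!: mult_left_mono moment_antimono exI[of _ 0] simp: moment_nonneg)
  show "integrable \<mu> (\<lambda>t. of_real (t ^ n) * radial f t)"
    using integrable_suminf[OF iF s1 s2] unfolding eqsum .
  show "(\<lambda>k. of_real (moment (n + k)) * taylor_coeff f k) sums (\<integral>t. of_real (t ^ n) * radial f t \<partial>\<mu>)"
    using sums_integral[OF iF s1 s2] unfolding eqsum intF .
qed

text \<open>The kernel series converges absolutely at |z|, and powers of t < 1 only help. A general
  \<phi> covers f with \<beta> as well as t f with \<beta> + 1.\<close>

lemma kernel_integral_sums:
  fixes \<phi> :: "real \<Rightarrow> complex"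
  assumes \<beta>: "\<beta> > 0" and z: "cmod z < 1" and \<phi>: "integrable \<mu> \<phi>" "\<And>t. t \<notin> {0..<1} \<Longrightarrow> \<phi> t = 0"
  shows "(\<lambda>n. of_real (kernel_coeff \<beta> n) * (\<integral>t. of_real (t ^ n) * \<phi> t \<partial>\<mu>) * z ^ n) sums
      (\<integral>t. \<phi> t * (1 - of_real t * z) powr (- of_real \<beta>) \<partial>\<mu>)"
proof -
  define F where "F = (\<lambda>n t. (of_real (kernel_coeff \<beta> n) * z ^ n) * (complex_of_real (t ^ n) * \<phi> t))"
  have [measurable]: "\<phi> \<in> borel_measurable \<mu>" using \<phi>(1) by auto
  have le: "norm (complex_of_real (t ^ n) * \<phi> t) \<le> norm (\<phi> t)" for n t
    using \<phi>(2)[of t] by (cases "t \<in> {0..<1}") (auto simp: norm_mult norm_power power_le_one mult_left_le_one_le)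
  have i1: "integrable \<mu> (\<lambda>t. complex_of_real (t ^ n) * \<phi> t)" for n
    by (rule Bochner_Integration.integrable_bound[OF \<phi>(1)]) (use le in \<open>auto intro!: AE_I2\<close>)
  have iF: "integrable \<mu> (F n)" for n unfolding F_def by (intro integrable_mult_right i1)
  have nF: "norm (F n t) \<le> kernel_coeff \<beta> n * cmod z ^ n * norm (\<phi> t)" for n t
    using mult_left_mono[OF le[of t n], of "kernel_coeff \<beta> n * cmod z ^ n"] kernel_coeff_pos[OF \<beta>, of n]
    by (simp add: F_def norm_mult norm_power)
  note ks = kernel_series_summable[OF \<beta> z]
  have s1: "AE t in \<mu>. summable (\<lambda>n. norm (F n t))"
  proof (rule AE_I2)
    fix t
    show "summable (\<lambda>n. norm (F n t))"
      by (rule summable_comparison_test[OF _ summable_mult2[OF ks, of "norm (\<phi> t)"]]) (use nF in auto)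
  qed
  have s2: "summable (\<lambda>n. \<integral>t. norm (F n t) \<partial>\<mu>)"
  proof (rule summable_comparison_test[OF _ summable_mult2[OF ks, of "\<integral>t. norm (\<phi> t) \<partial>\<mu>"]], intro exI allI impI)
    fix n
    have "(\<integral>t. norm (F n t) \<partial>\<mu>) \<le> (\<integral>t. kernel_coeff \<beta> n * cmod z ^ n * norm (\<phi> t) \<partial>\<mu>)"
      by (intro integral_mono integrable_norm iF integrable_mult_right \<phi>(1) nF)
    then show "norm (\<integral>t. norm (F n t) \<partial>\<mu>) \<le> kernel_coeff \<beta> n * cmod z ^ n * (\<integral>t. norm (\<phi> t) \<partial>\<mu>)" by simp
  qed
  have eq: "(\<Sum>n. F n t) = \<phi> t * (1 - of_real t * z) powr (- of_real \<beta>)" for t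
  proof (cases "t \<in> {0..<1}")
    case True
    have "cmod (of_real t * z) < 1" using True z by (auto simp: norm_mult mult_le_less_imp_less intro: le_less_trans[OF mult_left_le_one_le])
    from sums_mult[OF kernel_series[OF \<beta> this], of "\<phi> t"]
    show ?thesis by (simp add: F_def sums_iff power_mult_distrib mult_ac)
  qed (simp add: F_def \<phi>(2))
  have intF: "(\<integral>t. F n t \<partial>\<mu>) = of_real (kernel_coeff \<beta> n) * (\<integral>t. of_real (t ^ n) * \<phi> t \<partial>\<mu>) * z ^ n" for n
    unfolding F_def by (subst integral_mult_right_zero) (simp add: mult_ac)
  show ?thesis using sums_integral[OF iF s1 s2] unfolding eq intF .
qed

lemma mu_coef_moment: "mu_coef \<mu> \<beta> n k = kernel_coeff \<beta> n * moment (n + k)"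
  by (simp add: mu_coef_def kernel_coeff_def moment_def)

text \<open>The sum over k is interchanged with the integral first, the sum over n second. The
  derivative is taken in the power series, where \<open>kernel_coeff_Suc\<close> raises \<beta> by
  one, so there is no differentiation under the integral.\<close>

lemma Hilbert_op_integral:
  assumes f: "f holomorphic_on ball 0 1" and S: "summable (\<lambda>k. cmod (taylor_coeff f k) * moment k)" and \<beta>: "\<beta> > 0"
  shows "integrable \<mu> (radial f)"
    and "summable (\<lambda>k. of_real (mu_coef \<mu> \<beta> n k) * taylor_coeff f k)"
    and "z \<in> ball 0 1 \<Longrightarrow> summable (\<lambda>n. H_coef \<mu> \<beta> f n * z ^ n)"
    and "z \<in> ball 0 1 \<Longrightarrow> Hilbert_op \<mu> \<beta> f z = (\<integral>t. radial f t * (1 - of_real t * z) powr (- of_real \<beta>) \<partial>\<mu>)"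
    and "Hilbert_op \<mu> \<beta> f holomorphic_on ball 0 1"
    and "z \<in> ball 0 1 \<Longrightarrow> deriv (Hilbert_op \<mu> \<beta> f) z =
      of_real \<beta> * (\<integral>t. of_real t * radial f t * (1 - of_real t * z) powr (- of_real (\<beta> + 1)) \<partial>\<mu>)"
proof -
  show int: "integrable \<mu> (radial f)" using radial_sums(1)[OF f S, of 0] by simp
  have int1: "integrable \<mu> (\<lambda>t. of_real t * radial f t)" using radial_sums(1)[OF f S, of 1] by simp
  have 1: "(\<lambda>k. of_real (mu_coef \<mu> \<beta> n k) * taylor_coeff f k) sums
      (of_real (kernel_coeff \<beta> n) * (\<integral>t. of_real (t ^ n) * radial f t \<partial>\<mu>))" for n
    using sums_mult[OF radial_sums(2)[OF f S, of n], of "of_real (kernel_coeff \<beta> n)"]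
    by (simp add: mu_coef_moment mult.assoc)
  show "summable (\<lambda>k. of_real (mu_coef \<mu> \<beta> n k) * taylor_coeff f k)" using 1 by (rule sums_summable)
  have H: "H_coef \<mu> \<beta> f n = of_real (kernel_coeff \<beta> n) * (\<integral>t. of_real (t ^ n) * radial f t \<partial>\<mu>)" for n
    unfolding H_coef_def using 1 by (simp add: sums_iff)
  have t0: "t \<notin> {0..<1} \<Longrightarrow> radial f t = 0" for t by (simp add: radial_def)
  have 2: "(\<lambda>n. H_coef \<mu> \<beta> f n * z ^ n) sums (\<integral>t. radial f t * (1 - of_real t * z) powr (- of_real \<beta>) \<partial>\<mu>)"
    if "cmod z < 1" for z
    unfolding H by (rule kernel_integral_sums[OF \<beta> that int t0])
  show "z \<in> ball 0 1 \<Longrightarrow> summable (\<lambda>n. H_coef \<mu> \<beta> f n * z ^ n)" using 2[of z] by (simp add: sums_iff)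
  show "z \<in> ball 0 1 \<Longrightarrow> Hilbert_op \<mu> \<beta> f z = (\<integral>t. radial f t * (1 - of_real t * z) powr (- of_real \<beta>) \<partial>\<mu>)"
    unfolding Hilbert_op_def using 2[of z] by (simp add: sums_iff)
  show "Hilbert_op \<mu> \<beta> f holomorphic_on ball 0 1"
  proof (rule power_series_holomorphic)
    fix w :: complex assume "w \<in> ball 0 1"
    then show "(\<lambda>n. H_coef \<mu> \<beta> f n * (w - 0) ^ n) sums Hilbert_op \<mu> \<beta> f w"
      unfolding Hilbert_op_def using 2[of w] by (simp add: sums_iff)
  qed
  assume z: "z \<in> ball 0 1"
  define K where "K = complex_of_real ((1 + cmod z) / 2)"
  have K: "cmod K < 1" "cmod z < cmod K" using z by (auto simp: K_def simp del: of_real_divide of_real_add)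
  have "(Hilbert_op \<mu> \<beta> f has_field_derivative (\<Sum>n. diffs (H_coef \<mu> \<beta> f) n * z ^ n)) (at z)"
    unfolding Hilbert_op_def by (rule termdiffs_strong[OF sums_summable[OF 2[OF K(1)]] K(2)])
  then have d: "deriv (Hilbert_op \<mu> \<beta> f) z = (\<Sum>n. diffs (H_coef \<mu> \<beta> f) n * z ^ n)" by (rule DERIV_imp_deriv)
  have df: "diffs (H_coef \<mu> \<beta> f) n * z ^ n = of_real \<beta> * (of_real (kernel_coeff (\<beta> + 1) n) *
      (\<integral>t. of_real (t ^ n) * (of_real t * radial f t) \<partial>\<mu>) * z ^ n)" for n
  proof -
    have "of_nat (Suc n) * complex_of_real (kernel_coeff \<beta> (Suc n)) = of_real \<beta> * of_real (kernel_coeff (\<beta> + 1) n)"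
      using arg_cong[OF kernel_coeff_Suc[OF \<beta>, of n], of complex_of_real] by (simp only: of_real_mult of_real_of_nat_eq)
    moreover have "complex_of_real (t ^ Suc n) * radial f t = of_real (t ^ n) * (of_real t * radial f t)" for t by simp
    ultimately show ?thesis unfolding diffs_def H by (simp only: mult.assoc[symmetric])
  qed
  have "(\<lambda>n. diffs (H_coef \<mu> \<beta> f) n * z ^ n) sums
      (of_real \<beta> * (\<integral>t. (of_real t * radial f t) * (1 - of_real t * z) powr (- of_real (\<beta> + 1)) \<partial>\<mu>))"
    unfolding df using z \<beta> by (intro sums_mult kernel_integral_sums int1) (auto simp: t0)
  then show "deriv (Hilbert_op \<mu> \<beta> f) z =
      of_real \<beta> * (\<integral>t. of_real t * radial f t * (1 - of_real t * z) powr (- of_real (\<beta> + 1)) \<partial>\<mu>)"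
    unfolding d by (simp add: sums_iff)
qed

end

subsection \<open>Dyadic sums and shells around the boundary point 1\<close>

lemma dyadic_powr: "((1/2::real) ^ j) powr g = ((1/2) powr g) ^ j"
  by (simp add: powr_power powr_powr mult.commute flip: powr_realpow)

text \<open>Truncated subtraction makes the exponent |k - J|.\<close>

definition dkernel :: "real \<Rightarrow> nat \<Rightarrow> nat \<Rightarrow> real" where
  "dkernel \<rho> k J = \<rho> ^ ((k - J) + (J - k))"

lemma dkernel_sym: "dkernel \<rho> k J = dkernel \<rho> J k"
  by (simp add: dkernel_def add.commute)

text \<open>Two geometric series, one on each side of J, with a bound uniform in J.\<close>

lemma dkernel_sums:
  assumes "0 < \<rho>" "\<rho> < 1"
  shows "summable (\<lambda>k. dkernel \<rho> k J)" "(\<Sum>k. dkernel \<rho> k J) \<le> 2 / (1 - \<rho>)"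
proof -
  have g: "summable (\<lambda>k. \<rho> ^ k)" using assms by (intro summable_geometric) auto
  have eq: "dkernel \<rho> (k + J) J = \<rho> ^ k" for k by (simp add: dkernel_def)
  show s: "summable (\<lambda>k. dkernel \<rho> k J)"
    using g unfolding eq[symmetric] by (subst (asm) summable_iff_shift)
  have "(\<Sum>k<J. dkernel \<rho> k J) = (\<Sum>k<J. \<rho> ^ (J - k))" by (intro sum.cong) (auto simp: dkernel_def)
  also have "\<dots> \<le> (\<Sum>k<J. \<rho> ^ (J - Suc k))"
    using assms by (intro sum_mono power_decreasing) auto
  also have "\<dots> = (\<Sum>k<J. \<rho> ^ k)" by (rule sum.nat_diff_reindex)
  also have "\<dots> \<le> (\<Sum>k. \<rho> ^ k)" using assms by (intro sum_le_suminf g) auto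
  finally have "(\<Sum>k<J. dkernel \<rho> k J) \<le> (\<Sum>k. \<rho> ^ k)" .
  then have "(\<Sum>k. dkernel \<rho> k J) \<le> (\<Sum>k. \<rho> ^ k) + (\<Sum>k. \<rho> ^ k)"
    using suminf_split_initial_segment[OF s, of J] by (simp add: eq)
  also have "\<dots> = 2 / (1 - \<rho>)" using assms by (simp add: suminf_geometric)
  finally show "(\<Sum>k. dkernel \<rho> k J) \<le> 2 / (1 - \<rho>)" .
qed

lemma suminf_ennreal_swap:
  fixes f :: "nat \<Rightarrow> nat \<Rightarrow> ennreal"
  shows "(\<Sum>i. \<Sum>j. f i j) = (\<Sum>j. \<Sum>i. f i j)"
  using nn_integral_suminf[of "\<lambda>j i. f i j" "count_space UNIV"] by (simp add: nn_integral_count_space_nat)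

lemma suminf_ennreal_le_imp:
  fixes f :: "nat \<Rightarrow> real"
  assumes "\<And>i. 0 \<le> f i" "(\<Sum>i. ennreal (f i)) \<le> ennreal D" "D \<ge> 0"
  shows "summable f" "(\<Sum>i. f i) \<le> D"
proof -
  show s: "summable f" using assms by (intro summable_suminf_not_top) (auto simp: top_unique)
  show "(\<Sum>i. f i) \<le> D" using assms s by (simp add: suminf_ennreal2 suminf_nonneg)
qed

text \<open>Convolution with a summable kernel on l^q. For fixed J, \<open>le_add_powr\<close> at
  the level \<open>B J powr (1 / q)\<close> replaces Hoelder; summing \<open>B\<close> over J costs
  one more kernel sum, hence the power q + 1.\<close>

lemma discrete_young:
  fixes d :: "nat \<Rightarrow> real"
  assumes \<rho>: "0 < \<rho>" "\<rho> < 1" and q: "q \<ge> 1" and d: "\<And>k. d k \<ge> 0" and s: "summable (\<lambda>k. d k powr q)"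
  defines "W \<equiv> 2 / (1 - \<rho>)"
  shows "summable (\<lambda>k. d k * dkernel \<rho> k J)"
    and "summable (\<lambda>J. (\<Sum>k. d k * dkernel \<rho> k J) powr q)"
    and "(\<Sum>J. (\<Sum>k. d k * dkernel \<rho> k J) powr q) \<le> (W + 1) powr (q + 1) * (\<Sum>k. d k powr q)"
proof -
  have W: "W > 0" using \<rho> by (simp add: W_def)
  have k0: "dkernel \<rho> k J > 0" for k J using \<rho> by (simp add: dkernel_def)
  have k1: "dkernel \<rho> k J \<le> 1" for k J using \<rho> by (simp add: dkernel_def power_le_one)
  define B where "B = (\<lambda>J. \<Sum>k. d k powr q * dkernel \<rho> k J)"
  have sB: "summable (\<lambda>k. d k powr q * dkernel \<rho> k J)" for J
    by (rule summable_comparison_test[OF _ s])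
       (use k0 k1 in \<open>auto simp: abs_mult less_imp_le intro!: mult_right_le_one_le exI[of _ 0]\<close>)
  have pt: "d k * dkernel \<rho> k J \<le> l * dkernel \<rho> k J + l powr (1 - q) * (d k powr q * dkernel \<rho> k J)" if "l > 0" for l k J
    using mult_right_mono[OF le_add_powr[OF d[of k] that q] less_imp_le[OF k0[of k J]]] by (simp add: algebra_simps)
  have sr: "summable (\<lambda>k. l * dkernel \<rho> k J + l powr (1 - q) * (d k powr q * dkernel \<rho> k J))" for l J
    by (intro summable_add summable_mult sB dkernel_sums \<rho>)
  show sE: "summable (\<lambda>k. d k * dkernel \<rho> k J)" for J
    by (rule summable_comparison_test[OF _ sr[of 1 J]])
       (use pt[of 1 _ J] d k0 in \<open>auto simp: abs_mult less_imp_le intro!: exI[of _ 0]\<close>)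
  have B0: "B J \<ge> 0" for J unfolding B_def using k0 by (intro suminf_nonneg sB mult_nonneg_nonneg) (auto simp: less_imp_le)
  have EB: "(\<Sum>k. d k * dkernel \<rho> k J) powr q \<le> (W + 1) powr q * B J" for J
  proof (cases "B J = 0")
    \<comment> \<open>The level must be positive, so this case is separate; here every d k
      vanishes.\<close>
    case True
    then have "d k powr q * dkernel \<rho> k J = 0" for k
      using suminf_eq_zero_iff[OF sB[of J]] k0[of _ J] unfolding B_def by (simp add: less_imp_le)
    then have "d k = 0" for k using k0[of k J] by (metis less_irrefl mult_eq_0_iff powr_eq_0_iff)
    then show ?thesis using B0[of J] by simp
  next
    case False
    define l where "l = B J powr (1 / q)"
    have Bp: "B J > 0" using False B0[of J] by simp
    have l: "l > 0" using Bp by (simp add: l_def)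
    have "l powr (1 - q) * B J = l powr (1 - q) * l powr q" using Bp q by (simp add: l_def powr_powr)
    also have "\<dots> = l" using l by (simp flip: powr_add)
    finally have l1: "l powr (1 - q) * B J = l" .
    have "(\<Sum>k. d k * dkernel \<rho> k J) \<le> (\<Sum>k. l * dkernel \<rho> k J + l powr (1 - q) * (d k powr q * dkernel \<rho> k J))"
      by (intro suminf_le pt l sE sr)
    also have "\<dots> = l * (\<Sum>k. dkernel \<rho> k J) + l powr (1 - q) * B J"
      unfolding B_def by (simp add: suminf_add[symmetric] suminf_mult summable_mult sB dkernel_sums \<rho>)
    also have "\<dots> \<le> l * W + l" unfolding l1 W_def using dkernel_sums(2)[OF \<rho>] l by (intro add_right_mono mult_left_mono) auto
    finally have "(\<Sum>k. d k * dkernel \<rho> k J) \<le> (W + 1) * l" by (simp add: algebra_simps)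
    then have "(\<Sum>k. d k * dkernel \<rho> k J) powr q \<le> ((W + 1) * l) powr q"
      using q d k0 by (intro powr_mono2 suminf_nonneg sE mult_nonneg_nonneg) (auto simp: less_imp_le)
    also have "\<dots> = (W + 1) powr q * B J" using W l Bp q by (simp add: powr_mult) (simp add: l_def powr_powr)
    finally show ?thesis .
  qed
  define D where "D = (\<Sum>k. d k powr q)"
  have D0: "D \<ge> 0" unfolding D_def by (intro suminf_nonneg s) auto
  have "(\<Sum>J. ennreal (B J)) = (\<Sum>J. \<Sum>k. ennreal (d k powr q * dkernel \<rho> k J))"
    unfolding B_def using k0 by (intro suminf_cong suminf_ennreal2[symmetric] sB mult_nonneg_nonneg) (auto simp: less_imp_le)
  also have "\<dots> = (\<Sum>k. \<Sum>J. ennreal (d k powr q * dkernel \<rho> k J))" by (rule suminf_ennreal_swap)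
  also have "\<dots> = (\<Sum>k. ennreal (d k powr q * (\<Sum>J. dkernel \<rho> J k)))"
  proof (rule suminf_cong)
    fix k
    have "(\<Sum>J. ennreal (d k powr q * dkernel \<rho> k J)) = (\<Sum>J. ennreal (d k powr q * dkernel \<rho> J k))"
      by (simp only: dkernel_sym[of \<rho> k])
    also have "\<dots> = ennreal (\<Sum>J. d k powr q * dkernel \<rho> J k)"
      using k0 by (intro suminf_ennreal2 summable_mult dkernel_sums \<rho> mult_nonneg_nonneg) (auto simp: less_imp_le)
    also have "\<dots> = ennreal (d k powr q * (\<Sum>J. dkernel \<rho> J k))"
      by (subst suminf_mult) (auto intro!: dkernel_sums \<rho>)
    finally show "(\<Sum>J. ennreal (d k powr q * dkernel \<rho> k J)) = ennreal (d k powr q * (\<Sum>J. dkernel \<rho> J k))" .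
  qed
  also have "\<dots> \<le> (\<Sum>k. ennreal (d k powr q * W))"
    unfolding W_def by (intro suminf_le ennreal_leI mult_left_mono dkernel_sums \<rho>) auto
  also have "\<dots> = ennreal (D * W)"
    using W unfolding D_def by (subst suminf_mult2[OF s]) (intro suminf_ennreal2 summable_mult2 s, auto)
  finally have sumB: "(\<Sum>J. ennreal (B J)) \<le> ennreal (D * W)" .
  have "(\<Sum>J. ennreal ((\<Sum>k. d k * dkernel \<rho> k J) powr q)) \<le> (\<Sum>J. ennreal ((W + 1) powr q) * ennreal (B J))"
    using B0 by (intro suminf_le) (auto simp: EB intro!: ennreal_leI simp flip: ennreal_mult)
  also have "\<dots> = ennreal ((W + 1) powr q) * (\<Sum>J. ennreal (B J))" by (rule ennreal_suminf_cmult)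
  also have "\<dots> \<le> ennreal ((W + 1) powr q) * ennreal (D * W)" by (intro mult_left_mono sumB) auto
  also have "\<dots> = ennreal ((W + 1) powr q * (D * W))" using D0 W by (simp add: ennreal_mult)
  finally have fin: "(\<Sum>J. ennreal ((\<Sum>k. d k * dkernel \<rho> k J) powr q)) \<le> ennreal ((W + 1) powr q * (D * W))" .
  note res = suminf_ennreal_le_imp[OF _ fin]
  show "summable (\<lambda>J. (\<Sum>k. d k * dkernel \<rho> k J) powr q)" using D0 W by (intro res) auto
  have "(\<Sum>J. (\<Sum>k. d k * dkernel \<rho> k J) powr q) \<le> (W + 1) powr q * (D * W)" using D0 W by (intro res) auto
  also have "\<dots> \<le> (W + 1) powr q * (D * (W + 1))" using D0 W by (intro mult_left_mono) auto
  also have "\<dots> = (W + 1) powr (q + 1) * D" using W by (simp add: powr_add)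
  finally show "(\<Sum>J. (\<Sum>k. d k * dkernel \<rho> k J) powr q) \<le> (W + 1) powr (q + 1) * (\<Sum>k. d k powr q)" by (simp add: D_def)
qed

text \<open>Half-open in |1 - z|, so that the shells are disjoint and integrals over the disc split
  exactly. Indices from 0 on suffice because |1 - z| < 2 in the disc.\<close>

definition shell :: "nat \<Rightarrow> complex set" where
  "shell J = {z. (1/2) ^ J \<le> cmod (1 - z) \<and> cmod (1 - z) < 2 * (1/2) ^ J}"

lemma shell_measurable [measurable]: "shell J \<in> sets borel"
  unfolding shell_def by measurable

lemma dyadic_scale:
  fixes x :: real
  assumes "0 < x" "x < 2"
  obtains J where "(1/2) ^ J \<le> x" "x < 2 * (1/2) ^ J"
proof -
  obtain n where n: "(1/2) ^ n < x" using real_arch_pow_inv[of x "1/2"] assms by auto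
  define J where "J = (LEAST J. (1/2) ^ J \<le> x)"
  have J: "(1/2) ^ J \<le> x" unfolding J_def by (rule LeastI[of _ n]) (use n in simp)
  have "x < 2 * (1/2) ^ J"
  proof (cases J)
    case (Suc i)
    then have "\<not> (1/2) ^ i \<le> x" using not_less_Least[of i "\<lambda>J. (1/2) ^ J \<le> x"] by (simp add: J_def)
    then show ?thesis by (simp add: Suc)
  qed (use assms in simp)
  then show thesis using J that by blast
qed

lemma disjoint_shell: "disjoint_family shell"
proof -
  have "shell i \<inter> shell j = {}" if "i < j" for i j
  proof -
    have "2 * (1/2::real) ^ j \<le> 2 * (1/2) ^ Suc i" using that by (intro mult_left_mono power_decreasing) auto
    then show ?thesis by (auto simp: shell_def)
  qed
  then show ?thesis unfolding disjoint_family_on_def by (metis Int_commute linorder_neqE_nat)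
qed

lemma shell_cover:
  assumes "z \<in> ball 0 1" obtains J where "z \<in> shell J"
proof -
  have z: "cmod z < 1" using assms by simp
  have "1 - z \<noteq> 0" using z by auto
  then have "0 < cmod (1 - z)" by simp
  moreover have "cmod (1 - z) < 2" using norm_triangle_ineq4[of 1 z] z by simp
  ultimately show thesis using dyadic_scale that unfolding shell_def by blast
qed

lemma sum_shell_le:
  assumes [measurable]: "F \<in> borel_measurable borel"
  shows "(\<Sum>J. \<integral>\<^sup>+z. indicator (shell J) z * F z \<partial>lborel) \<le> (\<integral>\<^sup>+z. F z \<partial>lborel)"
proof -
  have "(\<Sum>J. \<integral>\<^sup>+z. indicator (shell J) z * F z \<partial>lborel) = (\<integral>\<^sup>+z. (\<Sum>J. indicator (shell J) z * F z) \<partial>lborel)"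
    by (rule nn_integral_suminf[symmetric]) measurable
  also have "\<dots> = (\<integral>\<^sup>+z. indicator (\<Union>J. shell J) z * F z \<partial>lborel)"
    by (simp add: ennreal_suminf_multc suminf_indicator[OF disjoint_shell])
  also have "\<dots> \<le> (\<integral>\<^sup>+z. F z \<partial>lborel)" by (intro nn_integral_mono) (auto simp: indicator_def)
  finally show ?thesis .
qed

lemma le_sum_shell:
  assumes [measurable]: "F \<in> borel_measurable borel" and "\<And>z. z \<notin> ball 0 1 \<Longrightarrow> F z = 0"
  shows "(\<integral>\<^sup>+z. F z \<partial>lborel) \<le> (\<Sum>J. \<integral>\<^sup>+z. indicator (shell J) z * F z \<partial>lborel)"
proof -
  have "(\<integral>\<^sup>+z. F z \<partial>lborel) = (\<integral>\<^sup>+z. indicator (\<Union>J. shell J) z * F z \<partial>lborel)"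
  proof (intro nn_integral_cong)
    fix z
    show "F z = indicator (\<Union>J. shell J) z * F z"
    proof (cases "z \<in> ball 0 1")
      case True
      then obtain J where "z \<in> shell J" by (rule shell_cover)
      then have "z \<in> (\<Union>J. shell J)" by blast
      then show ?thesis by simp
    qed (simp add: assms(2))
  qed
  also have "\<dots> = (\<integral>\<^sup>+z. (\<Sum>J. indicator (shell J) z * F z) \<partial>lborel)"
    by (simp add: ennreal_suminf_multc suminf_indicator[OF disjoint_shell])
  also have "\<dots> = (\<Sum>J. \<integral>\<^sup>+z. indicator (shell J) z * F z \<partial>lborel)"
    by (rule nn_integral_suminf) measurable
  finally show ?thesis by simp
qed

subsection \<open>Dyadic maxima along the radius\<close>

definition dpt :: "nat \<Rightarrow> real" where "dpt k = 1 - (1/2) ^ k"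

lemma dpt_simps: "dpt 0 = 0" "dpt (Suc k) - dpt k = (1/2) ^ k / 2" "dpt k < dpt (Suc k)" "0 \<le> dpt k" "dpt k < 1"
  by (auto simp: dpt_def power_le_one)

definition dmax :: "(complex \<Rightarrow> complex) \<Rightarrow> nat \<Rightarrow> real" where
  "dmax f k = (SUP t\<in>{dpt k..dpt (Suc k)}. cmod (f (of_real t)))"

lemma continuous_on_radius:
  assumes "f holomorphic_on ball 0 1"
  shows "continuous_on {dpt k..dpt (Suc k)} (\<lambda>t. cmod (f (of_real t)))"
  using dpt_simps(4)[of k] dpt_simps(5)[of "Suc k"]
  by (intro continuous_intros continuous_on_compose2[OF holomorphic_on_imp_continuous_on[OF assms]]) auto

lemma dmax_attained:
  assumes "f holomorphic_on ball 0 1"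
  obtains s where "s \<in> {dpt k..dpt (Suc k)}" "dmax f k = cmod (f (of_real s))"
proof -
  obtain s where s: "s \<in> {dpt k..dpt (Suc k)}" "\<And>t. t \<in> {dpt k..dpt (Suc k)} \<Longrightarrow> cmod (f (of_real t)) \<le> cmod (f (of_real s))"
    using continuous_attains_sup[OF _ _ continuous_on_radius[OF assms, of k]] dpt_simps(3)[of k] by auto
  have "dmax f k = cmod (f (of_real s))"
    unfolding dmax_def by (rule cSup_eq_maximum) (use s in auto)
  then show thesis using s(1) that by blast
qed

lemma dmax_upper:
  assumes "f holomorphic_on ball 0 1" "t \<in> {dpt k..dpt (Suc k)}"
  shows "cmod (f (of_real t)) \<le> dmax f k"
  unfolding dmax_def
  by (rule cSUP_upper[OF assms(2) bounded_imp_bdd_above[OF compact_imp_bounded[OF compact_continuous_image[OF continuous_on_radius[OF assms(1)]]]]]) auto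

lemma dmax_nonneg: "f holomorphic_on ball 0 1 \<Longrightarrow> dmax f k \<ge> 0"
  by (metis dmax_attained norm_ge_zero)

text \<open>Integrate the derivative along the radius: the j-th interval is shorter than
  (1/2)^j.\<close>

lemma norm_le_sum_dmax_deriv:
  assumes f: "f holomorphic_on ball 0 1" and t: "t \<in> {dpt k..dpt (Suc k)}"
  shows "cmod (f (of_real t)) \<le> cmod (f 0) + (\<Sum>j\<le>k. (1/2) ^ j * dmax (deriv f) j)"
  using t
proof (induction k arbitrary: t)
  have df: "deriv f holomorphic_on ball 0 1" by (intro holomorphic_deriv f) auto
  have step: "cmod (f (of_real t)) \<le> cmod (f (of_real (dpt k))) + (1/2) ^ k * dmax (deriv f) k"
    if t: "t \<in> {dpt k..dpt (Suc k)}" for t k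
  proof -
    have "cmod (f (of_real t) - f (of_real (dpt k))) \<le> dmax (deriv f) k * cmod (of_real t - of_real (dpt k))"
    proof (rule field_differentiable_bound[where f'="deriv f"])
      let ?S = "closed_segment (complex_of_real (dpt k)) (of_real (dpt (Suc k)))"
      have seg: "?S = of_real ` {dpt k..dpt (Suc k)}"
        by (simp only: closed_segment_of_real closed_segment_eq_real_ivl1[OF less_imp_le[OF dpt_simps(3)]])
      show "convex ?S" by simp
      show "of_real t \<in> ?S" "of_real (dpt k) \<in> ?S"
        unfolding seg using t less_imp_le[OF dpt_simps(3)[of k]] by (blast, auto)
      fix z assume "z \<in> ?S"
      then obtain s where s: "z = of_real s" "s \<in> {dpt k..dpt (Suc k)}"
        unfolding seg by blast
      show "cmod (deriv f z) \<le> dmax (deriv f) k" unfolding s(1) by (rule dmax_upper[OF df s(2)])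
      have "z \<in> ball 0 1" using s dpt_simps(4)[of k] dpt_simps(5)[of "Suc k"] by auto
      then show "(f has_field_derivative deriv f z) (at z within ?S)"
        by (rule holomorphic_derivI[OF f open_ball])
    qed
    also have "cmod (of_real t - of_real (dpt k)) = t - dpt k"
      using t by (simp flip: of_real_diff)
    also have "dmax (deriv f) k * (t - dpt k) \<le> dmax (deriv f) k * (1/2) ^ k"
    proof (intro mult_left_mono dmax_nonneg df)
      have "t \<le> dpt (Suc k)" "0 < (1/2::real) ^ k" using t by auto
      then show "t - dpt k \<le> (1/2) ^ k" using dpt_simps(2)[of k] by linarith
    qed
    finally have "cmod (f (of_real t) - f (of_real (dpt k))) \<le> (1/2) ^ k * dmax (deriv f) k" by (simp add: mult.commute)
    then show ?thesis using norm_triangle_sub[of "f (of_real t)" "f (of_real (dpt k))"] by linarith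
  qed
  { case 0 then show ?case using step[of t 0] by (simp add: dpt_simps) }
  case (Suc k)
  have "dpt (Suc k) \<in> {dpt k..dpt (Suc k)}" using dpt_simps(3)[of k] by simp
  from Suc.IH[OF this] step[OF Suc.prems] show ?case by simp
qed

text \<open>Here 1 - s is between 2^-j / 2 and 2^-j, so |1 - w| stays between 2^-j / 4 and twice
  2^-j, a range of three shells. This is the bounded overlap needed to compare sums over j with area
  integrals.\<close>

lemma ball_radius_subset_shells:
  assumes s: "s \<in> {dpt j..dpt (Suc j)}"
  shows "ball (of_real s) ((1 - s) / 2) \<subseteq> ball 0 1 \<inter> (shell j \<union> shell (Suc j) \<union> shell (Suc (Suc j)))"
proof
  fix w assume "w \<in> ball (complex_of_real s) ((1 - s) / 2)"
  then have w: "cmod (of_real s - w) < (1 - s) / 2" by (simp add: dist_norm)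
  have s1: "(1/2) ^ j / 2 \<le> 1 - s" "1 - s \<le> (1/2) ^ j" "0 \<le> s"
    using s dpt_simps(4)[of j] by (auto simp: dpt_def)
  have "cmod (1 - of_real s) = 1 - s" using s1 by (smt (verit) norm_of_real of_real_1 of_real_diff zero_le_power zero_le_divide_iff)
  then have "cmod (1 - w) \<le> (1 - s) + cmod (of_real s - w)" "1 - s \<le> cmod (1 - w) + cmod (of_real s - w)"
    using norm_triangle_ineq[of "1 - of_real s" "of_real s - w"] norm_triangle_ineq4[of "1 - w" "of_real s - w"] by simp_all
  then have 1: "(1/2) ^ j / 4 \<le> cmod (1 - w)" "cmod (1 - w) < 2 * (1/2) ^ j"
    using w s1 by argo+
  have "cmod w \<le> s + cmod (of_real s - w)"
    using norm_triangle_ineq4[of "of_real s" "of_real s - w"] s1 by simp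
  then have "cmod w < 1" using w s1 zero_less_power[of "1/2::real" j] by argo
  then show "w \<in> ball 0 1 \<inter> (shell j \<union> shell (Suc j) \<union> shell (Suc (Suc j)))"
    using 1 by (auto simp: shell_def field_simps)
qed

text \<open>The mean value inequality at the maximum point of each interval, summed with overlap
  three.\<close>

lemma dyadic_sup_sum_deriv:
  fixes p \<alpha> :: real
  assumes p: "p > 0" and \<alpha>: "\<alpha> > -1"
  obtains C where "C > 0"
    "\<And>h A. h holomorphic_on ball 0 1 \<Longrightarrow> A \<ge> 0 \<Longrightarrow> A_int p \<alpha> h \<le> ennreal A \<Longrightarrow>
      summable (\<lambda>j. (((1/2) powr ((\<alpha> + 2) / p)) ^ j * dmax h j) powr p) \<and>
      (\<Sum>j. (((1/2) powr ((\<alpha> + 2) / p)) ^ j * dmax h j) powr p) \<le> C * A"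
proof -
  obtain C where C: "C > 0" "\<And>h z. h holomorphic_on ball 0 1 \<Longrightarrow> z \<in> ball 0 1 \<Longrightarrow>
      ennreal (cmod (h z) powr p * (1 - cmod z) powr (\<alpha> + 2)) \<le> ennreal C *
        (\<integral>\<^sup>+w. indicator (ball z ((1 - cmod z) / 2)) w * ennreal (cmod (h w) powr p * (1 - (cmod w)\<^sup>2) powr \<alpha>) \<partial>lborel)"
    by (rule weighted_local_bound[OF p, of \<alpha>]) (rule that)
  \<comment> \<open>From (1/2)^j \<le> 2 (1 - s), raised to the power \<alpha> + 2.\<close>
  define C1 where "C1 = 2 powr (\<alpha> + 2) * C"
  have C1: "C1 > 0" using C by (simp add: C1_def)
  show ?thesis
  proof (rule that[of "3 * C1 * (pi / (\<alpha> + 1))"])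
    show "3 * C1 * (pi / (\<alpha> + 1)) > 0" using C1 \<alpha> by simp
    fix h A assume h: "h holomorphic_on ball 0 1" and A: "A \<ge> 0" "A_int p \<alpha> h \<le> ennreal A"
    define F where "F = (\<lambda>z. indicator (ball 0 1) z * ennreal (cmod (h z) powr p * (1 - (cmod z)\<^sup>2) powr \<alpha>))"
    have mF[measurable]: "F \<in> borel_measurable borel" unfolding F_def by (rule weighted_integral_eq_A_int(2)[OF \<alpha> p h])
    define I where "I = (\<lambda>J. \<integral>\<^sup>+z. indicator (shell J) z * F z \<partial>lborel)"
    define a where "a = (\<lambda>j. (((1/2) powr ((\<alpha> + 2) / p)) ^ j * dmax h j) powr p)"
    have aj: "ennreal (a j) \<le> ennreal C1 * (I j + I (Suc j) + I (Suc (Suc j)))" for j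
    proof -
      obtain s where s: "s \<in> {dpt j..dpt (Suc j)}" "dmax h j = cmod (h (of_real s))"
        using dmax_attained[OF h] by blast
      have s1: "(1/2) ^ j \<le> 2 * (1 - s)" "0 \<le> s" using s dpt_simps(4)[of j] by (auto simp: dpt_def)
      have "s \<le> dpt (Suc j)" using s by simp
      then have s1: "(1/2) ^ j \<le> 2 * (1 - s)" "0 \<le> s" "s < 1" using s1 dpt_simps(5)[of "Suc j"] by linarith+
      have "a j = (((1/2) powr ((\<alpha> + 2) / p)) ^ j) powr p * cmod (h (of_real s)) powr p"
        unfolding a_def s(2) by (rule powr_mult)
      also have "(((1/2) powr ((\<alpha> + 2) / p)) ^ j) powr p = ((1/2) ^ j) powr (\<alpha> + 2)"
        unfolding dyadic_powr[symmetric] powr_powr using p by simp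
      also have "\<dots> \<le> (2 * (1 - s)) powr (\<alpha> + 2)" using s1 \<alpha> by (intro powr_mono2) auto
      also have "(2 * (1 - s)) powr (\<alpha> + 2) = 2 powr (\<alpha> + 2) * (1 - s) powr (\<alpha> + 2)" by (rule powr_mult)
      finally have "a j \<le> 2 powr (\<alpha> + 2) * (cmod (h (of_real s)) powr p * (1 - cmod (of_real s)) powr (\<alpha> + 2))"
        using s1 by (simp add: mult_right_mono mult_ac)
      then have "ennreal (a j) \<le> ennreal (2 powr (\<alpha> + 2)) * ennreal (cmod (h (of_real s)) powr p * (1 - cmod (of_real s)) powr (\<alpha> + 2))"
        by (subst ennreal_mult[symmetric]) (auto intro: ennreal_leI)
      also have "\<dots> \<le> ennreal (2 powr (\<alpha> + 2)) * (ennreal C *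
        (\<integral>\<^sup>+w. indicator (ball (of_real s) ((1 - cmod (of_real s)) / 2)) w * ennreal (cmod (h w) powr p * (1 - (cmod w)\<^sup>2) powr \<alpha>) \<partial>lborel))"
        using s1 by (intro mult_left_mono C(2)[OF h]) auto
      also have "\<dots> = ennreal C1 *
        (\<integral>\<^sup>+w. indicator (ball (of_real s) ((1 - s) / 2)) w * ennreal (cmod (h w) powr p * (1 - (cmod w)\<^sup>2) powr \<alpha>) \<partial>lborel)"
        unfolding C1_def using C(1) s1 by (subst ennreal_mult) (auto simp: mult.assoc)
      also have "\<dots> \<le> ennreal C1 * (\<integral>\<^sup>+w. indicator (shell j) w * F w + indicator (shell (Suc j)) w * F w + indicator (shell (Suc (Suc j))) w * F w \<partial>lborel)"
      proof (intro mult_left_mono nn_integral_mono)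
        fix w
        show "indicator (ball (of_real s) ((1 - s) / 2)) w * ennreal (cmod (h w) powr p * (1 - (cmod w)\<^sup>2) powr \<alpha>)
          \<le> indicator (shell j) w * F w + indicator (shell (Suc j)) w * F w + indicator (shell (Suc (Suc j))) w * F w"
        proof (cases "w \<in> ball (complex_of_real s) ((1 - s) / 2)")
          case True
          then have w: "w \<in> ball 0 1" "w \<in> shell j \<or> w \<in> shell (Suc j) \<or> w \<in> shell (Suc (Suc j))"
            using ball_radius_subset_shells[OF s(1)] by auto
          have "indicator (ball (of_real s) ((1 - s) / 2)) w * ennreal (cmod (h w) powr p * (1 - (cmod w)\<^sup>2) powr \<alpha>) = F w"
            using True w(1) by (simp add: F_def)
          then show ?thesis using w(2) by (auto simp: indicator_def add_increasing add_increasing2)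
        qed simp
      qed simp
      also have "\<dots> = ennreal C1 * (I j + I (Suc j) + I (Suc (Suc j)))"
        unfolding I_def by (simp add: nn_integral_add)
      finally show ?thesis .
    qed
    have S0: "(\<Sum>J. I J) \<le> (\<integral>\<^sup>+z. F z \<partial>lborel)" unfolding I_def by (rule sum_shell_le[OF mF])
    have shift: "(\<Sum>J. I (Suc J)) \<le> (\<Sum>J. I J)" "(\<Sum>J. I (Suc (Suc J))) \<le> (\<Sum>J. I J)"
    proof -
      have le: "(\<Sum>J. g (Suc J)) \<le> (\<Sum>J. g J)" for g :: "nat \<Rightarrow> ennreal"
        using suminf_offset[of g 1] by (simp add: add_increasing2)
      show "(\<Sum>J. I (Suc J)) \<le> (\<Sum>J. I J)" by (rule le)
      show "(\<Sum>J. I (Suc (Suc J))) \<le> (\<Sum>J. I J)" using le[of "\<lambda>J. I (Suc J)"] le[of I] by (rule order_trans)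
    qed
    have "(\<Sum>j. ennreal (a j)) \<le> (\<Sum>j. ennreal C1 * (I j + I (Suc j) + I (Suc (Suc j))))"
      by (intro suminf_le aj) auto
    also have "\<dots> = ennreal C1 * ((\<Sum>j. I j) + (\<Sum>j. I (Suc j)) + (\<Sum>j. I (Suc (Suc j))))"
      by (simp add: suminf_add[symmetric] ennreal_suminf_cmult)
    also have "\<dots> \<le> ennreal C1 * ((\<integral>\<^sup>+z. F z \<partial>lborel) + (\<integral>\<^sup>+z. F z \<partial>lborel) + (\<integral>\<^sup>+z. F z \<partial>lborel))"
      using S0 shift by (intro mult_left_mono add_mono) (auto intro: order_trans)
    also have "\<dots> = ennreal C1 * (3 * (\<integral>\<^sup>+z. F z \<partial>lborel))"
      by (metis (no_types, lifting) add.commute mult_2 distrib_right numeral_Bit1 numeral_One one_add_one mult_1)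
    also have "(\<integral>\<^sup>+z. F z \<partial>lborel) = ennreal (pi / (\<alpha> + 1)) * A_int p \<alpha> h"
      unfolding F_def by (rule weighted_integral_eq_A_int(1)[OF \<alpha> p h])
    also have "ennreal C1 * (3 * (ennreal (pi / (\<alpha> + 1)) * A_int p \<alpha> h)) \<le> ennreal C1 * (3 * (ennreal (pi / (\<alpha> + 1)) * ennreal A))"
      by (intro mult_left_mono A(2)) auto
    also have "\<dots> = ennreal (3 * C1 * (pi / (\<alpha> + 1)) * A)"
    proof -
      have "3 = ennreal 3" by simp
      then show ?thesis using C1 \<alpha> A(1) by (simp only: ennreal_mult[symmetric] mult_nonneg_nonneg divide_nonneg_nonneg pi_ge_zero less_imp_le zero_le_numeral) (simp add: ennreal_mult[symmetric] mult_ac)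
    qed
    finally have fin: "(\<Sum>j. ennreal (a j)) \<le> ennreal (3 * C1 * (pi / (\<alpha> + 1)) * A)" .
    have nn: "0 \<le> 3 * C1 * (pi / (\<alpha> + 1)) * A" using C1 \<alpha> A(1) by simp
    show "summable (\<lambda>j. (((1/2) powr ((\<alpha> + 2) / p)) ^ j * dmax h j) powr p) \<and>
      (\<Sum>j. (((1/2) powr ((\<alpha> + 2) / p)) ^ j * dmax h j) powr p) \<le> 3 * C1 * (pi / (\<alpha> + 1)) * A"
      using suminf_ennreal_le_imp[OF _ fin nn] unfolding a_def by auto
  qed
qed

text \<open>A discrete Hardy inequality: f is bounded by a sum of increments, and the factor
  \<rho>^k with \<rho> = 2^-\<gamma> < 1 turns that sum into a convolution with a decaying kernel.
  The embedding of l^p into l^q comes before Young's inequality, which needs an exponent of at least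
  1.\<close>

lemma dyadic_sup_sum:
  fixes p q \<alpha> :: real
  assumes p: "p > 0" and \<alpha>: "\<alpha> > -1" and q: "q \<ge> 1" "p \<le> q" and \<gamma>: "\<gamma> = (\<alpha> + 2) / p - 1" "\<gamma> > 0"
  obtains C where "C > 0"
    "\<And>f A. f holomorphic_on ball 0 1 \<Longrightarrow> A \<ge> 0 \<Longrightarrow> A_int p \<alpha> (deriv f) \<le> ennreal A \<Longrightarrow>
      summable (\<lambda>k. (((1/2) powr \<gamma>) ^ k * dmax f k) powr q) \<and>
      (\<Sum>k. (((1/2) powr \<gamma>) ^ k * dmax f k) powr q) \<le> C * (A powr (q / p) + cmod (f 0) powr q)"
proof -
  obtain C0 where C0: "C0 > 0" 
    "\<And>h A. h holomorphic_on ball 0 1 \<Longrightarrow> A \<ge> 0 \<Longrightarrow> A_int p \<alpha> h \<le> ennreal A \<Longrightarrow>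
      summable (\<lambda>j. (((1/2) powr ((\<alpha> + 2) / p)) ^ j * dmax h j) powr p) \<and>
      (\<Sum>j. (((1/2) powr ((\<alpha> + 2) / p)) ^ j * dmax h j) powr p) \<le> C0 * A"
    by (rule dyadic_sup_sum_deriv[OF p \<alpha>]) (rule that)
  define \<rho> where "\<rho> = (1/2::real) powr \<gamma>"
  have \<rho>: "0 < \<rho>" "\<rho> < 1" using \<gamma>(2) powr_less_mono2_neg[of "-1" ] by (auto simp: \<rho>_def powr_divide)
  define Y where "Y = (2 / (1 - \<rho>) + 1) powr (q + 1)"
  have Y: "Y > 0" 
  proof -
    have "2 / (1 - \<rho>) > 0" using \<rho> by simp
    then have "2 / (1 - \<rho>) + 1 > 0" by linarith
    then show ?thesis unfolding Y_def by (simp only: powr_gt_zero)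
  qed
  define C where "C = Y * 2 powr q * max (C0 powr (q / p)) 1"
  show ?thesis
  proof (rule that[of C])
    show "C > 0" using Y by (simp add: C_def)
    fix f A assume f: "f holomorphic_on ball 0 1" and A: "A \<ge> 0" "A_int p \<alpha> (deriv f) \<le> ennreal A"
    have df: "deriv f holomorphic_on ball 0 1" by (intro holomorphic_deriv f) auto
    define a where "a = (\<lambda>j. ((1/2) powr ((\<alpha> + 2) / p)) ^ j * dmax (deriv f) j)"
    have a0: "a j \<ge> 0" for j unfolding a_def by (intro mult_nonneg_nonneg dmax_nonneg df) auto
    have sa: "summable (\<lambda>j. a j powr p)" "(\<Sum>j. a j powr p) \<le> C0 * A"
      using C0(2)[OF df A] by (auto simp: a_def)
    define T where "T = C0 * A"
    have T0: "T \<ge> 0" using C0(1) A(1) by (simp add: T_def)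
    have ajT: "a j powr p \<le> T" for j
      using sum_le_suminf[OF sa(1), of "{j}"] sa(2) by (auto simp: T_def)
    \<comment> \<open>Each single term is bounded through the whole sum, which lets the excess power
      q - p be pulled out.\<close>
    have aq: "a j powr q \<le> T powr ((q - p) / p) * a j powr p" for j
    proof -
      have "a j powr q = (a j powr p) powr ((q - p) / p) * a j powr p"
        using p by (simp add: powr_powr flip: powr_add)
      also have "\<dots> \<le> T powr ((q - p) / p) * a j powr p"
        using q p ajT by (intro mult_right_mono powr_mono2) auto
      finally show ?thesis .
    qed
    have sq: "summable (\<lambda>j. a j powr q)"
      by (rule summable_comparison_test[OF _ summable_mult[OF sa(1), of "T powr ((q - p) / p)"]]) (use aq in auto)
    have "(\<Sum>j. a j powr q) \<le> (\<Sum>j. T powr ((q - p) / p) * a j powr p)"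
      by (intro suminf_le aq sq summable_mult sa)
    also have "\<dots> \<le> T powr ((q - p) / p) * T"
      using sa by (subst suminf_mult) (auto intro!: mult_left_mono simp: T_def)
    also have "\<dots> = T powr (q / p)"
    proof (cases "T = 0")
      case False
      then have "T powr ((q - p) / p) * T powr 1 = T powr (q / p)" unfolding powr_add[symmetric] using p by (simp add: diff_divide_distrib)
      then show ?thesis using T0 by simp
    qed simp
    finally have Sq: "(\<Sum>j. a j powr q) \<le> T powr (q / p)" .
    \<comment> \<open>The value f 0 is stored in the term j = 0, so that one convolution covers both
      parts of the bound for f.\<close>
    define b where "b = (\<lambda>j. a j + (if j = 0 then cmod (f 0) else 0))"
    have b0: "b j \<ge> 0" for j using a0 by (simp add: b_def)
    have bq: "b j powr q \<le> 2 powr q * (a j powr q + (if j = 0 then cmod (f 0) powr q else 0))" for j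
    proof (cases "j = 0")
      case True
      have "b j powr q \<le> (2 * max (a j) (cmod (f 0))) powr q"
        using True q a0[of j] by (intro powr_mono2) (auto simp: b_def)
      also have "\<dots> = 2 powr q * (max (a j) (cmod (f 0))) powr q" using a0 by (simp add: powr_mult)
      also have "\<dots> \<le> 2 powr q * (a j powr q + cmod (f 0) powr q)"
        by (intro mult_left_mono) (auto simp: max_def)
      finally show ?thesis using True by simp
    next
      case False
      have "1 * a j powr q \<le> 2 powr q * a j powr q" using q by (intro mult_right_mono ge_one_powr_ge_zero) auto
      then show ?thesis using False by (simp add: b_def)
    qed
    have s1: "summable (\<lambda>j. if j = 0 then cmod (f 0) powr q else 0)" "(\<Sum>j. if j = 0 then cmod (f 0) powr q else 0) = cmod (f 0) powr q"
      using sums_single[of 0 "\<lambda>_. cmod (f 0) powr q"] by (auto simp: sums_iff)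
    have sr: "summable (\<lambda>j. 2 powr q * (a j powr q + (if j = 0 then cmod (f 0) powr q else 0)))"
      by (intro summable_mult summable_add sq s1)
    have sb: "summable (\<lambda>j. b j powr q)"
      by (rule summable_comparison_test[OF _ sr]) (use bq in auto)
    have "(\<Sum>j. b j powr q) \<le> (\<Sum>j. 2 powr q * (a j powr q + (if j = 0 then cmod (f 0) powr q else 0)))"
      by (intro suminf_le bq sb sr)
    also have "\<dots> = 2 powr q * ((\<Sum>j. a j powr q) + cmod (f 0) powr q)"
      by (simp only: suminf_mult[OF summable_add[OF sq s1(1)]] suminf_add[OF sq s1(1), symmetric] s1(2))
    also have "\<dots> \<le> 2 powr q * (T powr (q / p) + cmod (f 0) powr q)" using Sq by (intro mult_left_mono) auto
    finally have Sb: "(\<Sum>j. b j powr q) \<le> 2 powr q * (T powr (q / p) + cmod (f 0) powr q)" .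
    note Yg = discrete_young[OF \<rho> q(1) b0 sb, folded Y_def]
    have ck: "\<rho> ^ k * dmax f k \<le> (\<Sum>j. b j * dkernel \<rho> j k)" for k
    proof -
      obtain s where s: "s \<in> {dpt k..dpt (Suc k)}" "dmax f k = cmod (f (of_real s))"
        using dmax_attained[OF f] by blast
      have aj: "\<rho> ^ j * ((1/2) ^ j * dmax (deriv f) j) = a j" for j
      proof -
        \<comment> \<open>(\<alpha> + 2)/p = \<gamma> + 1: one power of 1/2 per index is the length
          of the interval, the others form \<rho>.\<close>
        have "(1/2::real) powr ((\<alpha> + 2) / p) = \<rho> * (1/2)"
          using powr_add[of "1/2::real" \<gamma> 1] by (simp add: \<rho>_def \<gamma>(1))
        then show ?thesis by (simp only: a_def power_mult_distrib mult.assoc)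
      qed
      have "\<rho> ^ k * dmax f k \<le> \<rho> ^ k * (cmod (f 0) + (\<Sum>j\<le>k. (1/2) ^ j * dmax (deriv f) j))"
        unfolding s(2) using \<rho> by (intro mult_left_mono norm_le_sum_dmax_deriv[OF f s(1)]) auto
      also have "\<dots> = \<rho> ^ k * cmod (f 0) + (\<Sum>j\<le>k. \<rho> ^ (k - j) * a j)"
        unfolding distrib_left sum_distrib_left
      proof (intro arg_cong2[where f="(+)"] sum.cong refl)
        fix j assume "j \<in> {..k}"
        then have "\<rho> ^ k = \<rho> ^ (k - j) * \<rho> ^ j" by (simp flip: power_add)
        then show "\<rho> ^ k * ((1/2) ^ j * dmax (deriv f) j) = \<rho> ^ (k - j) * a j" by (simp only: aj[symmetric] mult.assoc)
      qed
      also have "\<dots> = (\<Sum>j\<le>k. b j * dkernel \<rho> j k)"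
      proof -
        have "(\<Sum>j\<le>k. b j * dkernel \<rho> j k) = (\<Sum>j\<le>k. \<rho> ^ (k - j) * a j + (if j = 0 then \<rho> ^ k * cmod (f 0) else 0))"
          by (intro sum.cong) (auto simp: b_def dkernel_def algebra_simps)
        also have "\<dots> = (\<Sum>j\<le>k. \<rho> ^ (k - j) * a j) + \<rho> ^ k * cmod (f 0)"
          by (simp add: sum.distrib)
        finally show ?thesis by simp
      qed
      also have "\<dots> \<le> (\<Sum>j. b j * dkernel \<rho> j k)"
        using b0 \<rho> by (intro sum_le_suminf Yg(1)) (auto simp: dkernel_def)
      finally show ?thesis .
    qed
    have c0: "\<rho> ^ k * dmax f k \<ge> 0" for k using \<rho> by (intro mult_nonneg_nonneg dmax_nonneg f) auto
    have cq: "(\<rho> ^ k * dmax f k) powr q \<le> (\<Sum>j. b j * dkernel \<rho> j k) powr q" for k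
      using ck c0 q by (intro powr_mono2) auto
    have sc: "summable (\<lambda>k. (\<rho> ^ k * dmax f k) powr q)"
      by (rule summable_comparison_test[OF _ Yg(2)]) (use cq in auto)
    have "(\<Sum>k. (\<rho> ^ k * dmax f k) powr q) \<le> (\<Sum>k. (\<Sum>j. b j * dkernel \<rho> j k) powr q)"
      by (intro suminf_le cq sc Yg(2))
    also have "\<dots> \<le> Y * (\<Sum>j. b j powr q)" by (rule Yg(3))
    also have "\<dots> \<le> Y * (2 powr q * (T powr (q / p) + cmod (f 0) powr q))" using Y by (intro mult_left_mono Sb) auto
    also have "T powr (q / p) + cmod (f 0) powr q \<le> max (C0 powr (q / p)) 1 * (A powr (q / p) + cmod (f 0) powr q)"
    proof -
      have "T powr (q / p) = C0 powr (q / p) * A powr (q / p)" using C0(1) A(1) by (simp add: T_def powr_mult)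
      also have "\<dots> \<le> max (C0 powr (q / p)) 1 * A powr (q / p)" by (intro mult_right_mono) auto
      finally have 1: "T powr (q / p) \<le> max (C0 powr (q / p)) 1 * A powr (q / p)" .
      have "1 * cmod (f 0) powr q \<le> max (C0 powr (q / p)) 1 * cmod (f 0) powr q" by (intro mult_right_mono) auto
      with 1 show ?thesis by (simp only: distrib_left)
    qed
    finally have "(\<Sum>k. (\<rho> ^ k * dmax f k) powr q) \<le> C * (A powr (q / p) + cmod (f 0) powr q)"
      using Y by (simp add: C_def mult_ac mult_left_mono)
    then show "summable (\<lambda>k. (((1/2) powr \<gamma>) ^ k * dmax f k) powr q) \<and>
      (\<Sum>k. (((1/2) powr \<gamma>) ^ k * dmax f k) powr q) \<le> C * (A powr (q / p) + cmod (f 0) powr q)"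
      using sc by (simp add: \<rho>_def)
  qed
qed

subsection \<open>The dyadic bound for the operator\<close>

lemma half_powr: "(1/2::real) powr x = 2 powr (- x)"
  by (simp add: powr_minus_divide powr_divide)

lemma half_power: "(1/2::real) ^ n = 2 powr (- real n)"
  by (simp add: powr_minus_divide powr_realpow power_one_over)

lemma powr_real_mult: "(2::real) powr (m * real n) = (2 powr m) ^ n"
  by (simp add: powr_power mult.commute)

text \<open>If g is not integrable, the left side is 0 by the default value of the integral.\<close>

lemma norm_integral_le_nn_integral:
  fixes g :: "'a \<Rightarrow> complex"
  shows "ennreal (norm (\<integral>t. g t \<partial>M)) \<le> (\<integral>\<^sup>+t. ennreal (norm (g t)) \<partial>M)"
  using integral_norm_bound_ennreal[of M g] by (cases "integrable M g") (auto simp: not_integrable_integral_eq)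

context unit_interval_measure
begin

text \<open>The whole tail up to 1 rather than the k-th interval, because Carleson conditions bound
  tails.\<close>

definition mass :: "nat \<Rightarrow> real" where "mass k = measure \<mu> {dpt k..<1}"

text \<open>On the k-th interval f, the weight and the measure are each replaced by an upper bound.
  Neighbouring closed intervals share an endpoint, which is harmless for an upper bound. The weight
  will be a kernel, a power of 1 - t, or 1.\<close>

lemma nn_integral_dyadic_le:
  assumes f: "f holomorphic_on ball 0 1"
    and w: "\<And>k t. t \<in> {dpt k..dpt (Suc k)} \<Longrightarrow> w t \<le> W k" and W: "\<And>k. 0 \<le> W k"
  shows "(\<integral>\<^sup>+t. ennreal (cmod (radial f t) * w t) \<partial>\<mu>) \<le> (\<Sum>k. ennreal (dmax f k * W k * mass k))"
proof -
  have "(\<integral>\<^sup>+t. ennreal (cmod (radial f t) * w t) \<partial>\<mu>)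
    \<le> (\<integral>\<^sup>+t. (\<Sum>k. ennreal (dmax f k * W k) * indicator {dpt k..dpt (Suc k)} t) \<partial>\<mu>)"
  proof (rule nn_integral_mono)
    fix t
    show "ennreal (cmod (radial f t) * w t) \<le> (\<Sum>k. ennreal (dmax f k * W k) * indicator {dpt k..dpt (Suc k)} t)"
    proof (cases "t \<in> {0..<1}")
      case True
      obtain k where k: "t \<in> {dpt k..dpt (Suc k)}"
      proof -
        obtain J where J: "(1/2) ^ J \<le> 1 - t" "1 - t < 2 * (1/2) ^ J"
          by (rule dyadic_scale[of "1 - t"]) (use True in auto)
        show thesis
        \<comment> \<open>The scale J of 1 - t belongs to the interval with index J - 1; J = 0
          happens for t = 0 only.\<close>
        proof (cases J)
          case 0
          then have "t = 0" using J True by auto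
          then show ?thesis using that[of 0] by (simp add: dpt_def)
        next
          case (Suc k)
          then show ?thesis using that[of k] J by (simp add: dpt_def)
        qed
      qed
      have "ennreal (cmod (radial f t) * w t) \<le> ennreal (dmax f k * W k)"
      proof (rule ennreal_leI)
        have "cmod (radial f t) * w t \<le> cmod (radial f t) * W k" by (intro mult_left_mono w k) auto
        also have "\<dots> \<le> dmax f k * W k"
          using dmax_upper[OF f k] True by (intro mult_right_mono W) (auto simp: radial_def)
        finally show "cmod (radial f t) * w t \<le> dmax f k * W k" .
      qed
      also have "\<dots> = ennreal (dmax f k * W k) * indicator {dpt k..dpt (Suc k)} t" using k by simp
      also have "\<dots> \<le> (\<Sum>k. ennreal (dmax f k * W k) * indicator {dpt k..dpt (Suc k)} t)"
        using sum_le_suminf[of "\<lambda>k. ennreal (dmax f k * W k) * indicator {dpt k..dpt (Suc k)} t" "{k}"]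
        by (simp only: summableI finite.intros sum.insert sum.empty finite.emptyI empty_iff not_False_eq_True add_0_right zero_le simp_thms)
      finally show ?thesis .
    qed (simp add: radial_def)
  qed
  also have "\<dots> = (\<Sum>k. \<integral>\<^sup>+t. ennreal (dmax f k * W k) * indicator {dpt k..dpt (Suc k)} t \<partial>\<mu>)"
    by (rule nn_integral_suminf) measurable
  also have "\<dots> \<le> (\<Sum>k. ennreal (dmax f k * W k * mass k))"
  proof (intro suminf_le)
    fix k
    have "(\<integral>\<^sup>+t. ennreal (dmax f k * W k) * indicator {dpt k..dpt (Suc k)} t \<partial>\<mu>)
        = ennreal (dmax f k * W k) * emeasure \<mu> {dpt k..dpt (Suc k)}" by (simp add: nn_integral_cmult_indicator)
    also have "\<dots> \<le> ennreal (dmax f k * W k) * emeasure \<mu> {dpt k..<1}"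
      using dpt_simps(5)[of "Suc k"] by (intro mult_left_mono emeasure_mono) auto
    also have "\<dots> = ennreal (dmax f k * W k * mass k)"
      using dmax_nonneg[OF f, of k] W[of k] by (simp add: mass_def emeasure_eq_measure ennreal_mult)
    finally show "(\<integral>\<^sup>+t. ennreal (dmax f k * W k) * indicator {dpt k..dpt (Suc k)} t \<partial>\<mu>) \<le> ennreal (dmax f k * W k * mass k)" .
  qed auto
  finally show ?thesis .
qed

text \<open>Both 1 - t and |1 - z| / 2 are at most |1 - t z|, so the larger of the two dyadic scales
  bounds it from below.\<close>

lemma kernel_dyadic_bound:
  assumes t: "t \<in> {dpt k..dpt (Suc k)}" and z: "z \<in> ball 0 1" "z \<in> shell J" and B: "B \<ge> 0"
  shows "cmod (1 - of_real t * z) powr (- B) \<le> 2 powr B * 2 powr (B * real (min k J))"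
proof -
  have t1: "0 \<le> t" "t < 1" using t dpt_simps(4)[of k] dpt_simps(5)[of "Suc k"] by (auto simp del: dpt_simps)
  have cz: "cmod z < 1" using z by simp
  have tz: "t * cmod z \<le> t" using t1 cz by (simp add: mult_left_le)
  have a: "1 - t \<le> cmod (1 - of_real t * z)"
    using norm_triangle_ineq2[of 1 "of_real t * z"] t1 tz by (simp add: norm_mult)
  have "cmod (1 - z) \<le> cmod (1 - of_real t * z) + cmod (of_real (1 - t) * z)"
    using norm_triangle_ineq4[of "1 - of_real t * z" "of_real (1 - t) * z"] by (simp add: algebra_simps)
  also have "cmod (of_real (1 - t) * z) \<le> 1 - t" using t1 cz by (simp add: norm_mult mult_left_le del: of_real_diff)
  finally have b: "cmod (1 - z) \<le> 2 * cmod (1 - of_real t * z)" using a by linarith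
  have "t \<le> 1 - (1/2) ^ k / 2" using t by (simp add: dpt_def)
  then have "(1/2) ^ k \<le> 2 * cmod (1 - of_real t * z)" "(1/2) ^ J \<le> 2 * cmod (1 - of_real t * z)"
    using a b z(2) by (auto simp: shell_def)
  then have "(1/2) ^ min k J / 2 \<le> cmod (1 - of_real t * z)" by (simp add: min_def)
  then have "cmod (1 - of_real t * z) powr (- B) \<le> ((1/2) ^ min k J / 2) powr (- B)"
    using B by (intro powr_mono2') auto
  also have "(1/2::real) ^ min k J / 2 = (1/2) ^ Suc (min k J)" by (simp only: power_Suc2 times_divide_eq_right mult_1_right)
  also have "\<dots> = 2 powr (- real (Suc (min k J)))" by (rule half_power)
  also have "(2 powr (- real (Suc (min k J)))) powr (- B) = 2 powr B * 2 powr (B * real (min k J))"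
    unfolding powr_powr powr_add[symmetric] by (simp add: algebra_simps)
  finally show ?thesis .
qed

text \<open>Compared with e J + e' k, the exponent (e + e') min k J falls short by e (J - k) or e'
  (k - J), according to which index is larger. This deficit is the off-diagonal decay.\<close>

lemma dyadic_exponent_bound:
  fixes e e' :: real
  assumes "e > 0" "e' > 0"
  shows "2 powr ((e + e') * real (min k J)) \<le>
      2 powr (e * real J) * ((2 powr e') ^ k * dkernel ((1/2) powr min e e') k J)"
proof -
  have "(e + e') * real (min k J) \<le> e * real J + e' * real k - min e e' * real ((k - J) + (J - k))"
  proof (cases "k \<le> J")
    case True
    have "min e e' * (real J - real k) \<le> e * (real J - real k)" using True by (intro mult_right_mono) auto
    then show ?thesis using True by (simp add: of_nat_diff algebra_simps)
  next
    case False
    have "min e e' * (real k - real J) \<le> e' * (real k - real J)" using False by (intro mult_right_mono) auto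
    then show ?thesis using False by (simp add: of_nat_diff algebra_simps)
  qed
  then have "2 powr ((e + e') * real (min k J)) \<le> 2 powr (e * real J + e' * real k - min e e' * real ((k - J) + (J - k)))"
    by (intro powr_mono) auto
  also have "\<dots> = 2 powr (e * real J) * ((2 powr e') ^ k * (2 powr (- min e e' * real ((k - J) + (J - k)))))"
    by (simp add: powr_add[symmetric] powr_power algebra_simps)
  also have "2 powr (- min e e' * real ((k - J) + (J - k))) = dkernel ((1/2) powr min e e') k J"
    unfolding dkernel_def half_powr powr_real_mult ..
  finally show ?thesis .
qed

text \<open>The kernel exponent B = \<beta> + 1 splits into e = B/q and e' = B (1 - 1/q). The part e
  goes with the shell index J, where weight and area cancel it; the part e' goes with k and joins
  the mass. Young's inequality sums what is left.\<close>

lemma Hilbert_op_dyadic_bound: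
  assumes \<beta>: "\<beta> > 1" and q: "q > 1"
  obtains C where "C > 0"
    "\<And>f. f holomorphic_on ball 0 1 \<Longrightarrow> summable (\<lambda>k. cmod (taylor_coeff f k) * moment k) \<Longrightarrow>
      summable (\<lambda>k. (dmax f k * mass k * (2 powr ((\<beta> + 1) * (1 - 1 / q))) ^ k) powr q) \<Longrightarrow>
      A_int q (\<beta> - 1) (deriv (Hilbert_op \<mu> \<beta> f)) \<le> ennreal (C * (\<Sum>k. (dmax f k * mass k * (2 powr ((\<beta> + 1) * (1 - 1 / q))) ^ k) powr q)) \<and>
      cmod (Hilbert_op \<mu> \<beta> f 0) powr q \<le> C * (\<Sum>k. (dmax f k * mass k * (2 powr ((\<beta> + 1) * (1 - 1 / q))) ^ k) powr q)"
proof -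
  define B where "B = \<beta> + 1"
  define e where "e = B / q"
  define e' where "e' = B * (1 - 1 / q)"
  have ee: "e > 0" "e' > 0" "e + e' = B" "e * q = B" "B > 0"
  proof -
    show "B > 0" using \<beta> by (simp add: B_def)
    then show "e > 0" "e' > 0" using q by (auto simp: e_def e'_def intro!: mult_pos_pos)
    show "e + e' = B" "e * q = B" using q by (auto simp: e_def e'_def field_simps)
  qed
  define \<rho> where "\<rho> = (1/2::real) powr min e e'"
  have \<rho>: "0 < \<rho>" "\<rho> < 1" using ee by (auto simp: \<rho>_def powr_divide min_def)
  define Y where "Y = (2 / (1 - \<rho>) + 1) powr (q + 1)"
  have Y: "Y > 0"
  proof -
    have "2 / (1 - \<rho>) > 0" using \<rho> by simp
    then have "2 / (1 - \<rho>) + 1 > 0" by linarith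
    then show ?thesis unfolding Y_def by (simp only: powr_gt_zero)
  qed
  \<comment> \<open>The last two factors come from 1 - |z|^2 \<le> 4 (1/2)^J on the shell and from
    the area of a disc of radius 2 (1/2)^J.\<close>
  define K where "K = (\<beta> * 2 powr B) powr q * 4 powr (\<beta> - 1) * (4 * pi)"
  have K: "K > 0" using \<beta> by (simp add: K_def)
  define C where "C = max (\<beta> / pi * K * Y) Y"
  show ?thesis
  proof (rule that[of C])
    show "C > 0" using Y by (simp add: C_def)
    fix f assume f: "f holomorphic_on ball 0 1" and S: "summable (\<lambda>k. cmod (taylor_coeff f k) * moment k)"
    define d where "d = (\<lambda>k. dmax f k * mass k * (2 powr e') ^ k)"
    assume "summable (\<lambda>k. (dmax f k * mass k * (2 powr ((\<beta> + 1) * (1 - 1 / q))) ^ k) powr q)"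
    then have sd: "summable (\<lambda>k. d k powr q)" by (simp add: d_def e'_def B_def)
    have d0: "d k \<ge> 0" for k unfolding d_def mass_def by (intro mult_nonneg_nonneg dmax_nonneg f) auto
    have \<beta>0: "\<beta> > 0" using \<beta> by simp
    note H = Hilbert_op_integral[OF f S \<beta>0]
    define h where "h = deriv (Hilbert_op \<mu> \<beta> f)"
    have h: "h holomorphic_on ball 0 1" unfolding h_def by (intro holomorphic_deriv H(5)) auto
    define E where "E = (\<lambda>J. \<Sum>k. d k * dkernel \<rho> k J)"
    note young = discrete_young[OF \<rho> less_imp_le[OF q] d0 sd, folded Y_def]
    have Yg: "summable (\<lambda>k. d k * dkernel \<rho> k J)" "summable (\<lambda>J. E J powr q)"
      "(\<Sum>J. E J powr q) \<le> Y * (\<Sum>k. d k powr q)" for J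
      unfolding E_def by (rule young)+
    have k0: "dkernel \<rho> k J \<ge> 0" for k J using \<rho> by (simp add: dkernel_def)
    have E0: "E J \<ge> 0" for J unfolding E_def by (intro suminf_nonneg Yg(1) mult_nonneg_nonneg d0 k0)
    have sumE: "(\<Sum>k. ennreal (c * (d k * dkernel \<rho> k J))) = ennreal (c * E J)" if "c \<ge> 0" for c J
      unfolding E_def using that d0 k0 by (subst suminf_mult[OF Yg(1), symmetric]) (intro suminf_ennreal2 summable_mult Yg(1) mult_nonneg_nonneg, auto)
    have hb: "cmod (h z) \<le> \<beta> * 2 powr B * 2 powr (e * J) * E J" if z: "z \<in> ball 0 1" "z \<in> shell J" for z J
    proof -
      have cz: "cmod z < 1" using z by simp
      define g where "g = (\<lambda>t. of_real t * radial f t * (1 - of_real t * z) powr (- of_real (\<beta> + 1)))"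
      have hz: "h z = of_real \<beta> * (\<integral>t. g t \<partial>\<mu>)" unfolding h_def g_def by (rule H(6)[OF z(1)])
      have "ennreal (cmod (\<integral>t. g t \<partial>\<mu>)) \<le> (\<integral>\<^sup>+t. ennreal (cmod (g t)) \<partial>\<mu>)"
        by (rule norm_integral_le_nn_integral)
      also have "\<dots> \<le> (\<integral>\<^sup>+t. ennreal (cmod (radial f t) * cmod (1 - of_real t * z) powr (- B)) \<partial>\<mu>)"
      proof (intro nn_integral_mono ennreal_leI)
        fix t
        show "cmod (g t) \<le> cmod (radial f t) * cmod (1 - of_real t * z) powr (- B)"
        proof (cases "t \<in> {0..<1}")
          case True
          then have "cmod (g t) = t * (cmod (radial f t) * cmod (1 - of_real t * z) powr (- B))"
            using norm_kernel[of t z "\<beta> + 1"] cz by (simp add: g_def norm_mult B_def)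
          also have "\<dots> \<le> 1 * (cmod (radial f t) * cmod (1 - of_real t * z) powr (- B))"
            using True by (intro mult_right_mono) auto
          finally show ?thesis by simp
        qed (simp add: g_def radial_def)
      qed
      also have "\<dots> \<le> (\<Sum>k. ennreal (dmax f k * (2 powr B * 2 powr (B * real (min k J))) * mass k))"
        by (rule nn_integral_dyadic_le[OF f]) (use kernel_dyadic_bound[OF _ z, of _ _ B] ee in auto)
      also have "\<dots> \<le> (\<Sum>k. ennreal ((2 powr B * 2 powr (e * J)) * (d k * dkernel \<rho> k J)))"
      proof (intro suminf_le ennreal_leI)
        fix k
        have "dmax f k * (2 powr B * 2 powr (B * real (min k J))) * mass k
          = (dmax f k * mass k * 2 powr B) * 2 powr ((e + e') * real (min k J))" by (simp add: ee)
        also have "\<dots> \<le> (dmax f k * mass k * 2 powr B) * (2 powr (e * real J) * ((2 powr e') ^ k * dkernel \<rho> k J))"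
          unfolding \<rho>_def using ee
          by (intro mult_left_mono dyadic_exponent_bound mult_nonneg_nonneg dmax_nonneg f) (auto simp: mass_def)
        also have "\<dots> = (2 powr B * 2 powr (e * J)) * (d k * dkernel \<rho> k J)" by (simp add: d_def mult_ac)
        finally show "dmax f k * (2 powr B * 2 powr (B * real (min k J))) * mass k \<le> (2 powr B * 2 powr (e * J)) * (d k * dkernel \<rho> k J)" .
      qed auto
      also have "\<dots> = ennreal ((2 powr B * 2 powr (e * J)) * E J)" by (rule sumE) simp
      finally have "cmod (\<integral>t. g t \<partial>\<mu>) \<le> 2 powr B * 2 powr (e * J) * E J"
        using E0 by (subst (asm) ennreal_le_iff) auto
      then have "\<beta> * cmod (\<integral>t. g t \<partial>\<mu>) \<le> \<beta> * (2 powr B * 2 powr (e * J) * E J)"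
        using \<beta> by (intro mult_left_mono) auto
      then show ?thesis using \<beta> by (simp add: hz norm_mult mult_ac)
    qed
    define F where "F = (\<lambda>z. indicator (ball 0 1) z * ennreal (cmod (h z) powr q * (1 - (cmod z)\<^sup>2) powr (\<beta> - 1)))"
    have b1: "\<beta> - 1 > -1" "q > 0" using \<beta> q by auto
    have mF[measurable]: "F \<in> borel_measurable borel" unfolding F_def by (rule weighted_integral_eq_A_int(2)[OF b1 h])
    have FJ: "(\<integral>\<^sup>+z. indicator (shell J) z * F z \<partial>lborel) \<le> ennreal (K * E J powr q)" for J
    proof -
      define M where "M = (\<beta> * 2 powr B * 2 powr (e * J) * E J) powr q * (4 * (1/2) ^ J) powr (\<beta> - 1)"
      have "(\<integral>\<^sup>+z. indicator (shell J) z * F z \<partial>lborel) \<le> (\<integral>\<^sup>+z. ennreal M * indicator (cball (1::complex) (2 * (1/2) ^ J)) z \<partial>lborel)"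
      proof (rule nn_integral_mono)
        fix z
        show "indicator (shell J) z * F z \<le> ennreal M * indicator (cball 1 (2 * (1/2) ^ J)) z"
        proof (cases "z \<in> shell J \<and> z \<in> ball 0 1")
          case True
          then have z: "z \<in> ball 0 1" "z \<in> shell J" by auto
          then have s: "cmod (1 - z) < 2 * (1/2) ^ J" "cmod z < 1" by (auto simp: shell_def)
          then have zc: "z \<in> cball 1 (2 * (1/2) ^ J)" by (simp add: dist_norm)
          have "1 - (cmod z)\<^sup>2 = (1 - cmod z) * (1 + cmod z)" by (simp add: power2_eq_square algebra_simps)
          also have "\<dots> \<le> cmod (1 - z) * 2"
            using s(2) norm_triangle_ineq2[of 1 z] by (intro mult_mono) auto
          also have "\<dots> \<le> 4 * (1/2) ^ J" using s by simp
          finally have "1 - (cmod z)\<^sup>2 \<le> 4 * (1/2) ^ J" .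
          moreover have "0 \<le> 1 - (cmod z)\<^sup>2" using s(2) by (simp add: abs_square_le_1)
          \<comment> \<open>The weight exponent \<beta> - 1 is positive, so an upper bound for 1 -
            |z|^2 bounds the weight.\<close>
          ultimately have "(1 - (cmod z)\<^sup>2) powr (\<beta> - 1) \<le> (4 * (1/2) ^ J) powr (\<beta> - 1)"
            using \<beta> by (intro powr_mono2) auto
          moreover have "cmod (h z) powr q \<le> (\<beta> * 2 powr B * 2 powr (e * J) * E J) powr q"
            using hb[OF z] q by (intro powr_mono2) auto
          ultimately have "cmod (h z) powr q * (1 - (cmod z)\<^sup>2) powr (\<beta> - 1) \<le> M"
            unfolding M_def by (intro mult_mono) auto
          then show ?thesis using z zc by (simp add: F_def ennreal_leI)
        next
          case False
          then show ?thesis by (auto simp: F_def)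
        qed
      qed
      also have "\<dots> = ennreal M * ennreal (pi * (2 * (1/2) ^ J)\<^sup>2)"
        by (simp add: nn_integral_cmult_indicator emeasure_cball unit_ball_vol_2)
      also have "\<dots> = ennreal (M * (pi * (2 * (1/2) ^ J)\<^sup>2))" by (simp add: M_def ennreal_mult)
      also have "M * (pi * (2 * (1/2) ^ J)\<^sup>2) = K * E J powr q"
      proof -
        have "(2 powr (e * J)) powr q = 2 powr (B * J)" unfolding powr_powr ee(4)[symmetric] by (simp add: mult_ac)
        moreover have "((1/2::real) ^ J) powr (\<beta> - 1) = 2 powr (- (\<beta> - 1) * J)"
          unfolding half_power powr_powr by (simp add: algebra_simps)
        moreover have "((1/2::real) ^ J)\<^sup>2 = 2 powr (- 2 * J)"
          using half_power[of "J * 2"] by (simp add: power_mult mult.commute)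
        \<comment> \<open>The exponents B, -(\<beta> - 1) and -2 add up to 0, so the shell index
          drops out.\<close>
        moreover have "2 powr (B * J) * (2 powr (- (\<beta> - 1) * J) * 2 powr (- 2 * J)) = (1::real)"
          unfolding powr_add[symmetric] by (simp add: B_def algebra_simps)
        ultimately have 1: "(2 powr (e * J)) powr q * (((1/2) ^ J) powr (\<beta> - 1) * ((1/2) ^ J)\<^sup>2) = (1::real)" by simp
        have "M * (pi * (2 * (1/2) ^ J)\<^sup>2) = K * E J powr q * ((2 powr (e * J)) powr q * (((1/2) ^ J) powr (\<beta> - 1) * ((1/2) ^ J)\<^sup>2))"
          unfolding M_def K_def power_mult_distrib powr_mult by (simp add: mult_ac)
        then show ?thesis unfolding 1 by simp
      qed
      finally show ?thesis .
    qed
    have "(\<integral>\<^sup>+z. F z \<partial>lborel) \<le> (\<Sum>J. \<integral>\<^sup>+z. indicator (shell J) z * F z \<partial>lborel)"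
      by (rule le_sum_shell[OF mF]) (simp add: F_def)
    also have "\<dots> \<le> (\<Sum>J. ennreal (K * E J powr q))" by (intro suminf_le FJ) auto
    also have "\<dots> = ennreal (K * (\<Sum>J. E J powr q))"
      using K by (subst suminf_mult[OF Yg(2), symmetric]) (intro suminf_ennreal2 summable_mult Yg(2), auto)
    also have "\<dots> \<le> ennreal (K * (Y * (\<Sum>k. d k powr q)))"
      using K by (intro ennreal_leI mult_left_mono Yg(3)) auto
    finally have FI: "(\<integral>\<^sup>+z. F z \<partial>lborel) \<le> ennreal (K * (Y * (\<Sum>k. d k powr q)))" .
    have sdn: "(\<Sum>k. d k powr q) \<ge> 0" by (intro suminf_nonneg sd) auto
    have "A_int q (\<beta> - 1) h = ennreal (\<beta> / pi) * (\<integral>\<^sup>+z. F z \<partial>lborel)"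
      using A_int_eq[OF b1 h] by (simp add: F_def)
    also have "\<dots> \<le> ennreal (\<beta> / pi) * ennreal (K * (Y * (\<Sum>k. d k powr q)))" by (intro mult_left_mono FI) auto
    also have "\<dots> = ennreal (\<beta> / pi * K * Y * (\<Sum>k. d k powr q))"
      using \<beta> K Y sdn by (subst ennreal_mult[symmetric]) (auto simp: mult_ac)
    also have "\<dots> \<le> ennreal (C * (\<Sum>k. d k powr q))"
      unfolding C_def by (intro ennreal_leI mult_right_mono sdn) auto
    finally have 1: "A_int q (\<beta> - 1) h \<le> ennreal (C * (\<Sum>k. d k powr q))" .
    \<comment> \<open>At z = 0 the kernel is 1, and a comparison with J = 0 bounds the value at 0 by
      one entry of the same convolution.\<close>
    have "ennreal (cmod (Hilbert_op \<mu> \<beta> f 0)) = ennreal (cmod (\<integral>t. radial f t \<partial>\<mu>))"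
      using H(4)[of 0] by simp
    also have "\<dots> \<le> (\<integral>\<^sup>+t. ennreal (cmod (radial f t)) \<partial>\<mu>)" by (rule norm_integral_le_nn_integral)
    also have "\<dots> \<le> (\<Sum>k. ennreal (dmax f k * 1 * mass k))"
      using nn_integral_dyadic_le[OF f, of "\<lambda>_. 1" "\<lambda>_. 1"] by simp
    also have "\<dots> \<le> (\<Sum>k. ennreal (1 * (d k * dkernel \<rho> k 0)))"
    proof (intro suminf_le ennreal_leI)
      fix k
      have "1 = 2 powr ((e + e') * real (min k 0))" by simp
      also have "\<dots> \<le> 2 powr (e * real 0) * ((2 powr e') ^ k * dkernel \<rho> k 0)"
        unfolding \<rho>_def by (rule dyadic_exponent_bound) (use ee in auto)
      finally have "1 \<le> (2 powr e') ^ k * dkernel \<rho> k 0" by simp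
      then have "(dmax f k * mass k) * 1 \<le> (dmax f k * mass k) * ((2 powr e') ^ k * dkernel \<rho> k 0)"
        by (intro mult_left_mono mult_nonneg_nonneg dmax_nonneg f) (auto simp: mass_def)
      then show "dmax f k * 1 * mass k \<le> 1 * (d k * dkernel \<rho> k 0)" by (simp add: d_def mult_ac)
    qed auto
    also have "\<dots> = ennreal (1 * E 0)" by (rule sumE) simp
    finally have "cmod (Hilbert_op \<mu> \<beta> f 0) \<le> E 0" using E0[of 0] by simp
    then have "cmod (Hilbert_op \<mu> \<beta> f 0) powr q \<le> E 0 powr q" using q by (intro powr_mono2) auto
    also have "\<dots> \<le> (\<Sum>J. E J powr q)" using sum_le_suminf[OF Yg(2), of "{0}"] by simp
    also have "\<dots> \<le> Y * (\<Sum>k. d k powr q)" by (rule Yg(3))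
    also have "\<dots> \<le> C * (\<Sum>k. d k powr q)" unfolding C_def by (intro mult_right_mono sdn) auto
    finally have 2: "cmod (Hilbert_op \<mu> \<beta> f 0) powr q \<le> C * (\<Sum>k. d k powr q)" .
    show "A_int q (\<beta> - 1) (deriv (Hilbert_op \<mu> \<beta> f)) \<le> ennreal (C * (\<Sum>k. (dmax f k * mass k * (2 powr ((\<beta> + 1) * (1 - 1 / q))) ^ k) powr q)) \<and>
      cmod (Hilbert_op \<mu> \<beta> f 0) powr q \<le> C * (\<Sum>k. (dmax f k * mass k * (2 powr ((\<beta> + 1) * (1 - 1 / q))) ^ k) powr q)"
      using 1 2 by (simp add: d_def h_def e'_def B_def)
  qed
qed

end

subsection \<open>Decay of moments\<close>

text \<open>The inequality y \<le> exp y at y = x / a.\<close>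

lemma powr_le_exp:
  fixes x a :: real
  assumes "x \<ge> 0" "a > 0"
  shows "x powr a \<le> a powr a * exp x"
proof -
  have "x / a \<le> exp (x / a)" using exp_ge_add_one_self[of "x / a"] by linarith
  then have "(x / a) powr a \<le> exp (x / a) powr a" using assms by (intro powr_mono2) auto
  also have "exp (x / a) powr a = exp x" using assms by (simp add: powr_def)
  finally show ?thesis using assms by (simp add: powr_divide field_simps)
qed

lemma taylor_coeff_deriv: "taylor_coeff (deriv f) k = of_nat (Suc k) * taylor_coeff f (Suc k)"
proof -
  have "(deriv ^^ k) (deriv f) = (deriv ^^ Suc k) f" by (simp add: funpow_swap1)
  moreover have "of_nat (fact (Suc k)) = (of_nat (Suc k) :: complex) * of_nat (fact k)"
    by (simp only: fact_Suc of_nat_mult of_nat_id)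
  moreover have "(of_nat (Suc k) :: complex) \<noteq> 0" by (simp only: of_nat_eq_0_iff)
  ultimately show ?thesis unfolding taylor_coeff_def by (simp del: funpow.simps of_nat_Suc of_nat_fact)
qed

lemma A_int_cong:
  assumes "\<And>z. z \<in> ball 0 1 \<Longrightarrow> f z = g z"
  shows "A_int p \<alpha> f = A_int p \<alpha> g"
  unfolding A_int_def
proof (rule arg_cong2[where f="(*)", OF refl], rule nn_integral_cong)
  fix z :: complex
  show "indicator (ball 0 1) z * ennreal (cmod (f z) powr p * (1 - (cmod z)\<^sup>2) powr \<alpha> / pi)
      = indicator (ball 0 1) z * ennreal (cmod (g z) powr p * (1 - (cmod z)\<^sup>2) powr \<alpha> / pi)"
    using assms[of z] by (cases "z \<in> ball 0 1") simp_all
qed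

text \<open>A pointwise quasi-triangle inequality through the maximum. It treats all p > 0 alike;
  for p < 1 the root of \<open>A_int\<close> need not be subadditive.\<close>

lemma A_int_diff_le:
  assumes "\<alpha> > -1" "p > 0" "f holomorphic_on ball 0 1" "g holomorphic_on ball 0 1"
  shows "A_int p \<alpha> (\<lambda>z. f z - g z) \<le> ennreal (2 powr p) * (A_int p \<alpha> f + A_int p \<alpha> g)"
proof -
  define F where "F = (\<lambda>f z. indicator (ball (0::complex) 1) z * ennreal (cmod (f z :: complex) powr p * (1 - (cmod z)\<^sup>2) powr \<alpha>))"
  have AF: "A_int p \<alpha> f = ennreal ((\<alpha> + 1) / pi) * (\<integral>\<^sup>+z. F f z \<partial>lborel)" "F f \<in> borel_measurable borel"
    if "f holomorphic_on ball 0 1" for f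
    unfolding F_def by (rule A_int_eq[OF assms(1,2) that], rule weighted_integral_eq_A_int(2)[OF assms(1,2) that])
  note [measurable] = AF(2)[OF assms(3)] AF(2)[OF assms(4)]
  have d: "(\<lambda>z. f z - g z) holomorphic_on ball 0 1" by (intro holomorphic_intros assms)
  have pt: "F (\<lambda>z. f z - g z) z \<le> ennreal (2 powr p) * (F f z + F g z)" for z
  proof (cases "z \<in> ball 0 1")
    case True
    have "cmod (f z - g z) \<le> 2 * max (cmod (f z)) (cmod (g z))" using norm_triangle_ineq4[of "f z" "g z"] by auto
    then have "cmod (f z - g z) powr p \<le> (2 * max (cmod (f z)) (cmod (g z))) powr p" using assms by (intro powr_mono2) auto
    also have "\<dots> = 2 powr p * (max (cmod (f z)) (cmod (g z))) powr p" by (rule powr_mult)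
    also have "\<dots> \<le> 2 powr p * (cmod (f z) powr p + cmod (g z) powr p)" by (intro mult_left_mono) (auto simp: max_def)
    finally have "cmod (f z - g z) powr p * (1 - (cmod z)\<^sup>2) powr \<alpha> \<le> 2 powr p * (cmod (f z) powr p + cmod (g z) powr p) * (1 - (cmod z)\<^sup>2) powr \<alpha>"
      by (intro mult_right_mono) auto
    also have "\<dots> = 2 powr p * (cmod (f z) powr p * (1 - (cmod z)\<^sup>2) powr \<alpha> + cmod (g z) powr p * (1 - (cmod z)\<^sup>2) powr \<alpha>)" by (simp add: algebra_simps)
    finally have "ennreal (cmod (f z - g z) powr p * (1 - (cmod z)\<^sup>2) powr \<alpha>)
      \<le> ennreal (2 powr p * (cmod (f z) powr p * (1 - (cmod z)\<^sup>2) powr \<alpha> + cmod (g z) powr p * (1 - (cmod z)\<^sup>2) powr \<alpha>))" by (rule ennreal_leI)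
    then show ?thesis using True by (simp add: F_def ennreal_mult ennreal_plus)
  qed (simp add: F_def)
  have "A_int p \<alpha> (\<lambda>z. f z - g z) \<le> ennreal ((\<alpha> + 1) / pi) * (\<integral>\<^sup>+z. ennreal (2 powr p) * (F f z + F g z) \<partial>lborel)"
    unfolding AF(1)[OF d] by (intro mult_left_mono nn_integral_mono pt) auto
  also have "\<dots> = ennreal (2 powr p) * (ennreal ((\<alpha> + 1) / pi) * ((\<integral>\<^sup>+z. F f z \<partial>lborel) + (\<integral>\<^sup>+z. F g z \<partial>lborel)))"
    by (simp add: nn_integral_cmult nn_integral_add mult.left_commute)
  finally show ?thesis by (simp only: AF(1)[OF assms(3)] AF(1)[OF assms(4)] distrib_left)
qed

section \<open>Singular integrals and moments under a decay bound for the masses\<close>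

context unit_interval_measure
begin

text \<open>The dyadic estimate with f = 1 leaves a geometric series of ratio
  \<open>2 powr (a - s)\<close>. With a = \<gamma> it supplies the majorant of the necessity part,
  with other a the decay of moments.\<close>

lemma nn_integral_singular_finite:
  assumes m: "\<And>k. mass k \<le> K * (2 powr (- s)) ^ k" and a: "0 \<le> a" "a < s"
  obtains A where "A \<ge> 0" "(\<integral>\<^sup>+t. ennreal (indicator {0..<1} t * (1 - t) powr (- a)) \<partial>\<mu>) \<le> ennreal A"
proof -
  have K: "K \<ge> 0" using order_trans[OF measure_nonneg m[of 0, unfolded mass_def]] by simp
  have one: "(\<lambda>_. 1 :: complex) holomorphic_on ball 0 1" by simp
  have dm: "dmax (\<lambda>_. 1) k = 1" for k using dmax_attained[OF one, of k] by auto
  define \<rho> where "\<rho> = (2::real) powr (a - s)"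
  have \<rho>: "0 < \<rho>" "\<rho> < 1" using a by (auto simp: \<rho>_def powr_less_one)
  have sg: "summable (\<lambda>k. (2 powr a * K) * \<rho> ^ k)" using \<rho> by (intro summable_mult summable_geometric) auto
  have "(\<integral>\<^sup>+t. ennreal (indicator {0..<1} t * (1 - t) powr (- a)) \<partial>\<mu>)
    = (\<integral>\<^sup>+t. ennreal (cmod (radial (\<lambda>_. 1) t) * (1 - t) powr (- a)) \<partial>\<mu>)"
    by (intro nn_integral_cong) (auto simp: radial_def indicator_def)
  also have "\<dots> \<le> (\<Sum>k. ennreal (dmax (\<lambda>_. 1) k * (2 powr a * (2 powr a) ^ k) * mass k))"
  proof (rule nn_integral_dyadic_le[OF one])
    fix k t assume t: "t \<in> {dpt k..dpt (Suc k)}"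
    then have "(1/2) ^ Suc k \<le> 1 - t" by (simp add: dpt_def)
    then have "(1 - t) powr (- a) \<le> ((1/2) ^ Suc k) powr (- a)" using a by (intro powr_mono2') auto
    also have "\<dots> = 2 powr (a * real (Suc k))" unfolding half_power powr_powr by (simp add: algebra_simps)
    also have "\<dots> = 2 powr a * (2 powr a) ^ k" unfolding powr_real_mult by simp
    finally show "(1 - t) powr (- a) \<le> 2 powr a * (2 powr a) ^ k" .
  qed simp
  also have "\<dots> \<le> (\<Sum>k. ennreal ((2 powr a * K) * \<rho> ^ k))"
  proof (intro suminf_le ennreal_leI)
    fix k
    have "dmax (\<lambda>_. 1) k * (2 powr a * (2 powr a) ^ k) * mass k \<le> (2 powr a * (2 powr a) ^ k) * (K * (2 powr (- s)) ^ k)"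
      unfolding dm using m[of k] by (simp add: mult_left_mono)
    also have "\<dots> = (2 powr a * K) * (2 powr a * 2 powr (- s)) ^ k" by (simp add: power_mult_distrib mult_ac)
    also have "2 powr a * 2 powr (- s) = \<rho>" by (simp add: \<rho>_def powr_add[symmetric])
    finally show "dmax (\<lambda>_. 1) k * (2 powr a * (2 powr a) ^ k) * mass k \<le> (2 powr a * K) * \<rho> ^ k" .
  qed auto
  also have "\<dots> = ennreal (\<Sum>k. (2 powr a * K) * \<rho> ^ k)" using K \<rho> by (intro suminf_ennreal2 sg) auto
  finally have fin: "(\<integral>\<^sup>+t. ennreal (indicator {0..<1} t * (1 - t) powr (- a)) \<partial>\<mu>) \<le> ennreal (\<Sum>k. (2 powr a * K) * \<rho> ^ k)" .
  have "0 \<le> (\<Sum>k. (2 powr a * K) * \<rho> ^ k)" using K \<rho> by (intro suminf_nonneg sg) auto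
  then show ?thesis using fin by (rule that)
qed

text \<open>t ^ k is at most exp (-k (1 - t)), hence at most a constant times the power -a of (k +
  2)(1 - t), and this power is integrable because a < s.\<close>

lemma moment_decay:
  assumes m: "\<And>k. mass k \<le> K * (2 powr (- s)) ^ k" and a: "0 < a" "a < s"
  obtains A where "A \<ge> 0" "\<And>k. moment k \<le> A * real (k + 2) powr (- a)"
proof -
  obtain A where A: "A \<ge> 0" "(\<integral>\<^sup>+t. ennreal (indicator {0..<1} t * (1 - t) powr (- a)) \<partial>\<mu>) \<le> ennreal A"
    using nn_integral_singular_finite[OF m less_imp_le[OF a(1)] a(2)] by blast
  \<comment> \<open>\<open>a powr a\<close> comes from \<open>powr_le_exp\<close>, and exp 2 from
    the shift of k to k + 2.\<close>
  define c where "c = a powr a * exp 2"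
  have "moment k \<le> (c * A) * real (k + 2) powr (- a)" for k
  proof -
    have pt: "t ^ k \<le> (c * real (k + 2) powr (- a)) * (1 - t) powr (- a)" if t: "0 \<le> t" "t < 1" for t
    proof -
      define x where "x = real (k + 2) * (1 - t)"
      have x0: "x > 0" using t by (simp add: x_def)
      have "t \<le> exp (- (1 - t))" using exp_ge_add_one_self[of "- (1 - t)"] by simp
      then have "t ^ k \<le> exp (- (1 - t)) ^ k" using t by (intro power_mono) auto
      also have "\<dots> = exp (- (real k * (1 - t)))" unfolding exp_of_nat_mult[symmetric] by (simp add: algebra_simps)
      also have "\<dots> \<le> exp (2 - x)" using t by (simp add: x_def algebra_simps)
      finally have 1: "t ^ k \<le> exp (2 - x)" .
      have "t ^ k * x powr a \<le> exp (2 - x) * (a powr a * exp x)"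
        using 1 powr_le_exp[of x a] x0 a t by (intro mult_mono) auto
      also have "\<dots> = c" by (simp add: c_def exp_diff)
      finally have "t ^ k \<le> c * x powr (- a)" using x0 by (simp add: powr_minus field_simps)
      also have "x powr (- a) = real (k + 2) powr (- a) * (1 - t) powr (- a)" unfolding x_def by (rule powr_mult)
      finally show ?thesis by (simp add: mult.assoc)
    qed
    have "ennreal (moment k) = (\<integral>\<^sup>+t. ennreal (t ^ k) \<partial>\<mu>)"
      unfolding moment_def
      by (rule nn_integral_eq_integral[symmetric, OF integrable_moment]) (use AE_unit in eventually_elim, simp)
    also have "\<dots> \<le> (\<integral>\<^sup>+t. ennreal (c * real (k + 2) powr (- a)) * ennreal (indicator {0..<1} t * (1 - t) powr (- a)) \<partial>\<mu>)"
    proof (rule nn_integral_mono_AE)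
      show "AE t in \<mu>. ennreal (t ^ k) \<le> ennreal (c * real (k + 2) powr (- a)) * ennreal (indicator {0..<1} t * (1 - t) powr (- a))"
        using AE_unit
      proof eventually_elim
        case (elim t)
        then show ?case using pt[of t] by (simp add: c_def ennreal_leI flip: ennreal_mult)
      qed
    qed
    also have "\<dots> = ennreal (c * real (k + 2) powr (- a)) * (\<integral>\<^sup>+t. ennreal (indicator {0..<1} t * (1 - t) powr (- a)) \<partial>\<mu>)"
      by (rule nn_integral_cmult) measurable
    also have "\<dots> \<le> ennreal (c * real (k + 2) powr (- a)) * ennreal A" by (intro mult_left_mono A) auto
    also have "\<dots> = ennreal ((c * A) * real (k + 2) powr (- a))"
      using A by (subst ennreal_mult[symmetric]) (auto simp: c_def mult_ac)
    finally show ?thesis using A by (subst (asm) ennreal_le_iff) (auto simp: c_def)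
  qed
  then show ?thesis using that[of "c * A"] A by (simp add: c_def)
qed

text \<open>The coefficients of f are one order smaller than those of its derivative, so the terms
  have order \<kappa> - 1 - a with a between \<kappa> and s, which is below -1. This is the premise
  of \<open>Hilbert_op_integral\<close>.\<close>

lemma summable_taylor_moment:
  assumes m: "\<And>k. mass k \<le> K * (2 powr (- s)) ^ k" and s: "coeff_exponent p \<alpha> < s" "0 < s"
    and p: "p > 0" and \<alpha>: "\<alpha> > -1" and f: "in_Dirichlet p \<alpha> f"
  shows "summable (\<lambda>k. cmod (taylor_coeff f k) * moment k)"
proof -
  define \<kappa> where "\<kappa> = coeff_exponent p \<alpha>"
  obtain a where a: "max 0 \<kappa> < a" "a < s" using dense[of "max 0 \<kappa>" s] s by (auto simp: \<kappa>_def)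
  obtain A where A: "A \<ge> 0" "\<And>k. moment k \<le> A * real (k + 2) powr (- a)"
    using moment_decay[OF m, of a] a by auto
  have f': "f holomorphic_on ball 0 1" "A_int p \<alpha> (deriv f) < \<infinity>" using f by (auto simp: in_Dirichlet_def)
  have df: "deriv f holomorphic_on ball 0 1" by (intro holomorphic_deriv f') auto
  obtain C where C: "C > 0" "\<And>k. cmod (taylor_coeff (deriv f) k) \<le> C * real (k + 2) powr \<kappa>"
    using taylor_coeff_bound_of_A_int[OF p \<alpha> df f'(2)] unfolding \<kappa>_def by blast
  have sum: "summable (\<lambda>k. (2 * C * A) * real (k + 2) powr (\<kappa> - 1 - a))"
  proof (rule summable_mult)
    have "summable (\<lambda>k. real k powr (\<kappa> - 1 - a))" using a by (subst summable_real_powr_iff) auto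
    then show "summable (\<lambda>k. real (k + 2) powr (\<kappa> - 1 - a))" by (subst summable_iff_shift)
  qed
  have "summable (\<lambda>k. cmod (taylor_coeff f (k + 1)) * moment (k + 1))"
  proof (rule summable_comparison_test[OF _ sum], intro exI allI impI)
    fix k
    have "real (Suc k) * cmod (taylor_coeff f (k + 1)) \<le> C * real (k + 2) powr \<kappa>"
      using C(2)[of k] by (simp add: taylor_coeff_deriv norm_mult del: of_nat_Suc)
    moreover have "real (k + 2) * cmod (taylor_coeff f (k + 1)) \<le> 2 * (real (Suc k) * cmod (taylor_coeff f (k + 1)))"
      unfolding mult.assoc[symmetric] by (intro mult_right_mono) auto
    ultimately have "real (k + 2) * cmod (taylor_coeff f (k + 1)) \<le> 2 * (C * real (k + 2) powr \<kappa>)" by linarith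
    then have "cmod (taylor_coeff f (k + 1)) \<le> 2 * C * (real (k + 2) powr \<kappa> / real (k + 2))"
      by (simp add: field_simps)
    also have "real (k + 2) powr \<kappa> / real (k + 2) = real (k + 2) powr (\<kappa> - 1)" by (simp add: powr_diff)
    finally have 1: "cmod (taylor_coeff f (k + 1)) \<le> 2 * C * real (k + 2) powr (\<kappa> - 1)" .
    have 2: "moment (k + 1) \<le> A * real (k + 2) powr (- a)"
      using moment_antimono[of 1 k] A(2)[of k] by (simp add: add.commute)
    have "cmod (taylor_coeff f (k + 1)) * moment (k + 1) \<le> (2 * C * real (k + 2) powr (\<kappa> - 1)) * (A * real (k + 2) powr (- a))"
      using C A by (intro mult_mono 1 2 moment_nonneg) auto
    also have "\<dots> = (2 * C * A) * (real (k + 2) powr (\<kappa> - 1) * real (k + 2) powr (- a))" by (simp add: mult_ac)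
    also have "real (k + 2) powr (\<kappa> - 1) * real (k + 2) powr (- a) = real (k + 2) powr (\<kappa> - 1 - a)" 
      by (simp only: powr_add[symmetric] diff_conv_add_uminus)
    finally show "norm (cmod (taylor_coeff f (k + 1)) * moment (k + 1)) \<le> (2 * C * A) * real (k + 2) powr (\<kappa> - 1 - a)"
      using moment_nonneg by simp
  qed
  then show ?thesis by (subst (asm) summable_iff_shift)
qed

end

subsection \<open>Sufficiency\<close>

text \<open>Membership is a separate premise because \<open>enn2real\<close> sends infinity to 0, so
  a small norm by itself says nothing.\<close>

lemma A_int_le_of_Dirichlet_norm:
  assumes "in_Dirichlet p \<alpha> f" "Dirichlet_norm p \<alpha> f \<le> M" "p > 0"
  shows "A_int p \<alpha> (deriv f) \<le> ennreal (M powr p)" "cmod (f 0) \<le> M" "M \<ge> 0"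
proof -
  obtain a where a: "A_int p \<alpha> (deriv f) = ennreal a" "a \<ge> 0"
    using assms(1) by (cases "A_int p \<alpha> (deriv f)") (auto simp: in_Dirichlet_def)
  have le: "cmod (f 0) + a powr (1 / p) \<le> M" using assms(2) a by (simp add: Dirichlet_norm_def)
  have pos: "0 \<le> a powr (1 / p)" by simp
  show "cmod (f 0) \<le> M" using le pos by linarith
  then show "M \<ge> 0" using norm_ge_zero order_trans by blast
  have "a powr (1 / p) \<le> M" using le norm_ge_zero[of "f 0"] by linarith
  then have "(a powr (1 / p)) powr p \<le> M powr p" using assms(3) by (intro powr_mono2) auto
  then show "A_int p \<alpha> (deriv f) \<le> ennreal (M powr p)" using a assms(3) by (simp add: powr_powr ennreal_leI)
qed

lemma A_int_Fatou:
  assumes p: "p > 0" and \<alpha>: "\<alpha> > -1" and h: "\<And>n. h n holomorphic_on ball 0 1" "\<And>n. A_int p \<alpha> (h n) \<le> ennreal A"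
    and g: "g holomorphic_on ball 0 1" and lim: "\<And>z. z \<in> ball 0 1 \<Longrightarrow> (\<lambda>n. h n z) \<longlonglongrightarrow> g z"
  shows "A_int p \<alpha> g \<le> ennreal A"
proof -
  define F where "F = (\<lambda>f z. indicator (ball (0::complex) 1) z * ennreal (cmod (f z :: complex) powr p * (1 - (cmod z)\<^sup>2) powr \<alpha>))"
  have AF: "A_int p \<alpha> f = ennreal ((\<alpha> + 1) / pi) * (\<integral>\<^sup>+z. F f z \<partial>lborel)" "F f \<in> borel_measurable borel"
    if "f holomorphic_on ball 0 1" for f
    unfolding F_def by (rule A_int_eq[OF \<alpha> p that], rule weighted_integral_eq_A_int(2)[OF \<alpha> p that])
  have b: "(\<integral>\<^sup>+z. F (h n) z \<partial>lborel) \<le> ennreal (pi / (\<alpha> + 1)) * ennreal A" for n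
    unfolding F_def weighted_integral_eq_A_int(1)[OF \<alpha> p h(1)] by (intro mult_left_mono h) auto
  have "(\<integral>\<^sup>+z. F g z \<partial>lborel) = (\<integral>\<^sup>+z. liminf (\<lambda>n. F (h n) z) \<partial>lborel)"
  proof (rule nn_integral_cong)
    fix z
    have "(\<lambda>n. F (h n) z) \<longlonglongrightarrow> F g z"
    proof (cases "z \<in> ball 0 1")
      case True
      have "(\<lambda>n. cmod (h n z) powr p * (1 - (cmod z)\<^sup>2) powr \<alpha>) \<longlonglongrightarrow> cmod (g z) powr p * (1 - (cmod z)\<^sup>2) powr \<alpha>"
        using p by (intro tendsto_intros tendsto_powr2 lim[OF True]) auto
      then show ?thesis using True by (simp add: F_def tendsto_ennrealI)
    qed (simp add: F_def)
    then show "F g z = liminf (\<lambda>n. F (h n) z)" by (simp add: lim_imp_Liminf)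
  qed
  also have "\<dots> \<le> liminf (\<lambda>n. \<integral>\<^sup>+z. F (h n) z \<partial>lborel)"
    by (rule nn_integral_liminf) (use AF(2)[OF h(1)] in simp)
  also have "\<dots> \<le> ennreal (pi / (\<alpha> + 1)) * ennreal A"
    using b by (intro Liminf_le) auto
  finally have "A_int p \<alpha> g \<le> ennreal ((\<alpha> + 1) / pi) * (ennreal (pi / (\<alpha> + 1)) * ennreal A)"
    unfolding AF(1)[OF g] by (intro mult_left_mono) auto
  also have "\<dots> = ennreal A" using \<alpha> by (simp add: mult.assoc[symmetric] ennreal_mult[symmetric])
  finally show ?thesis .
qed

text \<open>The growth estimate for the derivatives, integrated from 0, gives the local bounds for
  Montel's theorem. Locally uniform convergence passes to derivatives pointwise, and Fatou's lemma
  then keeps the limit in the space.\<close>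

lemma Dirichlet_normal_family:
  assumes p: "p > 0" and \<alpha>: "\<alpha> > -1" and F: "\<And>n. F n holomorphic_on ball 0 1"
    and A: "\<And>n. A_int p \<alpha> (deriv (F n)) \<le> ennreal A" and M: "\<And>n. cmod (F n 0) \<le> M"
  obtains g r where "strict_mono (r :: nat \<Rightarrow> nat)" "g holomorphic_on ball 0 1" "A_int p \<alpha> (deriv g) \<le> ennreal A"
    "cmod (g 0) \<le> M" "\<And>K. compact K \<Longrightarrow> K \<subseteq> ball 0 1 \<Longrightarrow> uniform_limit K (\<lambda>n. F (r n)) g sequentially"
proof -
  obtain C where C: "C > 0" "\<And>h z. h holomorphic_on ball 0 1 \<Longrightarrow> z \<in> ball 0 1 \<Longrightarrow>
      ennreal (cmod (h z) powr p * (1 - cmod z) powr (\<alpha> + 2)) \<le> ennreal C * A_int p \<alpha> h"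
    by (rule growth_estimate[OF p \<alpha>]) (rule that)
  have dF: "deriv (F n) holomorphic_on ball 0 1" for n by (intro holomorphic_deriv F) auto
  \<comment> \<open>\<open>ennreal\<close> reads a negative A as 0; A' is the real number it stands
    for.\<close>
  define A' where "A' = max A 0"
  have A': "A_int p \<alpha> (deriv (F n)) \<le> ennreal A'" for n by (rule order_trans[OF A ennreal_leI]) (simp add: A'_def)
  have dbound: "cmod (deriv (F n) w) \<le> (C * A' * (1 - R) powr (- (\<alpha> + 2))) powr (1 / p)"
    if R: "cmod w \<le> R" "R < 1" for n w R
  proof -
    have "ennreal (cmod (deriv (F n) w) powr p * (1 - cmod w) powr (\<alpha> + 2)) \<le> ennreal C * A_int p \<alpha> (deriv (F n))"
      by (rule C(2)[OF dF]) (use R in auto)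
    also have "\<dots> \<le> ennreal C * ennreal A'" by (intro mult_left_mono A') auto
    also have "\<dots> = ennreal (C * A')" using C(1) by (simp add: ennreal_mult A'_def)
    finally have 1: "cmod (deriv (F n) w) powr p * (1 - cmod w) powr (\<alpha> + 2) \<le> C * A'"
      using C(1) by (subst (asm) ennreal_le_iff) (auto simp: A'_def)
    have "cmod (deriv (F n) w) powr p * (1 - R) powr (\<alpha> + 2) \<le> cmod (deriv (F n) w) powr p * (1 - cmod w) powr (\<alpha> + 2)"
      using R \<alpha> by (intro mult_left_mono powr_mono2) auto
    then have "cmod (deriv (F n) w) powr p \<le> C * A' * (1 - R) powr (- (\<alpha> + 2))"
      using 1 R by (subst powr_minus) (simp add: field_simps)
    then have "(cmod (deriv (F n) w) powr p) powr (1 / p) \<le> (C * A' * (1 - R) powr (- (\<alpha> + 2))) powr (1 / p)"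
      using p by (intro powr_mono2) auto
    then show ?thesis using p by (simp add: powr_powr)
  qed
  have bounded: "\<exists>B. \<forall>h\<in>range F. \<forall>z\<in>K. cmod (h z) \<le> B" if K: "compact K" "K \<subseteq> ball 0 1" for K
  proof -
    obtain R where R: "0 \<le> R" "R < 1" "K \<subseteq> cball 0 R"
    proof (cases "K = {}")
      case True then show ?thesis using that[of 0] by simp
    next
      case False
      obtain x where x: "x \<in> K" "\<And>y. y \<in> K \<Longrightarrow> cmod y \<le> cmod x"
        using continuous_attains_sup[OF K(1) False continuous_on_norm_id] by blast
      have "K \<subseteq> cball 0 (cmod x)" using x(2) by auto
      moreover have "cmod x < 1" using x(1) K(2) by auto
      ultimately show ?thesis using that[of "cmod x"] by simp
    qed
    define D where "D = (C * A' * (1 - R) powr (- (\<alpha> + 2))) powr (1 / p)"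
    have "cmod (F n z) \<le> M + D * R" if z: "z \<in> K" for n z
    proof -
      have "cmod (F n z - F n 0) \<le> D * cmod (z - 0)"
      proof (rule field_differentiable_bound[where f'="deriv (F n)" and S="cball 0 R"])
        fix w assume w: "w \<in> cball (0::complex) R"
        then show "cmod (deriv (F n) w) \<le> D" unfolding D_def using R by (intro dbound) auto
        have "w \<in> ball 0 1" using w R by auto
        then show "(F n has_field_derivative deriv (F n) w) (at w within cball 0 R)"
          by (rule holomorphic_derivI[OF F open_ball])
      qed (use R z in auto)
      also have "\<dots> \<le> D * R" using R(3) z by (intro mult_left_mono) (auto simp: D_def)
      finally show ?thesis using M[of n] norm_triangle_sub[of "F n z" "F n 0"] by linarith
    qed
    then show ?thesis by blast
  qed
  obtain g r where gr: "g holomorphic_on ball 0 1" "strict_mono (r :: nat \<Rightarrow> nat)"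
          "\<And>x. x \<in> ball 0 1 \<Longrightarrow> ((\<lambda>n. F (r n) x) \<longlongrightarrow> g x) sequentially"
          "\<And>K. \<lbrakk>compact K; K \<subseteq> ball 0 1\<rbrakk> \<Longrightarrow> uniform_limit K (F \<circ> r) g sequentially"
  proof (rule Montel[of "ball 0 1" "range F" F])
    show "h holomorphic_on ball 0 1" if "h \<in> range F" for h using that F by auto
    show "\<exists>B. \<forall>h\<in>range F. \<forall>z\<in>K. cmod (h z) \<le> B" if "compact K" "K \<subseteq> ball 0 1" for K by (rule bounded[OF that])
  qed auto
  have ul: "uniform_limit K (\<lambda>n. F (r n)) g sequentially" if "compact K" "K \<subseteq> ball 0 1" for K
    using gr(4)[OF that] by (simp add: o_def)
  have "\<exists>g'. \<forall>x\<in>ball 0 1. (g has_field_derivative g' x) (at x) \<and> ((\<lambda>n. deriv (F (r n)) x) \<longlonglongrightarrow> g' x)"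
  proof (rule has_complex_derivative_uniform_sequence)
    show "(F (r n) has_field_derivative deriv (F (r n)) x) (at x)" if "x \<in> ball 0 1" for n x
      by (rule holomorphic_derivI[OF F open_ball that])
    fix x :: complex assume "x \<in> ball 0 1"
    then obtain d where d: "d > 0" "cball x d \<subseteq> ball 0 1" using open_contains_cball[THEN iffD1, OF open_ball] by blast
    then show "\<exists>d>0. cball x d \<subseteq> ball 0 1 \<and> uniform_limit (cball x d) (\<lambda>n. F (r n)) g sequentially"
      using ul[OF compact_cball d(2)] by (intro exI[of _ d] conjI)
  qed simp
  then have dl: "(\<lambda>n. deriv (F (r n)) x) \<longlonglongrightarrow> deriv g x" if "x \<in> ball 0 1" for x
    using that DERIV_imp_deriv by fastforce
  have "A_int p \<alpha> (deriv g) \<le> ennreal A"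
    by (rule A_int_Fatou[OF p \<alpha> dF A _ dl]) (intro holomorphic_deriv gr(1), auto)
  moreover have "cmod (g 0) \<le> M"
    by (rule LIMSEQ_le_const2[OF tendsto_norm[OF gr(3)]]) (use M in auto)
  ultimately show thesis using that gr ul by blast
qed

lemma dmax_tendsto_zero:
  assumes f: "\<And>n. F n holomorphic_on ball 0 1" "g holomorphic_on ball 0 1"
    and ul: "\<And>K. compact K \<Longrightarrow> K \<subseteq> ball 0 1 \<Longrightarrow> uniform_limit K F g sequentially"
  shows "(\<lambda>n. dmax (\<lambda>z. F n z - g z) k) \<longlonglongrightarrow> 0"
proof (rule tendstoI)
  fix e :: real assume e: "e > 0"
  have h: "(\<lambda>z. F n z - g z) holomorphic_on ball 0 1" for n by (intro holomorphic_intros f)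
  have "uniform_limit (cball 0 (dpt (Suc k))) F g sequentially"
    using dpt_simps(5)[of "Suc k"] by (intro ul) auto
  then have "\<forall>\<^sub>F n in sequentially. \<forall>x\<in>cball 0 (dpt (Suc k)). dist (F n x) (g x) < e"
    using e by (rule uniform_limitD)
  then show "\<forall>\<^sub>F n in sequentially. dist (dmax (\<lambda>z. F n z - g z) k) 0 < e"
  proof eventually_elim
    case (elim n)
    obtain s where s: "s \<in> {dpt k..dpt (Suc k)}" "dmax (\<lambda>z. F n z - g z) k = cmod (F n (of_real s) - g (of_real s))"
      using dmax_attained[OF h] by blast
    have "of_real s \<in> cball (0::complex) (dpt (Suc k))" using s dpt_simps(4)[of k] by auto
    then show ?case using elim s(2) by (auto simp: dist_norm)
  qed
qed

text \<open>Beyond some index the weights are small against the common bound T, whatever n is; the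
  finitely many earlier terms vanish one by one.\<close>

lemma weighted_sum_tendsto_zero:
  fixes c :: "nat \<Rightarrow> nat \<Rightarrow> real" and \<theta> :: "nat \<Rightarrow> real"
  assumes q: "q > 0" and c: "\<And>n k. c n k \<ge> 0" "\<And>n. summable (\<lambda>k. c n k powr q)" "\<And>n. (\<Sum>k. c n k powr q) \<le> T"
    and c0: "\<And>k. (\<lambda>n. c n k) \<longlonglongrightarrow> 0" and \<theta>: "\<And>k. \<theta> k \<ge> 0" "\<theta> \<longlonglongrightarrow> 0"
    and s: "\<And>n. summable (\<lambda>k. (c n k * \<theta> k) powr q)"
  shows "(\<lambda>n. \<Sum>k. (c n k * \<theta> k) powr q) \<longlonglongrightarrow> 0"
proof (rule tendstoI)
  fix e :: real assume e: "e > 0"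
  have T: "T \<ge> 0" using order_trans[OF suminf_nonneg[OF c(2)] c(3)] by simp
  \<comment> \<open>T + 1 instead of T, because T may be 0.\<close>
  define \<delta> where "\<delta> = e / (2 * (T + 1))"
  have \<delta>: "\<delta> > 0" using e T by (simp add: \<delta>_def)
  have "(\<lambda>k. \<theta> k powr q) \<longlonglongrightarrow> 0 powr q" by (intro tendsto_powr2 \<theta> tendsto_const q) (use \<theta> in auto)
  then have "\<forall>\<^sub>F k in sequentially. \<theta> k powr q < \<delta>" using \<delta> q by (auto elim: order_tendstoD)
  then obtain K where K: "\<And>k. k \<ge> K \<Longrightarrow> \<theta> k powr q < \<delta>" by (auto simp: eventually_sequentially)
  have "(\<lambda>n. \<Sum>k<K. (c n k * \<theta> k) powr q) \<longlonglongrightarrow> (\<Sum>k<K. (0 * \<theta> k) powr q)"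
    by (intro tendsto_sum tendsto_powr2 tendsto_mult c0 tendsto_const always_eventually allI mult_nonneg_nonneg c \<theta> q)
  then have "(\<lambda>n. \<Sum>k<K. (c n k * \<theta> k) powr q) \<longlonglongrightarrow> 0" using q by simp
  then have "\<forall>\<^sub>F n in sequentially. (\<Sum>k<K. (c n k * \<theta> k) powr q) < e / 2" using order_tendstoD(2)[of _ 0 _ "e / 2"] e by simp
  then show "\<forall>\<^sub>F n in sequentially. dist (\<Sum>k. (c n k * \<theta> k) powr q) 0 < e"
  proof eventually_elim
    case (elim n)
    have "(\<Sum>k. (c n (k + K) * \<theta> (k + K)) powr q) \<le> (\<Sum>k. \<delta> * c n (k + K) powr q)"
    proof (intro suminf_le)
      fix k
      have "(c n (k + K) * \<theta> (k + K)) powr q = \<theta> (k + K) powr q * c n (k + K) powr q" by (subst mult.commute) (rule powr_mult)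
      also have "\<dots> \<le> \<delta> * c n (k + K) powr q" using K[of "k + K"] by (intro mult_right_mono) auto
      finally show "(c n (k + K) * \<theta> (k + K)) powr q \<le> \<delta> * c n (k + K) powr q" .
      show "summable (\<lambda>k. (c n (k + K) * \<theta> (k + K)) powr q)" using s[of n] by (rule summable_ignore_initial_segment)
      show "summable (\<lambda>k. \<delta> * c n (k + K) powr q)" by (intro summable_mult summable_ignore_initial_segment c(2))
    qed
    also have "\<dots> = \<delta> * (\<Sum>k. c n (k + K) powr q)" by (intro suminf_mult summable_ignore_initial_segment c(2))
    also have "\<dots> \<le> \<delta> * T"
    proof (intro mult_left_mono)
      have "(\<Sum>k. c n (k + K) powr q) \<le> (\<Sum>k. c n k powr q)"
        using suminf_split_initial_segment[OF c(2)[of n], of K] by (simp add: sum_nonneg)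
      then show "(\<Sum>k. c n (k + K) powr q) \<le> T" using c(3)[of n] by linarith
    qed (use \<delta> in simp)
    also have "\<dots> \<le> \<delta> * (T + 1)" using \<delta> by (intro mult_left_mono) auto
    also have "\<dots> = e / 2" using T by (simp add: \<delta>_def field_simps)
    finally have "(\<Sum>k. (c n k * \<theta> k) powr q) < e"
      using suminf_split_initial_segment[OF s[of n], of K] elim by linarith
    moreover have "(\<Sum>k. (c n k * \<theta> k) powr q) \<ge> 0" by (intro suminf_nonneg s) auto
    ultimately show ?case by simp
  qed
qed

section \<open>Compactness from decay of the weighted masses\<close>

context unit_interval_measure
begin

text \<open>A normal family supplies a limit g, and the dyadic bound is applied to the differences F
  (r n) - g. Their sequences \<open>c\<close> are bounded in l^q and tend to 0 termwise in n, while
  the weights \<theta> tend to 0 in k; so the images converge to the image of g.\<close>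

lemma Hilbert_compact_if_decay:
  fixes p q \<alpha> \<beta> :: real
  assumes q: "q > 1" and p: "p > 0" "p \<le> q" and \<alpha>: "\<alpha> > p - 1" and \<beta>: "\<beta> > q"
    and N: "N = (\<alpha> + 2) / p - 1 + (\<beta> + 1) * (1 - 1 / q)"
    and decay: "(\<lambda>k. mass k * (2 powr N) ^ k) \<longlonglongrightarrow> 0"
  shows "Hilbert_compact \<mu> \<beta> p \<alpha> q (\<beta> - 1)"
proof -
  define \<gamma> where "\<gamma> = (\<alpha> + 2) / p - 1"
  define e' where "e' = (\<beta> + 1) * (1 - 1 / q)"
  have a1: "\<alpha> > -1" using \<alpha> p by simp
  have b1: "\<beta> > 1" "\<beta> > 0" using \<beta> q by auto
  have \<gamma>: "\<gamma> > 0" using \<alpha> p by (simp add: \<gamma>_def field_simps)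
  \<comment> \<open>Comes from \<beta> > q; it will place the coefficient exponent below N when p
    \<ge> 1.\<close>
  have e': "e' > q - 1 / q"
  proof -
    have "(q + 1) * (1 - 1 / q) < (\<beta> + 1) * (1 - 1 / q)" using q \<beta> by (intro mult_strict_right_mono) auto
    moreover have "(q + 1) * (1 - 1 / q) = q - 1 / q" using q by (simp add: field_simps)
    ultimately show ?thesis by (simp add: e'_def)
  qed
  have qq: "1 / q < 1" using q by simp
  have e'0: "e' > 0" using e' qq q by linarith
  have N': "N = \<gamma> + e'" by (simp add: N \<gamma>_def e'_def)
  have \<kappa>: "coeff_exponent p \<alpha> < N"
  proof (cases "p \<ge> 1")
    case True
    \<comment> \<open>The coefficient exponent is \<gamma> + 1 - 1/p here, and 1 - 1/p \<le> 1 - 1/q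
      < e'.\<close>
    have "1 / q \<le> 1 / p" using p q by (simp add: frac_le)
    moreover have "\<gamma> = (\<alpha> + 1) / p + 1 / p - 1" by (simp add: \<gamma>_def add_divide_distrib)
    ultimately show ?thesis using True e' q by (simp add: coeff_exponent_def N')
  next
    case False
    then show ?thesis using e'0 by (simp add: coeff_exponent_def N' \<gamma>_def)
  qed
  define \<theta> where "\<theta> = (\<lambda>k. mass k * (2 powr N) ^ k)"
  have \<theta>0: "\<theta> k \<ge> 0" for k by (simp add: \<theta>_def mass_def)
  \<comment> \<open>Boundedness of \<theta> already bounds the masses by multiples of
    \<open>2 powr (-N * k)\<close>; this settles the convergence of all the series for functions in
    the space.\<close>
  have "Bseq \<theta>" using decay unfolding \<theta>_def by (intro convergent_imp_Bseq) (auto simp: convergent_def)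
  then obtain \<Theta> where \<Theta>: "\<Theta> > 0" "\<And>k. \<theta> k \<le> \<Theta>" using \<theta>0 by (auto simp: Bseq_def)
  have m: "mass k \<le> \<Theta> * (2 powr (- N)) ^ k" for k
  proof -
    have "mass k = \<theta> k * (2 powr (- N)) ^ k"
      by (simp add: \<theta>_def powr_minus power_inverse)
    then show ?thesis using \<Theta>(2)[of k] by (simp add: mult_right_mono)
  qed
  have S: "summable (\<lambda>k. cmod (taylor_coeff f k) * moment k)" if "in_Dirichlet p \<alpha> f" for f
    by (rule summable_taylor_moment[OF m \<kappa> _ p(1) a1 that]) (use N' \<gamma> e'0 in simp)
  obtain C1 where C1: "C1 > 0"
    "\<And>f A. f holomorphic_on ball 0 1 \<Longrightarrow> A \<ge> 0 \<Longrightarrow> A_int p \<alpha> (deriv f) \<le> ennreal A \<Longrightarrow>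
      summable (\<lambda>k. (((1/2) powr \<gamma>) ^ k * dmax f k) powr q) \<and>
      (\<Sum>k. (((1/2) powr \<gamma>) ^ k * dmax f k) powr q) \<le> C1 * (A powr (q / p) + cmod (f 0) powr q)"
    by (rule dyadic_sup_sum[OF p(1) a1 less_imp_le[OF q] p(2) \<gamma>_def \<gamma>]) (rule that)
  define c where "c = (\<lambda>f k. ((1/2) powr \<gamma>) ^ k * dmax f k)"
  have c0: "f holomorphic_on ball 0 1 \<Longrightarrow> c f k \<ge> 0" for f k
    unfolding c_def by (intro mult_nonneg_nonneg dmax_nonneg) auto
  \<comment> \<open>N = \<gamma> + e': the \<gamma> part normalises f, the e' part stays with the
    kernel.\<close>
  have dc: "dmax f k * mass k * (2 powr e') ^ k = c f k * \<theta> k" for f k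
  proof -
    have "((1/2::real) powr \<gamma>) ^ k * (2 powr N) ^ k = (2 powr e') ^ k"
      unfolding half_powr power_mult_distrib[symmetric] powr_add[symmetric] N' by simp
    then show ?thesis by (simp only: c_def \<theta>_def mult_ac)
  qed
  have sd: "summable (\<lambda>k. (c f k * \<theta> k) powr q)" if f: "f holomorphic_on ball 0 1" and s: "summable (\<lambda>k. c f k powr q)" for f
  proof (rule summable_comparison_test[OF _ summable_mult[OF s, of "\<Theta> powr q"]], intro exI allI impI)
    fix k
    have "(c f k * \<theta> k) powr q \<le> (c f k * \<Theta>) powr q"
      using c0[OF f, of k] \<theta>0 \<Theta> q by (intro powr_mono2 mult_left_mono mult_nonneg_nonneg) auto
    also have "\<dots> = \<Theta> powr q * c f k powr q" by (subst mult.commute) (rule powr_mult)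
    finally show "norm ((c f k * \<theta> k) powr q) \<le> \<Theta> powr q * c f k powr q" by simp
  qed
  obtain C where C: "C > 0"
    "\<And>f. f holomorphic_on ball 0 1 \<Longrightarrow> summable (\<lambda>k. cmod (taylor_coeff f k) * moment k) \<Longrightarrow>
      summable (\<lambda>k. (dmax f k * mass k * (2 powr ((\<beta> + 1) * (1 - 1 / q))) ^ k) powr q) \<Longrightarrow>
      A_int q (\<beta> - 1) (deriv (Hilbert_op \<mu> \<beta> f)) \<le> ennreal (C * (\<Sum>k. (dmax f k * mass k * (2 powr ((\<beta> + 1) * (1 - 1 / q))) ^ k) powr q)) \<and>
      cmod (Hilbert_op \<mu> \<beta> f 0) powr q \<le> C * (\<Sum>k. (dmax f k * mass k * (2 powr ((\<beta> + 1) * (1 - 1 / q))) ^ k) powr q)"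
    by (rule Hilbert_op_dyadic_bound[OF b1(1) q]) (rule that)
  have cs: "summable (\<lambda>k. c f k powr q)" if "in_Dirichlet p \<alpha> f" for f
  proof -
    have "f holomorphic_on ball 0 1" "A_int p \<alpha> (deriv f) < \<infinity>" using that by (auto simp: in_Dirichlet_def)
    then obtain A where "A \<ge> 0" "A_int p \<alpha> (deriv f) = ennreal A" by (cases "A_int p \<alpha> (deriv f)") auto
    then show ?thesis using C1(2)[OF \<open>f holomorphic_on ball 0 1\<close>, of A] by (simp add: c_def)
  qed
  have bound: "A_int q (\<beta> - 1) (deriv (Hilbert_op \<mu> \<beta> f)) \<le> ennreal (C * (\<Sum>k. (c f k * \<theta> k) powr q))"
    "cmod (Hilbert_op \<mu> \<beta> f 0) powr q \<le> C * (\<Sum>k. (c f k * \<theta> k) powr q)" if f: "in_Dirichlet p \<alpha> f" for f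
  proof -
    have h: "f holomorphic_on ball 0 1" using f by (simp add: in_Dirichlet_def)
    show "A_int q (\<beta> - 1) (deriv (Hilbert_op \<mu> \<beta> f)) \<le> ennreal (C * (\<Sum>k. (c f k * \<theta> k) powr q))"
      "cmod (Hilbert_op \<mu> \<beta> f 0) powr q \<le> C * (\<Sum>k. (c f k * \<theta> k) powr q)"
      using C(2)[OF h S[OF f], folded e'_def, unfolded dc, OF sd[OF h cs[OF f]]] by auto
  qed
  have maps: "Hilbert_maps \<mu> \<beta> p \<alpha> q (\<beta> - 1)"
    unfolding Hilbert_maps_def
  proof (intro allI impI conjI ballI)
    fix f n and z :: complex assume f: "in_Dirichlet p \<alpha> f"
    have h: "f holomorphic_on ball 0 1" using f by (simp add: in_Dirichlet_def)
    note H = Hilbert_op_integral[OF h S[OF f] b1(2)]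
    show "summable (\<lambda>k. of_real (mu_coef \<mu> \<beta> n k) * taylor_coeff f k)" by (rule H(2))
    show "z \<in> ball 0 1 \<Longrightarrow> summable (\<lambda>n. H_coef \<mu> \<beta> f n * z ^ n)" by (rule H(3))
    show "in_Dirichlet q (\<beta> - 1) (Hilbert_op \<mu> \<beta> f)"
      unfolding in_Dirichlet_def using H(5) bound(1)[OF f] by (auto intro: le_less_trans)
  qed
  have compact: "\<exists>r g. strict_mono r \<and> in_Dirichlet q (\<beta> - 1) g \<and>
           (\<lambda>i. Dirichlet_norm q (\<beta> - 1) (\<lambda>z. Hilbert_op \<mu> \<beta> (F (r i)) z - g z)) \<longlonglongrightarrow> 0"
    if FM: "\<And>j. in_Dirichlet p \<alpha> (F j)" "\<And>j. Dirichlet_norm p \<alpha> (F j) \<le> M" for F :: "nat \<Rightarrow> complex \<Rightarrow> complex" and M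
  proof -
    note FA = A_int_le_of_Dirichlet_norm[OF FM p(1)]
    have Fh: "F j holomorphic_on ball 0 1" for j using FM by (simp add: in_Dirichlet_def)
    obtain g r where gr: "strict_mono (r :: nat \<Rightarrow> nat)" "g holomorphic_on ball 0 1" "A_int p \<alpha> (deriv g) \<le> ennreal (M powr p)"
      "cmod (g 0) \<le> M" "\<And>K. compact K \<Longrightarrow> K \<subseteq> ball 0 1 \<Longrightarrow> uniform_limit K (\<lambda>n. F (r n)) g sequentially"
      by (rule Dirichlet_normal_family[OF p(1) a1 Fh FA(1,2)]) (rule that)
    have gD: "in_Dirichlet p \<alpha> g" using gr by (auto simp: in_Dirichlet_def intro: le_less_trans)
    define G where "G = (\<lambda>n z. F (r n) z - g z)"
    have Gh: "G n holomorphic_on ball 0 1" for n unfolding G_def by (intro holomorphic_intros Fh gr)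
    have hd: "deriv (F n) holomorphic_on ball 0 1" "deriv g holomorphic_on ball 0 1" for n
      by (intro holomorphic_deriv Fh gr; simp)+
    have dG: "deriv (G n) z = deriv (F (r n)) z - deriv g z" if "z \<in> ball 0 1" for n z
      unfolding G_def using that Fh[of "r n"] gr(2)
      by (intro deriv_diff) (auto simp: holomorphic_on_open field_differentiable_def)
    define A' where "A' = 2 powr p * (M powr p + M powr p)"
    have GA: "A_int p \<alpha> (deriv (G n)) \<le> ennreal A'" for n
    proof -
      have "A_int p \<alpha> (deriv (G n)) = A_int p \<alpha> (\<lambda>z. deriv (F (r n)) z - deriv g z)" by (rule A_int_cong) (rule dG)
      also have "\<dots> \<le> ennreal (2 powr p) * (A_int p \<alpha> (deriv (F (r n))) + A_int p \<alpha> (deriv g))"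
        by (rule A_int_diff_le[OF a1 p(1) hd])
      also have "\<dots> \<le> ennreal (2 powr p) * (ennreal (M powr p) + ennreal (M powr p))"
        by (intro mult_left_mono add_mono FA gr) auto
      also have "\<dots> = ennreal A'"
        unfolding A'_def ennreal_plus[OF powr_ge_zero powr_ge_zero, symmetric] by (rule ennreal_mult[symmetric]) auto
      finally show ?thesis .
    qed
    have A'0: "A' \<ge> 0" by (simp add: A'_def)
    have GD: "in_Dirichlet p \<alpha> (G n)" for n using Gh GA[of n] by (auto simp: in_Dirichlet_def intro: le_less_trans)
    have G0: "cmod (G n 0) \<le> 2 * M" for n
      using FA(2)[of "r n"] gr(4) norm_triangle_ineq4[of "F (r n) 0" "g 0"] by (simp add: G_def)
    define T where "T = C1 * (A' powr (q / p) + (2 * M) powr q)"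
    have cT: "(\<Sum>k. c (G n) k powr q) \<le> T" for n
    proof -
      have "(\<Sum>k. c (G n) k powr q) \<le> C1 * (A' powr (q / p) + cmod (G n 0) powr q)"
        using C1(2)[OF Gh A'0 GA, of n] by (simp add: c_def)
      also have "\<dots> \<le> T" unfolding T_def using C1(1) q G0[of n] by (intro mult_left_mono add_left_mono powr_mono2) auto
      finally show ?thesis .
    qed
    have clim: "(\<lambda>n. c (G n) k) \<longlonglongrightarrow> 0" for k
    proof -
      have "(\<lambda>n. dmax (G n) k) \<longlonglongrightarrow> 0"
        unfolding G_def by (rule dmax_tendsto_zero[OF Fh gr(2,5)])
      from tendsto_mult_right_zero[OF this] show ?thesis by (simp add: c_def)
    qed
    define s where "s = (\<lambda>n. C * (\<Sum>k. (c (G n) k * \<theta> k) powr q))"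
    have "(\<lambda>n. (\<Sum>k. (c (G n) k * \<theta> k) powr q)) \<longlonglongrightarrow> 0"
      by (rule weighted_sum_tendsto_zero[OF _ c0[OF Gh] cs[OF GD] cT clim \<theta>0 _ sd[OF Gh cs[OF GD]]])
         (use q decay in \<open>auto simp: \<theta>_def\<close>)
    from tendsto_mult_right_zero[OF this, of C] have s0: "s \<longlonglongrightarrow> 0" by (simp add: s_def)
    have snn: "s n \<ge> 0" for n unfolding s_def using C(1) by (intro mult_nonneg_nonneg suminf_nonneg sd[OF Gh cs[OF GD]]) auto
    \<comment> \<open>Linearity is read off the defining series, all of which converge.\<close>
    have HG: "Hilbert_op \<mu> \<beta> (F (r n)) z - Hilbert_op \<mu> \<beta> g z = Hilbert_op \<mu> \<beta> (G n) z" if z: "z \<in> ball 0 1" for n z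
    proof -
      note HF = Hilbert_op_integral[OF Fh[of "r n"] S[OF FM(1)] b1(2)]
      note Hg = Hilbert_op_integral[OF gr(2) S[OF gD] b1(2)]
      have tc: "taylor_coeff (G n) k = taylor_coeff (F (r n)) k - taylor_coeff g k" for k
        using higher_deriv_diff[OF Fh[of "r n"] gr(2), of 0 k] by (simp add: taylor_coeff_def G_def diff_divide_distrib)
      have hc: "H_coef \<mu> \<beta> (G n) i = H_coef \<mu> \<beta> (F (r n)) i - H_coef \<mu> \<beta> g i" for i
        unfolding H_coef_def tc right_diff_distrib by (rule suminf_diff[symmetric, OF HF(2) Hg(2)])
      show ?thesis unfolding Hilbert_op_def hc left_diff_distrib by (rule suminf_diff[OF HF(3)[OF z] Hg(3)[OF z]])
    qed
    have dn: "Dirichlet_norm q (\<beta> - 1) (\<lambda>z. Hilbert_op \<mu> \<beta> (F (r n)) z - Hilbert_op \<mu> \<beta> g z) \<le> s n powr (1 / q) + s n powr (1 / q)" for n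
    proof -
      define D where "D = (\<lambda>z. Hilbert_op \<mu> \<beta> (F (r n)) z - Hilbert_op \<mu> \<beta> g z)"
      have "deriv D z = deriv (Hilbert_op \<mu> \<beta> (G n)) z" if "z \<in> ball 0 1" for z
      proof (rule deriv_cong_ev)
        show "\<forall>\<^sub>F x in nhds z. D x = Hilbert_op \<mu> \<beta> (G n) x"
          unfolding D_def using eventually_nhds_in_open[OF open_ball that] by eventually_elim (rule HG)
      qed simp
      then have "A_int q (\<beta> - 1) (deriv D) = A_int q (\<beta> - 1) (deriv (Hilbert_op \<mu> \<beta> (G n)))" by (rule A_int_cong)
      also have "\<dots> \<le> ennreal (s n)" unfolding s_def by (rule bound(1)[OF GD])
      finally have "enn2real (A_int q (\<beta> - 1) (deriv D)) \<le> s n"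
        using snn by (simp add: enn2real_leI)
      then have 1: "enn2real (A_int q (\<beta> - 1) (deriv D)) powr (1 / q) \<le> s n powr (1 / q)"
        using q by (intro powr_mono2) auto
      have "cmod (D 0) powr q \<le> s n" using bound(2)[OF GD, of n] HG[of 0 n] by (simp add: D_def s_def)
      then have "(cmod (D 0) powr q) powr (1 / q) \<le> s n powr (1 / q)" using q by (intro powr_mono2) auto
      then have "cmod (D 0) \<le> s n powr (1 / q)" using q by (simp add: powr_powr)
      with 1 show ?thesis unfolding Dirichlet_norm_def D_def by simp
    qed
    have "(\<lambda>n. s n powr (1 / q)) \<longlonglongrightarrow> 0 powr (1 / q)" by (intro tendsto_powr2 s0 tendsto_const) (use snn q in auto)
    then have "(\<lambda>n. s n powr (1 / q) + s n powr (1 / q)) \<longlonglongrightarrow> 0" using tendsto_add by fastforce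
    then have "(\<lambda>n. Dirichlet_norm q (\<beta> - 1) (\<lambda>z. Hilbert_op \<mu> \<beta> (F (r n)) z - Hilbert_op \<mu> \<beta> g z)) \<longlonglongrightarrow> 0"
      by (rule Lim_null_comparison[rotated]) (use dn in \<open>auto simp: Dirichlet_norm_def\<close>)
    moreover have "in_Dirichlet q (\<beta> - 1) (Hilbert_op \<mu> \<beta> g)" using maps gD by (simp add: Hilbert_maps_def)
    ultimately show ?thesis using gr(1) by blast
  qed
  show ?thesis unfolding Hilbert_compact_def using maps compact by blast
qed

end

subsection \<open>Test functions\<close>

text \<open>There is an explicit antiderivative: (1 - u)/(1 - b u) has derivative (b - 1)/(1 - b
  u)^2, so its power \<alpha> + 1 differentiates to the integrand up to a constant factor.\<close>

lemma beta_type_integral: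
  fixes b \<alpha> :: real
  assumes "0 \<le> b" "b < 1" "\<alpha> > -1"
  shows "((\<lambda>u. (1 - u) powr \<alpha> * (1 - b * u) powr (- \<alpha> - 2)) has_integral 1 / ((\<alpha> + 1) * (1 - b))) {0..1}"
proof -
  define \<Phi> where "\<Phi> = (\<lambda>u. - (((1 - u) / (1 - b * u)) powr (\<alpha> + 1)) / ((\<alpha> + 1) * (1 - b)))"
  have bu: "1 - b * u > 0" if "0 \<le> u" "u \<le> 1" for u
    using mult_left_mono[OF that(2) assms(1)] assms by simp
  have "((\<lambda>u. (1 - u) powr \<alpha> * (1 - b * u) powr (- \<alpha> - 2)) has_integral (\<Phi> 1 - \<Phi> 0)) {0..1}"
  proof (rule fundamental_theorem_of_calculus_interior)
    have "1 - b * u \<noteq> 0" if "u \<in> {0..1}" for u using bu[of u] that by simp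
    then have c1: "continuous_on {0..1} (\<lambda>u. (1 - u) / (1 - b * u))" by (intro continuous_intros) auto
    have "0 \<le> (1 - u) / (1 - b * u)" if "u \<in> {0..1}" for u
      using bu[of u] that by (intro divide_nonneg_pos) auto
    \<comment> \<open>Continuity at u = 1 rests on \<alpha> + 1 > 0. The integrand may blow up
      there, so differentiability is used in the interior only.\<close>
    then have "continuous_on {0..1} (\<lambda>u. ((1 - u) / (1 - b * u)) powr (\<alpha> + 1))"
      using assms(3) by (intro continuous_on_powr' c1 continuous_on_const) auto
    then show "continuous_on {0..1} \<Phi>"
      unfolding \<Phi>_def using assms by (intro continuous_on_divide continuous_on_minus continuous_on_const) auto
    fix u :: real assume u: "u \<in> {0<..<1}"
    define v where "v = (1 - u) / (1 - b * u)"
    have b0: "1 - b * u > 0" using bu[of u] u by simp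
    have v0: "v > 0" using u b0 by (simp add: v_def)
    have dv: "((\<lambda>u. (1 - u) / (1 - b * u)) has_real_derivative ((b - 1) / (1 - b * u)\<^sup>2)) (at u)"
      using b0 by (auto intro!: derivative_eq_intros simp: power2_eq_square algebra_simps)
    have d1: "((\<lambda>u. ((1 - u) / (1 - b * u)) powr (\<alpha> + 1)) has_real_derivative ((\<alpha> + 1) * v powr \<alpha> * ((b - 1) / (1 - b * u)\<^sup>2))) (at u)"
    proof -
      have "((\<lambda>y. y powr (\<alpha> + 1)) has_real_derivative (\<alpha> + 1) * v powr (\<alpha> + 1 - 1)) (at ((1 - u) / (1 - b * u)))"
        using has_real_derivative_powr[OF v0] by (simp only: v_def)
      from DERIV_chain2[OF this dv] show ?thesis by simp
    qed
    have "(\<Phi> has_real_derivative (- ((\<alpha> + 1) * v powr \<alpha> * ((b - 1) / (1 - b * u)\<^sup>2)) / ((\<alpha> + 1) * (1 - b)))) (at u)"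
      unfolding \<Phi>_def by (intro DERIV_cdivide DERIV_minus d1)
    moreover have "- ((\<alpha> + 1) * v powr \<alpha> * ((b - 1) / (1 - b * u)\<^sup>2)) / ((\<alpha> + 1) * (1 - b)) = (1 - u) powr \<alpha> * (1 - b * u) powr (- \<alpha> - 2)"
    proof -
      have "- ((\<alpha> + 1) * v powr \<alpha> * ((b - 1) / (1 - b * u)\<^sup>2)) / ((\<alpha> + 1) * (1 - b))
          = ((\<alpha> + 1) * (1 - b)) * (v powr \<alpha> / (1 - b * u)\<^sup>2) / ((\<alpha> + 1) * (1 - b))"
        by (simp add: algebra_simps diff_divide_distrib)
      also have "\<dots> = v powr \<alpha> / (1 - b * u)\<^sup>2" using assms by simp
      also have "\<dots> = (1 - u) powr \<alpha> * (1 - b * u) powr (- \<alpha> - 2)"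
      proof -
        have "v powr \<alpha> = (1 - u) powr \<alpha> / (1 - b * u) powr \<alpha>" using u b0 by (simp add: v_def powr_divide)
        moreover have "(1 - b * u) powr (- \<alpha> - 2) = 1 / ((1 - b * u) powr \<alpha> * (1 - b * u)\<^sup>2)"
          using b0 by (simp add: powr_diff powr_minus powr_numeral divide_inverse)
        ultimately show ?thesis by simp
      qed
      finally show ?thesis .
    qed
    ultimately show "(\<Phi> has_vector_derivative (1 - u) powr \<alpha> * (1 - b * u) powr (- \<alpha> - 2)) (at u)"
      by (simp add: has_real_derivative_iff_has_vector_derivative)
  qed simp
  moreover have "\<Phi> 1 - \<Phi> 0 = 1 / ((\<alpha> + 1) * (1 - b))" by (simp add: \<Phi>_def)
  ultimately show ?thesis by simp
qed

text \<open>The real part of (1 + u)/(1 - u) is the Poisson kernel, and its mean over a circle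
  around 0 is the value 1 at the centre.\<close>

lemma poisson_average:
  assumes "cmod w < 1"
  shows "(\<integral>\<^sup>+\<theta>\<in>{0..1}. ennreal (1 / (cmod (1 - circ \<theta> * w))\<^sup>2) \<partial>lborel) \<le> ennreal (1 / (1 - cmod w))"
proof -
  define h where "h = (\<lambda>u::complex. (1 + u) / (1 - u))"
  have h: "h holomorphic_on ball 0 1" unfolding h_def by (intro holomorphic_intros) auto
  have "((\<lambda>\<theta>. h (circ \<theta> * w)) has_integral 1) {0..1}"
    using circle_mean_value[OF h assms, of 0] by (simp add: h_def)
  then have "((\<lambda>\<theta>. Re (h (circ \<theta> * w))) has_integral 1) {0..1}"
    by (drule_tac has_integral_Re) simp
  moreover have "Re (h u) = (1 - (cmod u)\<^sup>2) / (cmod (1 - u))\<^sup>2" if "cmod u < 1" for u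
  proof -
    have "h u = (1 + u) * cnj (1 - u) / of_real ((cmod (1 - u))\<^sup>2)"
      unfolding h_def by (subst complex_div_cnj) simp
    then have "Re (h u) = Re ((1 + u) * cnj (1 - u)) / (cmod (1 - u))\<^sup>2" by (simp only: Re_divide_of_real)
    also have "Re ((1 + u) * cnj (1 - u)) = 1 - (cmod u)\<^sup>2"
      by (simp add: cmod_power2[unfolded power2_eq_square] algebra_simps power2_eq_square)
    finally show ?thesis .
  qed
  ultimately have "((\<lambda>\<theta>. (1 - (cmod w)\<^sup>2) / (cmod (1 - circ \<theta> * w))\<^sup>2) has_integral 1) {0..1}"
    using assms by (simp add: norm_mult)
  then have i: "((\<lambda>\<theta>. (1 - (cmod w)\<^sup>2) / (cmod (1 - circ \<theta> * w))\<^sup>2 * (1 / (1 - (cmod w)\<^sup>2))) has_integral 1 * (1 / (1 - (cmod w)\<^sup>2))) {0..1}"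
    by (rule has_integral_mult_left)
  have w2: "(cmod w)\<^sup>2 \<le> cmod w" using assms by (simp add: power2_eq_square mult_left_le)
  have "((\<lambda>\<theta>. 1 / (cmod (1 - circ \<theta> * w))\<^sup>2) has_integral 1 / (1 - (cmod w)\<^sup>2)) {0..1}"
    using i w2 assms by simp
  from nn_integral_has_integral_lebesgue[OF _ this]
  have "(\<integral>\<^sup>+\<theta>. ennreal (indicator {0..1} \<theta> * (1 / (cmod (1 - circ \<theta> * w))\<^sup>2)) \<partial>lborel) = ennreal (1 / (1 - (cmod w)\<^sup>2))"
    by simp
  moreover have "(\<integral>\<^sup>+\<theta>\<in>{0..1}. ennreal (1 / (cmod (1 - circ \<theta> * w))\<^sup>2) \<partial>lborel)
      = (\<integral>\<^sup>+\<theta>. ennreal (indicator {0..1} \<theta> * (1 / (cmod (1 - circ \<theta> * w))\<^sup>2)) \<partial>lborel)"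
    by (intro nn_integral_cong) (simp add: indicator_def)
  ultimately have "(\<integral>\<^sup>+\<theta>\<in>{0..1}. ennreal (1 / (cmod (1 - circ \<theta> * w))\<^sup>2) \<partial>lborel) = ennreal (1 / (1 - (cmod w)\<^sup>2))"
    by simp
  also have "\<dots> \<le> ennreal (1 / (1 - cmod w))" using w2 assms by (intro ennreal_leI frac_le) auto
  finally show ?thesis .
qed

text \<open>Split the exponent \<alpha> + 3 as (\<alpha> + 1) + 2. The first factor has a radial
  bound, the square is averaged over circles with the Poisson kernel, and in u = |z|^2 the rest is
  the explicit integral above.\<close>

lemma forelli_rudin_bound:
  fixes b \<alpha> :: real
  assumes b: "0 \<le> b" "b < 1" and \<alpha>: "\<alpha> > -1"
  shows "(\<integral>\<^sup>+z. indicator (ball 0 1) z * ennreal (cmod (1 - of_real b * z) powr (- (\<alpha> + 3)) * (1 - (cmod z)\<^sup>2) powr \<alpha>) \<partial>lborel)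
     \<le> ennreal (pi * 2 powr (\<alpha> + 2) / ((\<alpha> + 1) * (1 - b)))"
proof -
  have bz: "b * cmod z < 1" "1 - b * cmod z \<le> cmod (1 - of_real b * z)" if "cmod z < 1" for z
  proof -
    have "b * cmod z \<le> b * 1" using that b by (intro mult_left_mono) auto
    then show "b * cmod z < 1" using b by simp
    show "1 - b * cmod z \<le> cmod (1 - of_real b * z)"
      using norm_triangle_ineq2[of 1 "of_real b * z"] b by (simp add: norm_mult)
  qed
  define W where "W = (\<lambda>z. indicator (ball (0::complex) 1) z * ennreal ((1 - (cmod z)\<^sup>2) powr \<alpha> * (1 - b * cmod z) powr (- (\<alpha> + 1))))"
  define P where "P = (\<lambda>z. ennreal (1 / (cmod (1 - of_real b * z))\<^sup>2))"
  have mP[measurable]: "P \<in> borel_measurable borel" unfolding P_def by measurable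
  have [measurable]: "ball (0::complex) 1 \<in> sets borel" by simp
  have mW[measurable]: "W \<in> borel_measurable borel" unfolding W_def by measurable
  have "(\<integral>\<^sup>+z. indicator (ball 0 1) z * ennreal (cmod (1 - of_real b * z) powr (- (\<alpha> + 3)) * (1 - (cmod z)\<^sup>2) powr \<alpha>) \<partial>lborel)
    \<le> (\<integral>\<^sup>+z. W z * P z \<partial>lborel)"
  proof (rule nn_integral_mono)
    fix z :: complex
    show "indicator (ball 0 1) z * ennreal (cmod (1 - of_real b * z) powr (- (\<alpha> + 3)) * (1 - (cmod z)\<^sup>2) powr \<alpha>) \<le> W z * P z"
    proof (cases "z \<in> ball 0 1")
      case True
      then have z: "cmod z < 1" by simp
      have pos: "cmod (1 - of_real b * z) > 0" using bz[OF z] by linarith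
      have "cmod (1 - of_real b * z) powr (- (\<alpha> + 3)) = cmod (1 - of_real b * z) powr (- (\<alpha> + 1) + - 2)" by (rule arg_cong) simp
      also have "\<dots> = cmod (1 - of_real b * z) powr (- (\<alpha> + 1)) * (1 / (cmod (1 - of_real b * z))\<^sup>2)"
        using pos unfolding powr_add by (simp add: powr_minus powr_numeral divide_inverse)
      also have "\<dots> \<le> (1 - b * cmod z) powr (- (\<alpha> + 1)) * (1 / (cmod (1 - of_real b * z))\<^sup>2)"
        using bz[OF z] \<alpha> by (intro mult_right_mono powr_mono2') auto
      finally have "cmod (1 - of_real b * z) powr (- (\<alpha> + 3)) * (1 - (cmod z)\<^sup>2) powr \<alpha>
        \<le> ((1 - b * cmod z) powr (- (\<alpha> + 1)) * (1 / (cmod (1 - of_real b * z))\<^sup>2)) * (1 - (cmod z)\<^sup>2) powr \<alpha>"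
        by (rule mult_right_mono) simp
      also have "\<dots> = ((1 - (cmod z)\<^sup>2) powr \<alpha> * (1 - b * cmod z) powr (- (\<alpha> + 1))) * (1 / (cmod (1 - of_real b * z))\<^sup>2)" by simp
      finally have "ennreal (cmod (1 - of_real b * z) powr (- (\<alpha> + 3)) * (1 - (cmod z)\<^sup>2) powr \<alpha>)
        \<le> ennreal ((1 - (cmod z)\<^sup>2) powr \<alpha> * (1 - b * cmod z) powr (- (\<alpha> + 1))) * P z"
        unfolding P_def by (subst ennreal_mult[symmetric]) (auto intro: ennreal_leI)
      then show ?thesis using True by (simp add: W_def)
    qed simp
  qed
  also have "\<dots> = (\<integral>\<^sup>+z. (\<integral>\<^sup>+\<theta>\<in>{0..1}. W (circ \<theta> * z) * P (circ \<theta> * z) \<partial>lborel) \<partial>lborel)"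
    by (rule nn_integral_circle_average) measurable
  also have "\<dots> \<le> (\<integral>\<^sup>+z. indicator (ball (0::complex) 1) z * ennreal (2 powr (\<alpha> + 2) * ((1 - (cmod z)\<^sup>2) powr \<alpha> * (1 - b * (cmod z)\<^sup>2) powr (- \<alpha> - 2))) \<partial>lborel)"
  proof (rule nn_integral_mono)
    fix z :: complex
    have Wrot: "W (circ \<theta> * z) = W z" for \<theta> by (simp add: W_def norm_mult indicator_def)
    have "(\<integral>\<^sup>+\<theta>\<in>{0..1}. W (circ \<theta> * z) * P (circ \<theta> * z) \<partial>lborel) = W z * (\<integral>\<^sup>+\<theta>\<in>{0..1}. P (circ \<theta> * z) \<partial>lborel)"
      unfolding Wrot mult.assoc by (rule nn_integral_cmult) measurable
    also have "\<dots> \<le> indicator (ball (0::complex) 1) z * ennreal (2 powr (\<alpha> + 2) * ((1 - (cmod z)\<^sup>2) powr \<alpha> * (1 - b * (cmod z)\<^sup>2) powr (- \<alpha> - 2)))"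
    proof (cases "z \<in> ball 0 1")
      case True
      then have z: "cmod z < 1" by simp
      have nbz: "cmod (of_real b * z) = b * cmod z" using b by (simp add: norm_mult)
      have "(\<integral>\<^sup>+\<theta>\<in>{0..1}. P (circ \<theta> * z) \<partial>lborel) = (\<integral>\<^sup>+\<theta>\<in>{0..1}. ennreal (1 / (cmod (1 - circ \<theta> * (of_real b * z)))\<^sup>2) \<partial>lborel)"
        by (simp add: P_def mult.left_commute)
      also have "\<dots> \<le> ennreal (1 / (1 - b * cmod z))"
        using poisson_average[of "of_real b * z"] bz[OF z] by (simp only: nbz)
      finally have "W z * (\<integral>\<^sup>+\<theta>\<in>{0..1}. P (circ \<theta> * z) \<partial>lborel) \<le> W z * ennreal (1 / (1 - b * cmod z))"
        by (rule mult_left_mono) simp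
      also have "\<dots> = ennreal ((1 - (cmod z)\<^sup>2) powr \<alpha> * (1 - b * cmod z) powr (- (\<alpha> + 2)))"
      proof -
        have "(1 - b * cmod z) powr (- (\<alpha> + 2)) = (1 - b * cmod z) powr (- (\<alpha> + 1) + - 1)" by (rule arg_cong) simp
        also have "\<dots> = (1 - b * cmod z) powr (- (\<alpha> + 1)) * (1 / (1 - b * cmod z))"
          using bz[OF z] unfolding powr_add by (simp add: powr_minus divide_inverse)
        finally show ?thesis using True bz[OF z] by (simp add: W_def ennreal_mult[symmetric] mult.assoc)
      qed
      also have "\<dots> \<le> ennreal (2 powr (\<alpha> + 2) * ((1 - (cmod z)\<^sup>2) powr \<alpha> * (1 - b * (cmod z)\<^sup>2) powr (- \<alpha> - 2)))"
      proof (rule ennreal_leI)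
        have z2: "(cmod z)\<^sup>2 \<le> 1" using z by (simp add: abs_square_le_1)
        \<comment> \<open>Turns the bound into a function of |z|^2; the price is the factor
          \<open>2 powr (\<alpha> + 2)\<close>.\<close>
        have "1 - b * (cmod z)\<^sup>2 \<le> 1 - b\<^sup>2 * (cmod z)\<^sup>2"
          using b by (intro diff_left_mono mult_right_mono) (auto simp: power2_eq_square mult_left_le)
        also have "\<dots> = (1 - b * cmod z) * (1 + b * cmod z)" by (simp add: algebra_simps power2_eq_square)
        also have "\<dots> \<le> (1 - b * cmod z) * 2" using bz[OF z] by (intro mult_left_mono) auto
        finally have "(1 - b * (cmod z)\<^sup>2) / 2 \<le> 1 - b * cmod z" by simp
        moreover have bz2: "0 < 1 - b * (cmod z)\<^sup>2" using mult_left_mono[OF z2 b(1)] b by simp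
        ultimately have "(1 - b * cmod z) powr (- (\<alpha> + 2)) \<le> ((1 - b * (cmod z)\<^sup>2) / 2) powr (- (\<alpha> + 2))"
          using \<alpha> by (intro powr_mono2') auto
        also have "\<dots> = (1 - b * (cmod z)\<^sup>2) powr (- (\<alpha> + 2)) / 2 powr (- (\<alpha> + 2))" using bz2 by (intro powr_divide) 
        also have "\<dots> = 2 powr (\<alpha> + 2) * (1 - b * (cmod z)\<^sup>2) powr (- \<alpha> - 2)"
        proof -
          have "2 powr (- (\<alpha> + 2)) = inverse (2 powr (\<alpha> + 2))" "- (\<alpha> + 2) = - \<alpha> - 2" by (rule powr_minus) simp
          then show ?thesis by (simp only: divide_inverse inverse_inverse_eq mult.commute)
        qed
        finally have "(1 - (cmod z)\<^sup>2) powr \<alpha> * (1 - b * cmod z) powr (- (\<alpha> + 2))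
           \<le> (1 - (cmod z)\<^sup>2) powr \<alpha> * (2 powr (\<alpha> + 2) * (1 - b * (cmod z)\<^sup>2) powr (- \<alpha> - 2))" by (rule mult_left_mono) simp
        then show "(1 - (cmod z)\<^sup>2) powr \<alpha> * (1 - b * cmod z) powr (- (\<alpha> + 2))
           \<le> 2 powr (\<alpha> + 2) * ((1 - (cmod z)\<^sup>2) powr \<alpha> * (1 - b * (cmod z)\<^sup>2) powr (- \<alpha> - 2))" by (simp only: mult.left_commute)
      qed
      finally show ?thesis using True by simp
    qed (simp add: W_def)
    finally show "(\<integral>\<^sup>+\<theta>\<in>{0..1}. W (circ \<theta> * z) * P (circ \<theta> * z) \<partial>lborel)
      \<le> indicator (ball (0::complex) 1) z * ennreal (2 powr (\<alpha> + 2) * ((1 - (cmod z)\<^sup>2) powr \<alpha> * (1 - b * (cmod z)\<^sup>2) powr (- \<alpha> - 2)))" .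
  qed
  also have "\<dots> = ennreal pi * (\<integral>\<^sup>+u\<in>{0..<1}. ennreal (2 powr (\<alpha> + 2) * ((1 - u) powr \<alpha> * (1 - b * u) powr (- \<alpha> - 2))) \<partial>lborel)"
    by (rule nn_integral_radial[of "\<lambda>u. ennreal (2 powr (\<alpha> + 2) * ((1 - u) powr \<alpha> * (1 - b * u) powr (- \<alpha> - 2)))"]) measurable
  also have "\<dots> \<le> ennreal pi * ennreal (2 powr (\<alpha> + 2) * (1 / ((\<alpha> + 1) * (1 - b))))"
  proof (intro mult_left_mono)
    have i: "((\<lambda>u. 2 powr (\<alpha> + 2) * ((1 - u) powr \<alpha> * (1 - b * u) powr (- \<alpha> - 2))) has_integral 2 powr (\<alpha> + 2) * (1 / ((\<alpha> + 1) * (1 - b)))) {0..1}"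
      by (rule has_integral_mult_right[OF beta_type_integral[OF b \<alpha>]])
    have "(\<integral>\<^sup>+u\<in>{0..<1}. ennreal (2 powr (\<alpha> + 2) * ((1 - u) powr \<alpha> * (1 - b * u) powr (- \<alpha> - 2))) \<partial>lborel)
      \<le> (\<integral>\<^sup>+u. ennreal (indicator {0..1} u * (2 powr (\<alpha> + 2) * ((1 - u) powr \<alpha> * (1 - b * u) powr (- \<alpha> - 2)))) \<partial>lborel)"
      by (intro nn_integral_mono) (auto simp: indicator_def)
    also have "\<dots> = ennreal (2 powr (\<alpha> + 2) * (1 / ((\<alpha> + 1) * (1 - b))))"
      by (rule nn_integral_has_integral_lebesgue[OF _ i]) simp
    finally show "(\<integral>\<^sup>+u\<in>{0..<1}. ennreal (2 powr (\<alpha> + 2) * ((1 - u) powr \<alpha> * (1 - b * u) powr (- \<alpha> - 2))) \<partial>lborel)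
      \<le> ennreal (2 powr (\<alpha> + 2) * (1 / ((\<alpha> + 1) * (1 - b))))" .
  qed simp
  also have "\<dots> = ennreal (pi * 2 powr (\<alpha> + 2) / ((\<alpha> + 1) * (1 - b)))"
    using b \<alpha> by (subst ennreal_mult[symmetric]) auto
  finally show ?thesis .
qed

definition test_fun :: "real \<Rightarrow> real \<Rightarrow> real \<Rightarrow> complex \<Rightarrow> complex" where
  "test_fun s \<gamma> b z = of_real ((1 - b) powr s) * (1 - of_real b * z) powr (- of_real (\<gamma> + s))"

text \<open>Keeps 1 - w off the branch cut of \<open>powr\<close>.\<close>

lemma one_minus_not_nonpos_Reals:
  assumes "cmod w < 1" shows "1 - w \<notin> \<real>\<^sub>\<le>\<^sub>0"
proof
  assume "1 - w \<in> \<real>\<^sub>\<le>\<^sub>0"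
  then have "Re w \<ge> 1" by (auto simp: complex_nonpos_Reals_iff)
  then show False using complex_Re_le_cmod[of w] assms by linarith
qed

lemma test_fun_deriv:
  assumes "0 \<le> b" "cmod (of_real b * z) < 1"
  shows "(test_fun s \<gamma> b has_field_derivative
     of_real ((1 - b) powr s * (\<gamma> + s) * b) * (1 - of_real b * z) powr (- of_real (\<gamma> + s + 1))) (at z)"
proof -
  have n: "1 - of_real b * z \<notin> \<real>\<^sub>\<le>\<^sub>0" by (rule one_minus_not_nonpos_Reals[OF assms(2)])
  have e: "- complex_of_real (\<gamma> + s) - 1 = - of_real (\<gamma> + s + 1)" by simp
  have "((\<lambda>z. of_real ((1 - b) powr s) * (1 - of_real b * z) powr (- of_real (\<gamma> + s))) has_field_derivative
     of_real ((1 - b) powr s) * (- of_real (\<gamma> + s) * (1 - of_real b * z) powr (- of_real (\<gamma> + s + 1)) * (- of_real b))) (at z)"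
    using n unfolding e[symmetric] by (auto intro!: derivative_eq_intros has_field_derivative_powr)
  moreover have "of_real ((1 - b) powr s) * (- of_real (\<gamma> + s) * (1 - of_real b * z) powr (- of_real (\<gamma> + s + 1)) * (- of_real b))
      = of_real ((1 - b) powr s * (\<gamma> + s) * b) * (1 - of_real b * z) powr (- of_real (\<gamma> + s + 1))"
    by (simp only: of_real_mult mult_minus_left mult_minus_right minus_minus mult_ac)
  ultimately show ?thesis unfolding test_fun_def by simp
qed

text \<open>For b < 1 the disc of radius 1/b exceeds the unit disc, which will make the Taylor
  coefficients absolutely summable.\<close>

lemma test_fun_holomorphic:
  assumes "0 < b" shows "test_fun s \<gamma> b holomorphic_on ball 0 (1 / b)"
proof (rule holomorphic_onI)
  fix z :: complex assume "z \<in> ball 0 (1 / b)"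
  then have "cmod (of_real b * z) < 1" using assms by (simp add: norm_mult field_simps)
  from test_fun_deriv[OF less_imp_le[OF assms] this]
  show "test_fun s \<gamma> b field_differentiable at z within ball 0 (1 / b)"
    using field_differentiable_at_within field_differentiable_def by blast
qed

lemma test_fun_holomorphic_unit_ball:
  assumes "0 < b" "b < 1" shows "test_fun s \<gamma> b holomorphic_on ball 0 1"
proof (rule holomorphic_on_subset[OF test_fun_holomorphic[OF assms(1)]])
  have "1 \<le> 1 / b" using assms by simp
  then show "ball (0::complex) 1 \<subseteq> ball 0 (1 / b)" by (rule subset_ball)
qed

lemma norm_test_fun:
  assumes "0 \<le> b" "b < 1" "cmod z < 1"
  shows "cmod (test_fun s \<gamma> b z) = (1 - b) powr s * cmod (1 - of_real b * z) powr (- (\<gamma> + s))"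
  using norm_kernel[OF assms, of "\<gamma> + s"] by (simp add: test_fun_def norm_mult)

text \<open>The choice s = 1/p gives (\<gamma> + s + 1) p = \<alpha> + 3, the exponent of
  \<open>forelli_rudin_bound\<close>. The normalisation contributes 1 - b, which cancels the 1/(1 -
  b) there, so the bound is free of b.\<close>

lemma test_fun_A_int:
  fixes p \<alpha> b :: real
  assumes p: "p > 0" and \<alpha>: "\<alpha> > -1" and b: "0 < b" "b < 1" and \<gamma>: "\<gamma> = (\<alpha> + 2) / p - 1" "\<gamma> > 0"
  shows "A_int p \<alpha> (deriv (test_fun (1 / p) \<gamma> b)) \<le> ennreal ((\<gamma> + 1 / p) powr p * 2 powr (\<alpha> + 2))"
proof -
  define \<eta> where "\<eta> = \<gamma> + 1 / p"
  have \<eta>: "\<eta> > 0" "(\<eta> + 1) * p = \<alpha> + 3" using p \<gamma>(2) by (simp add: \<eta>_def add_pos_pos, simp add: \<eta>_def \<gamma>(1) field_simps)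
  have d: "cmod (deriv (test_fun (1 / p) \<gamma> b) z) powr p \<le> \<eta> powr p * (1 - b) * cmod (1 - of_real b * z) powr (- (\<alpha> + 3))"
    if z: "cmod z < 1" for z
  proof -
    have "b * cmod z \<le> 1 * cmod z" using b by (intro mult_right_mono) auto
    then have c: "cmod (of_real b * z) < 1" using z b by (simp add: norm_mult)
    have "deriv (test_fun (1 / p) \<gamma> b) z = of_real ((1 - b) powr (1 / p) * \<eta> * b) * (1 - of_real b * z) powr (- of_real (\<eta> + 1))"
      using DERIV_imp_deriv[OF test_fun_deriv[OF less_imp_le[OF b(1)] c]] by (simp add: \<eta>_def)
    then have "cmod (deriv (test_fun (1 / p) \<gamma> b) z) = (1 - b) powr (1 / p) * \<eta> * b * cmod (1 - of_real b * z) powr (- (\<eta> + 1))"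
      using norm_kernel[OF less_imp_le[OF b(1)] b(2) z, of "\<eta> + 1"] b \<eta> by (simp add: norm_mult del: of_real_mult of_real_add)
    also have "\<dots> \<le> (1 - b) powr (1 / p) * \<eta> * 1 * cmod (1 - of_real b * z) powr (- (\<eta> + 1))"
      using b \<eta> by (intro mult_right_mono mult_left_mono) auto
    finally have "cmod (deriv (test_fun (1 / p) \<gamma> b) z) powr p \<le> ((1 - b) powr (1 / p) * \<eta> * cmod (1 - of_real b * z) powr (- (\<eta> + 1))) powr p"
      using p by (intro powr_mono2) auto
    also have "\<dots> = ((1 - b) powr (1 / p)) powr p * \<eta> powr p * (cmod (1 - of_real b * z) powr (- (\<eta> + 1))) powr p"
      by (simp only: powr_mult)
    also have "((1 - b) powr (1 / p)) powr p = 1 - b" using p b by (simp add: powr_powr)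
    also have "(cmod (1 - of_real b * z) powr (- (\<eta> + 1))) powr p = cmod (1 - of_real b * z) powr (- (\<alpha> + 3))"
      unfolding powr_powr \<eta>(2)[symmetric] by (simp only: mult_minus_left)
    finally show ?thesis by (simp only: mult.commute mult.left_commute)
  qed
  have hol: "deriv (test_fun (1 / p) \<gamma> b) holomorphic_on ball 0 1"
    by (rule holomorphic_deriv[OF test_fun_holomorphic_unit_ball[OF b] open_ball])
  have "A_int p \<alpha> (deriv (test_fun (1 / p) \<gamma> b)) = ennreal ((\<alpha> + 1) / pi) * (\<integral>\<^sup>+ z. indicator (ball 0 1) z * ennreal (cmod (deriv (test_fun (1 / p) \<gamma> b) z) powr p * (1 - (cmod z)\<^sup>2) powr \<alpha>) \<partial>lborel)"
    by (rule A_int_eq[OF \<alpha> p hol])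
  also have "\<dots> \<le> ennreal ((\<alpha> + 1) / pi) * (\<integral>\<^sup>+ z. ennreal (\<eta> powr p * (1 - b)) * (indicator (ball 0 1) z * ennreal (cmod (1 - of_real b * z) powr (- (\<alpha> + 3)) * (1 - (cmod z)\<^sup>2) powr \<alpha>)) \<partial>lborel)"
  proof (intro mult_left_mono nn_integral_mono)
    fix z :: complex
    show "indicator (ball 0 1) z * ennreal (cmod (deriv (test_fun (1 / p) \<gamma> b) z) powr p * (1 - (cmod z)\<^sup>2) powr \<alpha>)
      \<le> ennreal (\<eta> powr p * (1 - b)) * (indicator (ball 0 1) z * ennreal (cmod (1 - of_real b * z) powr (- (\<alpha> + 3)) * (1 - (cmod z)\<^sup>2) powr \<alpha>))"
    proof (cases "z \<in> ball 0 1")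
      case True
      then have "cmod (deriv (test_fun (1 / p) \<gamma> b) z) powr p * (1 - (cmod z)\<^sup>2) powr \<alpha>
        \<le> (\<eta> powr p * (1 - b) * cmod (1 - of_real b * z) powr (- (\<alpha> + 3))) * (1 - (cmod z)\<^sup>2) powr \<alpha>"
        by (intro mult_right_mono d) auto
      then show ?thesis using True b by (simp add: ennreal_mult[symmetric] ennreal_leI mult.assoc)
    qed simp
  qed simp
  also have "\<dots> = ennreal ((\<alpha> + 1) / pi) * (ennreal (\<eta> powr p * (1 - b)) * (\<integral>\<^sup>+ z. indicator (ball 0 1) z * ennreal (cmod (1 - of_real b * z) powr (- (\<alpha> + 3)) * (1 - (cmod z)\<^sup>2) powr \<alpha>) \<partial>lborel))"
  proof (subst nn_integral_cmult)
    have [measurable]: "ball (0::complex) 1 \<in> sets borel" by simp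
    show "(\<lambda>z. indicator (ball 0 1) z * ennreal (cmod (1 - of_real b * z) powr (- (\<alpha> + 3)) * (1 - (cmod z)\<^sup>2) powr \<alpha>)) \<in> borel_measurable lborel"
      by measurable
  qed simp
  also have "\<dots> \<le> ennreal ((\<alpha> + 1) / pi) * (ennreal (\<eta> powr p * (1 - b)) * ennreal (pi * 2 powr (\<alpha> + 2) / ((\<alpha> + 1) * (1 - b))))"
    using b \<alpha> by (intro mult_left_mono forelli_rudin_bound) auto
  also have "\<dots> = ennreal ((\<alpha> + 1) / pi * (\<eta> powr p * (1 - b) * (pi * 2 powr (\<alpha> + 2) / ((\<alpha> + 1) * (1 - b)))))"
  proof -
    have nn: "0 \<le> (\<alpha> + 1) / pi" "0 \<le> \<eta> powr p * (1 - b)" "0 \<le> pi * 2 powr (\<alpha> + 2) / ((\<alpha> + 1) * (1 - b))"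
      using b \<alpha> by auto
    show ?thesis unfolding ennreal_mult[OF nn(1) mult_nonneg_nonneg[OF nn(2,3)]] ennreal_mult[OF nn(2,3)] ..
  qed
  also have "(\<alpha> + 1) / pi * (\<eta> powr p * (1 - b) * (pi * 2 powr (\<alpha> + 2) / ((\<alpha> + 1) * (1 - b)))) = \<eta> powr p * 2 powr (\<alpha> + 2)"
    using b \<alpha> by simp
  finally show ?thesis by (simp add: \<eta>_def)
qed

subsection \<open>Necessity\<close>

context unit_interval_measure
begin

lemma test_fun_summable_moment:
  assumes b: "0 < b" "b < 1"
  shows "summable (\<lambda>k. cmod (taylor_coeff (test_fun s \<gamma> b) k) * moment k)"
proof -
  \<comment> \<open>The radius of convergence exceeds 1, so the coefficients are summable even without the moments.\<close>
  define R where "R = (1 + 1 / b) / 2"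
  have R: "1 < R" "R < 1 / b" using b by (auto simp: R_def field_simps)
  have "(\<lambda>k. (deriv ^^ k) (test_fun s \<gamma> b) 0 / fact k * (of_real R - 0) ^ k) sums test_fun s \<gamma> b (of_real R)"
    by (rule holomorphic_power_series[OF test_fun_holomorphic[OF b(1)]]) (use R in auto)
  then have "summable (\<lambda>k. taylor_coeff (test_fun s \<gamma> b) k * of_real R ^ k)"
    by (simp add: taylor_coeff_def sums_iff)
  then have "summable (\<lambda>k. cmod (taylor_coeff (test_fun s \<gamma> b) k * 1 ^ k))"
    by (rule powser_insidea) (use R in auto)
  then have s: "summable (\<lambda>k. cmod (taylor_coeff (test_fun s \<gamma> b) k) * moment 0)"
    by (intro summable_mult2) simp
  show ?thesis
    by (rule summable_comparison_test[OF _ s])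
       (use moment_antimono[of _ 0] moment_nonneg in \<open>auto intro!: mult_left_mono\<close>)
qed

text \<open>The first bound is a majorant independent of b, the second tends to 0 as b tends to 1
  with t fixed. Together they are the input of dominated convergence.\<close>

lemma norm_radial_test_fun_le:
  assumes b: "0 < b" "b < 1" and s: "s > 0" and \<gamma>: "\<gamma> > 0"
  shows "cmod (radial (test_fun s \<gamma> b) t) \<le> indicator {0..<1} t * (1 - t) powr (- \<gamma>)"
    and "cmod (radial (test_fun s \<gamma> b) t) \<le> (1 - b) powr s * (indicator {0..<1} t * (1 - t) powr (- (\<gamma> + s)))"
proof -
  have main: "cmod (test_fun s \<gamma> b (of_real t)) \<le> (1 - t) powr (- \<gamma>)"
    "cmod (test_fun s \<gamma> b (of_real t)) \<le> (1 - b) powr s * (1 - t) powr (- (\<gamma> + s))" if t: "0 \<le> t" "t < 1"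
  proof -
    have bt: "b * t \<le> b" "b * t \<le> t" using b t by (auto simp: mult_left_le mult_left_le_one_le)
    have "cmod (1 - of_real b * of_real t) = cmod (of_real (1 - b * t))" by simp
    also have "\<dots> = 1 - b * t" using bt b unfolding norm_of_real by simp
    finally have e: "cmod (test_fun s \<gamma> b (of_real t)) = (1 - b) powr s * (1 - b * t) powr (- (\<gamma> + s))"
      using norm_test_fun[of b "of_real t" s \<gamma>] b t by simp
    have "(1 - b * t) powr (- (\<gamma> + s)) \<le> (1 - t) powr (- (\<gamma> + s))"
      using bt t \<gamma> s by (intro powr_mono2') auto
    then show "cmod (test_fun s \<gamma> b (of_real t)) \<le> (1 - b) powr s * (1 - t) powr (- (\<gamma> + s))"
      unfolding e by (rule mult_left_mono) simp
    \<comment> \<open>The normalisation is absorbed by s powers of the kernel.\<close>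
    have "(1 - b) powr s \<le> (1 - b * t) powr s" using bt b s by (intro powr_mono2) auto
    then have "(1 - b) powr s * (1 - b * t) powr (- (\<gamma> + s)) \<le> (1 - b * t) powr s * (1 - b * t) powr (- (\<gamma> + s))"
      by (rule mult_right_mono) simp
    also have "\<dots> = (1 - b * t) powr (- \<gamma>)" by (simp flip: powr_add)
    also have "\<dots> \<le> (1 - t) powr (- \<gamma>)" using bt t \<gamma> by (intro powr_mono2') auto
    finally show "cmod (test_fun s \<gamma> b (of_real t)) \<le> (1 - t) powr (- \<gamma>)" unfolding e .
  qed
  show "cmod (radial (test_fun s \<gamma> b) t) \<le> indicator {0..<1} t * (1 - t) powr (- \<gamma>)"
    "cmod (radial (test_fun s \<gamma> b) t) \<le> (1 - b) powr s * (indicator {0..<1} t * (1 - t) powr (- (\<gamma> + s)))"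
    using main by (auto simp: radial_def indicator_def)
qed

lemma test_fun_integral_tendsto_zero:
  assumes s: "s > 0" and \<gamma>: "\<gamma> > 0" and b: "\<And>i. 0 < b i" "\<And>i. b i < 1" "b \<longlonglongrightarrow> 1"
    and fin: "(\<integral>\<^sup>+t. ennreal (indicator {0..<1} t * (1 - t) powr (- \<gamma>)) \<partial>\<mu>) < \<infinity>"
  shows "(\<lambda>i. \<integral>t. cmod (radial (test_fun s \<gamma> (b i)) t) \<partial>\<mu>) \<longlonglongrightarrow> 0"
proof -
  have hol: "test_fun s \<gamma> (b i) holomorphic_on ball 0 1" for i
    by (rule test_fun_holomorphic_unit_ball[OF b(1,2)])
  have [measurable]: "radial (test_fun s \<gamma> (b i)) \<in> borel_measurable \<mu>" for i by (rule radial_measurable[OF hol])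
  have "(\<lambda>i. \<integral>t. cmod (radial (test_fun s \<gamma> (b i)) t) \<partial>\<mu>) \<longlonglongrightarrow> (\<integral>t. 0 \<partial>\<mu>)"
  proof (rule integral_dominated_convergence[where w="\<lambda>t. indicator {0..<1} t * (1 - t) powr (- \<gamma>)"])
    show "integrable \<mu> (\<lambda>t. indicator {0..<1} t * (1 - t) powr (- \<gamma>))"
      by (rule integrableI_nonneg) (use fin in auto)
    show "AE t in \<mu>. (\<lambda>i. cmod (radial (test_fun s \<gamma> (b i)) t)) \<longlonglongrightarrow> 0"
    proof (rule AE_I2)
      fix t
      have "(\<lambda>i. 1 - b i) \<longlonglongrightarrow> 1 - 1" by (intro tendsto_intros b(3))
      then have "(\<lambda>i. (1 - b i) powr s) \<longlonglongrightarrow> 0 powr s"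
        by (intro tendsto_powr2 tendsto_const) (use b s in \<open>auto intro!: always_eventually less_imp_le\<close>)
      then have "(\<lambda>i. (1 - b i) powr s * (indicator {0..<1} t * (1 - t) powr (- (\<gamma> + s)))) \<longlonglongrightarrow> 0"
        using s by (intro tendsto_mult_left_zero) simp
      then show "(\<lambda>i. cmod (radial (test_fun s \<gamma> (b i)) t)) \<longlonglongrightarrow> 0"
        by (rule Lim_null_comparison[rotated]) (use norm_radial_test_fun_le(2)[OF b(1,2) s \<gamma>] in auto)
    qed
    show "AE t in \<mu>. norm (cmod (radial (test_fun s \<gamma> (b i)) t)) \<le> indicator {0..<1} t * (1 - t) powr (- \<gamma>)" for i
      using norm_radial_test_fun_le(1)[OF b(1,2) s \<gamma>] by (intro AE_I2) simp
  qed measurable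
  then show ?thesis by simp
qed

text \<open>A crude bound from |1 - t z| \<ge> 1 - |z|. It is used at fixed z, for pointwise
  convergence.\<close>

lemma deriv_Hilbert_op_le:
  assumes f: "f holomorphic_on ball 0 1" and S: "summable (\<lambda>k. cmod (taylor_coeff f k) * moment k)" and \<beta>: "\<beta> > 0"
    and z: "z \<in> ball 0 1"
  shows "cmod (deriv (Hilbert_op \<mu> \<beta> f) z) \<le> \<beta> * (1 - cmod z) powr (- (\<beta> + 1)) * (\<integral>t. cmod (radial f t) \<partial>\<mu>)"
proof -
  note H = Hilbert_op_integral[OF f S \<beta>]
  have cz: "cmod z < 1" using z by simp
  have "cmod (\<integral>t. of_real t * radial f t * (1 - of_real t * z) powr (- of_real (\<beta> + 1)) \<partial>\<mu>)
    \<le> (\<integral>t. (1 - cmod z) powr (- (\<beta> + 1)) * cmod (radial f t) \<partial>\<mu>)"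
  proof (rule order_trans[OF integral_norm_bound integral_mono'])
    show "integrable \<mu> (\<lambda>t. (1 - cmod z) powr (- (\<beta> + 1)) * cmod (radial f t))"
      by (intro integrable_mult_right integrable_norm H)
    fix t
    show "norm (of_real t * radial f t * (1 - of_real t * z) powr (- of_real (\<beta> + 1)))
        \<le> (1 - cmod z) powr (- (\<beta> + 1)) * cmod (radial f t)"
    proof (cases "t \<in> {0..<1}")
      case True
      have "t * cmod z \<le> cmod z" using True by (simp add: mult_left_le_one_le)
      then have le: "1 - cmod z \<le> cmod (1 - of_real t * z)"
        using norm_triangle_ineq2[of 1 "of_real t * z"] True by (simp add: norm_mult)
      have "norm (of_real t * radial f t * (1 - of_real t * z) powr (- of_real (\<beta> + 1)))
          = t * cmod (radial f t) * cmod (1 - of_real t * z) powr (- (\<beta> + 1))"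
        using norm_kernel[of t z "\<beta> + 1"] True cz by (simp add: norm_mult)
      also have "\<dots> \<le> 1 * cmod (radial f t) * (1 - cmod z) powr (- (\<beta> + 1))"
        using True le cz \<beta> by (intro mult_mono powr_mono2') auto
      finally show ?thesis by (simp add: mult.commute)
    qed (simp add: radial_def)
  qed simp
  then have "\<beta> * cmod (\<integral>t. of_real t * radial f t * (1 - of_real t * z) powr (- of_real (\<beta> + 1)) \<partial>\<mu>)
    \<le> \<beta> * ((1 - cmod z) powr (- (\<beta> + 1)) * (\<integral>t. cmod (radial f t) \<partial>\<mu>))"
    using \<beta> by (intro mult_left_mono) auto
  then show ?thesis using H(6)[OF z] \<beta> by (simp add: norm_mult mult.assoc)
qed

text \<open>At z = b the integrand is real and nonnegative, so nothing cancels and the integral may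
  be cut down to [b, 1). There 1 - b t \<le> 2 (1 - b), and t \<ge> 1/2 gives the factor
  1/2.\<close>

lemma deriv_Hilbert_op_test_fun_ge:
  assumes b: "1/2 \<le> b" "b < 1" and \<beta>: "\<beta> > 0" and s: "s > 0" and \<gamma>: "\<gamma> > 0"
  shows "cmod (deriv (Hilbert_op \<mu> \<beta> (test_fun s \<gamma> b)) (of_real b)) \<ge>
    \<beta> / 2 * 2 powr (- (\<gamma> + s + \<beta> + 1)) * (1 - b) powr (- (\<gamma> + \<beta> + 1)) * measure \<mu> {b..<1}"
proof -
  have b0: "0 < b" "0 \<le> b" using b by auto
  have hol: "test_fun s \<gamma> b holomorphic_on ball 0 1"
    by (rule test_fun_holomorphic_unit_ball[OF b0(1) b(2)])
  note H = Hilbert_op_integral[OF hol test_fun_summable_moment[OF b0(1) b(2)] \<beta>]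
  define G where "G = (\<lambda>t. indicator {0..<1} t * (t * ((1 - b) powr s * (1 - b * t) powr (- (\<gamma> + s)) * (1 - b * t) powr (- (\<beta> + 1)))))"
  have bt: "b * t \<le> b" "b * t < 1" if "0 \<le> t" "t < 1" for t
  proof -
    show "b * t \<le> b" using that b0 by (simp add: mult_left_le)
    then show "b * t < 1" using b by linarith
  qed
  have eq: "of_real t * radial (test_fun s \<gamma> b) t * (1 - of_real t * of_real b) powr (- of_real (\<beta> + 1)) = complex_of_real (G t)" for t
  proof (cases "t \<in> {0..<1}")
    case True
    have pr: "(1 - complex_of_real b * of_real t) powr (- of_real c) = of_real ((1 - b * t) powr (- c))" for c
      using powr_of_real[of "1 - b * t" "- c"] bt[of t] True by simp
    have "of_real t * complex_of_real b = of_real b * of_real t" by (rule mult.commute)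
    then have "of_real t * radial (test_fun s \<gamma> b) t * (1 - of_real t * of_real b) powr (- of_real (\<beta> + 1))
       = of_real t * (of_real ((1 - b) powr s) * of_real ((1 - b * t) powr (- (\<gamma> + s)))) * of_real ((1 - b * t) powr (- (\<beta> + 1)))"
      using True by (simp only: radial_def test_fun_def pr indicator_simps scaleR_one)
    then show ?thesis using True by (simp add: G_def mult.assoc)
  qed (simp add: radial_def G_def)
  have d: "deriv (Hilbert_op \<mu> \<beta> (test_fun s \<gamma> b)) (of_real b) = of_real (\<beta> * (\<integral>t. G t \<partial>\<mu>))"
    using H(6)[of "of_real b"] b b0 unfolding eq by simp
  have G0: "G t \<ge> 0" for t by (simp add: G_def indicator_def)
  have Gm[measurable]: "G \<in> borel_measurable \<mu>" unfolding G_def by measurable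
  have Gi: "integrable \<mu> G"
  proof (rule integrable_const_bound[where B="(1 - b) powr s * (1 - b) powr (- (\<gamma> + s)) * (1 - b) powr (- (\<beta> + 1))"])
    show "AE t in \<mu>. norm (G t) \<le> (1 - b) powr s * (1 - b) powr (- (\<gamma> + s)) * (1 - b) powr (- (\<beta> + 1))"
    proof (rule AE_I2)
      fix t
      show "norm (G t) \<le> (1 - b) powr s * (1 - b) powr (- (\<gamma> + s)) * (1 - b) powr (- (\<beta> + 1))"
      proof (cases "t \<in> {0..<1}")
        case True
        have p: "(1 - b * t) powr (- c) \<le> (1 - b) powr (- c)" if "c > 0" for c
          using bt[of t] True b that by (intro powr_mono2') auto
        have "norm (G t) = t * ((1 - b) powr s * (1 - b * t) powr (- (\<gamma> + s)) * (1 - b * t) powr (- (\<beta> + 1)))"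
          using G0[of t] True by (simp add: G_def)
        also have "\<dots> \<le> 1 * ((1 - b) powr s * (1 - b) powr (- (\<gamma> + s)) * (1 - b) powr (- (\<beta> + 1)))"
          using True \<gamma> s \<beta> by (intro mult_mono p) auto
        finally show ?thesis by simp
      qed (simp add: G_def)
    qed
  qed (rule Gm)
  define c where "c = 1 / 2 * 2 powr (- (\<gamma> + s + \<beta> + 1)) * (1 - b) powr (- (\<gamma> + \<beta> + 1))"
  have "(\<integral>t. c * indicator {b..<1} t \<partial>\<mu>) \<le> (\<integral>t. G t \<partial>\<mu>)"
  proof (rule integral_mono'[OF Gi])
    fix t
    show "c * indicator {b..<1} t \<le> G t"
    proof (cases "t \<in> {b..<1}")
      case True
      then have t: "b \<le> t" "t < 1" "0 \<le> t" using b by auto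
      have "b * b \<le> b * t" using t b0 by (intro mult_left_mono) auto
      moreover have "1 - b * b \<le> 2 * (1 - b)"
        using zero_le_square[of "1 - b"] by (simp add: algebra_simps)
      ultimately have le: "1 - b * t \<le> 2 * (1 - b)" by linarith
      have p: "(1 - b * t) powr (- c) \<ge> 2 powr (- c) * (1 - b) powr (- c)" if "c > 0" for c
      proof -
        have "(2 * (1 - b)) powr (- c) \<le> (1 - b * t) powr (- c)"
          using le bt[OF t(3,2)] that by (intro powr_mono2') auto
        then show ?thesis by (simp only: powr_mult)
      qed
      have "c = 1 / 2 * ((1 - b) powr s * (2 powr (- (\<gamma> + s)) * (1 - b) powr (- (\<gamma> + s))) * (2 powr (- (\<beta> + 1)) * (1 - b) powr (- (\<beta> + 1))))"
      proof -
        have "2 powr (- (\<gamma> + s + \<beta> + 1)) = 2 powr (- (\<gamma> + s)) * 2 powr (- (\<beta> + 1))"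
          "(1 - b) powr (- (\<gamma> + \<beta> + 1)) = (1 - b) powr s * (1 - b) powr (- (\<gamma> + s)) * (1 - b) powr (- (\<beta> + 1))"
          unfolding powr_add[symmetric] by (rule arg_cong[where f="(powr) _"], simp)+
        then show ?thesis by (simp only: c_def mult_ac)
      qed
      also have "\<dots> \<le> t * ((1 - b) powr s * (1 - b * t) powr (- (\<gamma> + s)) * (1 - b * t) powr (- (\<beta> + 1)))"
        using t b \<gamma> s \<beta> by (intro mult_mono p) auto
      also have "\<dots> = G t" using t by (simp add: G_def)
      finally show ?thesis using True by simp
    qed (use G0 in simp)
  qed (rule G0)
  then have "c * measure \<mu> {b..<1} \<le> (\<integral>t. G t \<partial>\<mu>)" by simp
  then have "\<beta> * (c * measure \<mu> {b..<1}) \<le> \<beta> * (\<integral>t. G t \<partial>\<mu>)" using \<beta> by (intro mult_left_mono) auto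
  also have "\<dots> \<le> \<bar>\<beta> * (\<integral>t. G t \<partial>\<mu>)\<bar>" by simp
  finally show ?thesis unfolding d norm_of_real by (simp add: c_def mult_ac)
qed

text \<open>The negated conclusion yields one sequence b i tending to 1 with too much mass near 1.
  Every subsequence keeps this property, which suits the subsequence that compactness
  provides.\<close>

lemma vanishing_if_Hilbert_compact:
  fixes p q \<alpha> \<beta> :: real
  assumes q: "q > 1" and p: "p > 0" and \<alpha>: "\<alpha> > p - 1" and \<beta>: "\<beta> > 0"
    and fin: "(\<integral>\<^sup>+t. ennreal (indicator {0..<1} t * (1 - t) powr (- ((\<alpha> + 2) / p - 1))) \<partial>\<mu>) < \<infinity>"
    and compact: "Hilbert_compact \<mu> \<beta> p \<alpha> q (\<beta> - 1)"
  shows "vanishing_carleson \<mu> ((\<alpha> + 2) / p - 1 + (\<beta> + 1) * (1 - 1 / q))"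
proof (rule ccontr)
  define \<gamma> where "\<gamma> = (\<alpha> + 2) / p - 1"
  define N where "N = \<gamma> + (\<beta> + 1) * (1 - 1 / q)"
  define s where "s = 1 / p"
  have a1: "\<alpha> > -1" using \<alpha> p by simp
  have b1: "\<beta> - 1 > -1" using \<beta> by simp
  have \<gamma>: "\<gamma> > 0" using \<alpha> p by (simp add: \<gamma>_def field_simps)
  have s: "s > 0" using p by (simp add: s_def)
  assume "\<not> vanishing_carleson \<mu> ((\<alpha> + 2) / p - 1 + (\<beta> + 1) * (1 - 1 / q))"
  then obtain e where e: "e > 0" "\<And>d. d > 0 \<Longrightarrow> \<exists>t. 1 - d < t \<and> t < 1 \<and> \<not> emeasure \<mu> {t..<1} \<le> ennreal (e * (1 - t) powr N)"
    unfolding vanishing_carleson_def N_def \<gamma>_def by blast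
  \<comment> \<open>The offset 2 forces b i > 1/2 already at i = 0, as the lower bound for the image
    requires.\<close>
  have "\<forall>i::nat. \<exists>t. 1 - 1 / real (i + 2) < t \<and> t < 1 \<and> \<not> emeasure \<mu> {t..<1} \<le> ennreal (e * (1 - t) powr N)"
    by (intro allI e(2)) simp
  then obtain b where b: "\<And>i. 1 - 1 / real (i + 2) < b i" "\<And>i. b i < 1"
      "\<And>i. \<not> emeasure \<mu> {b i..<1} \<le> ennreal (e * (1 - b i) powr N)"
    by metis
  have bh: "1 / 2 \<le> b i" for i
  proof -
    have "1 / real (i + 2) \<le> 1 / 2" by (simp add: field_simps)
    then show ?thesis using b(1)[of i] by linarith
  qed
  then have b0: "0 < b i" for i by (metis half_gt_zero_iff less_le_trans zero_less_one)
  have blim: "b \<longlonglongrightarrow> 1"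
  proof (rule tendsto_sandwich[of "\<lambda>i. 1 - 1 / real (i + 2)" _ _ "\<lambda>_. 1"])
    show "(\<lambda>i. 1 - 1 / real (i + 2)) \<longlonglongrightarrow> 1" using tendsto_diff[OF tendsto_const LIMSEQ_ignore_initial_segment[OF lim_1_over_n, of 2]] by simp
  qed (use b in \<open>auto intro!: always_eventually less_imp_le\<close>)
  have meas: "e * (1 - b i) powr N < measure \<mu> {b i..<1}" for i
    using b(3)[of i] e(1) by (simp add: emeasure_eq_measure not_le ennreal_less_iff)
  define F where "F = (\<lambda>i. test_fun s \<gamma> (b i))"
  have Fh: "F i holomorphic_on ball 0 1" for i
    unfolding F_def by (rule test_fun_holomorphic_unit_ball[OF b0 b(2)])
  define A where "A = (\<gamma> + 1 / p) powr p * 2 powr (\<alpha> + 2)"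
  have FA: "A_int p \<alpha> (deriv (F i)) \<le> ennreal A" for i
    unfolding F_def A_def s_def by (rule test_fun_A_int[OF p a1 b0 b(2) \<gamma>_def \<gamma>])
  have FD: "in_Dirichlet p \<alpha> (F i)" for i using Fh FA[of i] by (auto simp: in_Dirichlet_def intro: le_less_trans)
  have FN: "Dirichlet_norm p \<alpha> (F i) \<le> 1 + A powr (1 / p)" for i
  proof -
    have "cmod (F i 0) = (1 - b i) powr s" using norm_test_fun[of "b i" 0 s \<gamma>] b0[of i] b(2)[of i] by (simp add: F_def)
    also have "\<dots> \<le> 1" using b0[of i] b(2)[of i] s by (intro powr_le1) auto
    finally have "cmod (F i 0) \<le> 1" .
    moreover have "enn2real (A_int p \<alpha> (deriv (F i))) \<le> A" using FA by (intro enn2real_leI) (auto simp: A_def)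
    ultimately show ?thesis unfolding Dirichlet_norm_def using p by (intro add_mono powr_mono2) auto
  qed
  have S: "summable (\<lambda>k. cmod (taylor_coeff (F i) k) * moment k)" for i
    unfolding F_def by (rule test_fun_summable_moment[OF b0 b(2)])
  obtain r g where rg: "strict_mono r" "in_Dirichlet q (\<beta> - 1) g"
      "(\<lambda>i. Dirichlet_norm q (\<beta> - 1) (\<lambda>z. Hilbert_op \<mu> \<beta> (F (r i)) z - g z)) \<longlonglongrightarrow> 0"
    using compact FD FN unfolding Hilbert_compact_def by blast
  define h where "h = (\<lambda>i. deriv (\<lambda>z. Hilbert_op \<mu> \<beta> (F (r i)) z - g z))"
  define D where "D = (\<lambda>i. Dirichlet_norm q (\<beta> - 1) (\<lambda>z. Hilbert_op \<mu> \<beta> (F (r i)) z - g z))"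
  have HD: "in_Dirichlet q (\<beta> - 1) (Hilbert_op \<mu> \<beta> (F i))" for i
    using compact FD by (auto simp: Hilbert_compact_def Hilbert_maps_def)
  have Hh: "Hilbert_op \<mu> \<beta> (F i) holomorphic_on ball 0 1" "A_int q (\<beta> - 1) (deriv (Hilbert_op \<mu> \<beta> (F i))) < \<infinity>" for i
    using HD by (auto simp: in_Dirichlet_def)
  have gh: "g holomorphic_on ball 0 1" "A_int q (\<beta> - 1) (deriv g) < \<infinity>" using rg(2) by (auto simp: in_Dirichlet_def)
  have dh: "deriv (Hilbert_op \<mu> \<beta> (F i)) holomorphic_on ball 0 1" "deriv g holomorphic_on ball 0 1" for i
    by (intro holomorphic_deriv Hh gh; simp)+
  have hd: "h i z = deriv (Hilbert_op \<mu> \<beta> (F (r i))) z - deriv g z" if "z \<in> ball 0 1" for i z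
    unfolding h_def using that Hh(1)[of "r i"] gh(1)
    by (intro deriv_diff) (auto simp: holomorphic_on_open field_differentiable_def)
  have hh: "h i holomorphic_on ball 0 1" for i
    unfolding h_def by (intro holomorphic_deriv holomorphic_intros Hh gh) auto
  \<comment> \<open>Finiteness matters: \<open>enn2real\<close> would turn an infinite integral into
    0, and D i would control nothing.\<close>
  have hfin: "A_int q (\<beta> - 1) (h i) < \<infinity>" for i
  proof -
    have "A_int q (\<beta> - 1) (h i) = A_int q (\<beta> - 1) (\<lambda>z. deriv (Hilbert_op \<mu> \<beta> (F (r i))) z - deriv g z)"
      by (rule A_int_cong) (rule hd)
    also have "\<dots> \<le> ennreal (2 powr q) * (A_int q (\<beta> - 1) (deriv (Hilbert_op \<mu> \<beta> (F (r i)))) + A_int q (\<beta> - 1) (deriv g))"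
      by (rule A_int_diff_le[OF b1 _ dh]) (use q in simp)
    also have "\<dots> < \<infinity>" using Hh(2)[of "r i"] gh(2) by (simp add: ennreal_mult_less_top)
    finally show ?thesis .
  qed
  have q0: "q > 0" using q by simp
  obtain C where C: "C > 0" "\<And>h z. h holomorphic_on ball 0 1 \<Longrightarrow> z \<in> ball 0 1 \<Longrightarrow>
      ennreal (cmod (h z) powr q * (1 - cmod z) powr (\<beta> - 1 + 2)) \<le> ennreal C * A_int q (\<beta> - 1) h"
    by (rule growth_estimate[OF q0 b1]) (rule that)
  have growth: "cmod (h i z) * (1 - cmod z) powr ((\<beta> + 1) / q) \<le> C powr (1 / q) * D i" if z: "z \<in> ball 0 1" for i z
  proof -
    obtain a where a: "A_int q (\<beta> - 1) (h i) = ennreal a" "a \<ge> 0" using hfin[of i] by (cases "A_int q (\<beta> - 1) (h i)") auto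
    have "a powr (1 / q) \<le> D i" unfolding D_def Dirichlet_norm_def a(1)[unfolded h_def] using a(2) by simp
    have "ennreal (cmod (h i z) powr q * (1 - cmod z) powr (\<beta> - 1 + 2)) \<le> ennreal (C * a)"
      using C(2)[OF hh z, of i] a C(1) by (simp add: ennreal_mult)
    then have "cmod (h i z) powr q * (1 - cmod z) powr (\<beta> + 1) \<le> C * a"
      using C(1) a by (subst (asm) ennreal_le_iff) (auto simp: add.commute)
    then have "(cmod (h i z) powr q * (1 - cmod z) powr (\<beta> + 1)) powr (1 / q) \<le> (C * a) powr (1 / q)"
      using q by (intro powr_mono2) auto
    then have "cmod (h i z) * (1 - cmod z) powr ((\<beta> + 1) / q) \<le> C powr (1 / q) * a powr (1 / q)"
      using q by (simp add: powr_mult powr_powr)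
    also have "\<dots> \<le> C powr (1 / q) * D i" by (intro mult_left_mono \<open>a powr (1 / q) \<le> D i\<close>) simp
    finally show ?thesis .
  qed
  have D0: "D \<longlonglongrightarrow> 0" using rg(3) by (simp add: D_def)
  have Ilim: "(\<lambda>i. \<integral>t. cmod (radial (F i) t) \<partial>\<mu>) \<longlonglongrightarrow> 0"
    unfolding F_def by (rule test_fun_integral_tendsto_zero[OF s \<gamma> b0 b(2) blim]) (use fin in \<open>simp add: \<gamma>_def\<close>)
  \<comment> \<open>Norm convergence makes the derivatives of the images tend to that of g, the
    integral bound makes them tend to 0. So g is constant and the lower bound applies to h
    itself.\<close>
  have g0: "deriv g z = 0" if z: "z \<in> ball 0 1" for z
  proof -
    have w: "(1 - cmod z) powr ((\<beta> + 1) / q) > 0" using z by simp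
    have "(\<lambda>i. C powr (1 / q) * D i / (1 - cmod z) powr ((\<beta> + 1) / q)) \<longlonglongrightarrow> 0"
      by (intro tendsto_divide_zero tendsto_mult_right_zero D0)
    then have "(\<lambda>i. h i z) \<longlonglongrightarrow> 0"
      by (rule Lim_null_comparison[rotated]) (use growth[OF z] w in \<open>auto simp: field_simps\<close>)
    moreover have "(\<lambda>i. deriv (Hilbert_op \<mu> \<beta> (F (r i))) z) \<longlonglongrightarrow> 0"
    proof (rule Lim_null_comparison)
      show "\<forall>\<^sub>F i in sequentially. cmod (deriv (Hilbert_op \<mu> \<beta> (F (r i))) z) \<le> \<beta> * (1 - cmod z) powr (- (\<beta> + 1)) * (\<integral>t. cmod (radial (F (r i)) t) \<partial>\<mu>)"
        by (intro always_eventually allI deriv_Hilbert_op_le[OF Fh S \<beta> z])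
      show "(\<lambda>i. \<beta> * (1 - cmod z) powr (- (\<beta> + 1)) * (\<integral>t. cmod (radial (F (r i)) t) \<partial>\<mu>)) \<longlonglongrightarrow> 0"
        using LIMSEQ_subseq_LIMSEQ[OF Ilim rg(1)] by (intro tendsto_mult_right_zero) (simp add: o_def)
    qed
    ultimately have "(\<lambda>i. deriv (Hilbert_op \<mu> \<beta> (F (r i))) z - h i z) \<longlonglongrightarrow> 0 - 0" by (rule tendsto_diff[rotated])
    then have "(\<lambda>i::nat. deriv g z) \<longlonglongrightarrow> 0" using hd[OF z] by simp
    then show ?thesis by (simp add: LIMSEQ_const_iff)
  qed
  define c where "c = \<beta> / 2 * 2 powr (- (\<gamma> + s + \<beta> + 1))"
  have c: "c > 0" using \<beta> by (simp add: c_def)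
  have low: "c * e \<le> C powr (1 / q) * D i" for i
  proof -
    define x where "x = b (r i)"
    have x: "1 / 2 \<le> x" "x < 1" "0 < x" using bh b(2) b0 by (auto simp: x_def)
    have xb: "complex_of_real x \<in> ball 0 1" using x by simp
    have cx: "cmod (complex_of_real x) = x" using x by simp
    have hx: "h i (of_real x) = deriv (Hilbert_op \<mu> \<beta> (test_fun s \<gamma> x)) (of_real x)"
      using hd[OF xb, of i] g0[OF xb] by (simp add: F_def x_def)
    \<comment> \<open>The value of N is the one for which all powers of 1 - x cancel, which leaves a
      lower bound free of x.\<close>
    have ex: "(1 - x) powr N * ((1 - x) powr (- (\<gamma> + \<beta> + 1)) * (1 - x) powr ((\<beta> + 1) / q)) = 1"
    proof -
      have "N + (- (\<gamma> + \<beta> + 1) + (\<beta> + 1) / q) = 0" by (simp add: N_def algebra_simps add_divide_distrib)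
      then show ?thesis using x unfolding powr_add[symmetric] by simp
    qed
    have "c * e = c * (e * (1 - x) powr N) * ((1 - x) powr (- (\<gamma> + \<beta> + 1)) * (1 - x) powr ((\<beta> + 1) / q))"
      using ex by (simp add: mult.assoc)
    also have "\<dots> \<le> c * measure \<mu> {x..<1} * ((1 - x) powr (- (\<gamma> + \<beta> + 1)) * (1 - x) powr ((\<beta> + 1) / q))"
      using meas[of "r i"] c by (intro mult_right_mono mult_left_mono) (auto simp: x_def)
    also have "\<dots> = (c * (1 - x) powr (- (\<gamma> + \<beta> + 1)) * measure \<mu> {x..<1}) * (1 - x) powr ((\<beta> + 1) / q)" by (simp add: mult_ac)
    also have "\<dots> \<le> cmod (h i (of_real x)) * (1 - x) powr ((\<beta> + 1) / q)"
      unfolding hx c_def by (intro mult_right_mono deriv_Hilbert_op_test_fun_ge[OF x(1,2) \<beta> s \<gamma>]) auto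
    also have "\<dots> \<le> C powr (1 / q) * D i" using growth[OF xb, of i] by (simp only: cx)
    finally show ?thesis .
  qed
  have "(\<lambda>i. C powr (1 / q) * D i) \<longlonglongrightarrow> 0" by (intro tendsto_mult_right_zero D0)
  then have "c * e \<le> 0" by (rule LIMSEQ_le_const) (use low in auto)
  moreover have "c * e > 0" using c e(1) by simp
  ultimately show False by simp
qed

section \<open>Carleson conditions in terms of dyadic masses\<close>

lemma mass_bound_of_carleson:
  assumes "carleson \<mu> s"
  obtains K where "\<And>k. mass k \<le> K * (2 powr (- s)) ^ k"
proof -
  obtain C where C: "\<And>t. t \<in> {0..<1} \<Longrightarrow> emeasure \<mu> {t..<1} \<le> ennreal (C * (1 - t) powr s)"
    using assms unfolding carleson_def by blast
  show ?thesis
  proof (rule that[of "max C 0"])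
    fix k
    have "ennreal (mass k) \<le> ennreal (C * (1 - dpt k) powr s)"
      using C[of "dpt k"] dpt_simps(4,5)[of k] by (simp add: mass_def emeasure_eq_measure)
    \<comment> \<open>The definition of \<open>carleson\<close> permits a negative C, for which
      \<open>ennreal\<close> clips the bound to 0.\<close>
    also have "\<dots> \<le> ennreal (max C 0 * (1 - dpt k) powr s)" by (intro ennreal_leI mult_right_mono) auto
    also have "(1 - dpt k) powr s = (2 powr (- s)) ^ k"
      by (simp add: dpt_def dyadic_powr half_powr)
    finally show "mass k \<le> max C 0 * (2 powr (- s)) ^ k" by (subst (asm) ennreal_le_iff) auto
  qed
qed

lemma mass_decay_of_vanishing_carleson:
  assumes v: "vanishing_carleson \<mu> s" and N: "N \<le> s"
  shows "(\<lambda>k. mass k * (2 powr N) ^ k) \<longlonglongrightarrow> 0"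
proof (rule tendstoI)
  fix e :: real assume e: "e > 0"
  then obtain d where d: "d > 0" "\<And>t. 1 - d < t \<Longrightarrow> t < 1 \<Longrightarrow> emeasure \<mu> {t..<1} \<le> ennreal (e / 2 * (1 - t) powr s)"
    using v half_gt_zero[OF e] unfolding vanishing_carleson_def by metis
  have "(\<lambda>k. (1/2::real) ^ k) \<longlonglongrightarrow> 0" by (intro LIMSEQ_power_zero) simp
  then have "\<forall>\<^sub>F k in sequentially. (1/2::real) ^ k < d" using d(1) by (rule order_tendstoD)
  then show "\<forall>\<^sub>F k in sequentially. dist (mass k * (2 powr N) ^ k) 0 < e"
  proof eventually_elim
    case (elim k)
    have "ennreal (mass k) \<le> ennreal (e / 2 * (1 - dpt k) powr s)"
      using d(2)[of "dpt k"] elim dpt_simps(5)[of k] by (simp add: mass_def emeasure_eq_measure dpt_def)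
    then have "mass k \<le> e / 2 * (1 - dpt k) powr s" using e by (subst (asm) ennreal_le_iff) auto
    also have "\<dots> \<le> e / 2 * (1 - dpt k) powr N"
      using e dpt_simps(4,5)[of k] N by (intro mult_left_mono powr_mono') auto
    also have "(1 - dpt k) powr N = (2 powr (- N)) ^ k" by (simp add: dpt_def dyadic_powr half_powr)
    finally have "mass k * (2 powr N) ^ k \<le> e / 2 * (2 powr (- N)) ^ k * (2 powr N) ^ k" by (rule mult_right_mono) simp
    also have "\<dots> = e / 2" unfolding mult.assoc power_mult_distrib[symmetric] powr_add[symmetric] by simp
    finally show ?case using e by (simp add: mass_def)
  qed
qed

end

text \<open>The margin above \<gamma> = (\<alpha> + 2)/p - 1 is 1, 1 - (p - 1)^2/p or 1 - 1/p in the
  three ranges. It is strictness that makes \<open>(1 - t) powr (-\<gamma>)\<close>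
  integrable.\<close>

lemma cond_W_carleson:
  assumes "cond_W p \<alpha> \<mu>" "p > 0"
  obtains s where "s > (\<alpha> + 2) / p - 1" "carleson \<mu> s"
proof -
  consider "p \<le> 1" | "1 \<le> p" "p \<le> 2" | "2 \<le> p" by linarith
  then show thesis
  proof cases
    case 1
    then show ?thesis using that[of "(\<alpha> + 2) / p"] assms by (simp add: cond_W_def)
  next
    case 2
    have "(p - 1)\<^sup>2 \<le> 1 * (p - 1)" unfolding power2_eq_square using 2 by (intro mult_right_mono) auto
    then have "(p - 1)\<^sup>2 < p" by simp
    then have "(p - 1)\<^sup>2 / p < 1" using assms(2) by simp
    then show ?thesis using that[of "(\<alpha> + 2 - (p - 1)\<^sup>2) / p"] assms 2 by (simp add: cond_W_def diff_divide_distrib)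
  next
    case 3
    have "(\<alpha> + 2) / p - 1 < (\<alpha> + 1) / p" using 3 by (simp add: field_simps)
    then show ?thesis using that[of "(\<alpha> + 1) / p"] assms 3 by (simp add: cond_W_def)
  qed
qed

lemma carleson_finite_measure:
  assumes "sets \<mu> = sets borel" "emeasure \<mu> (UNIV - {0..<1}) = 0" "carleson \<mu> s"
  shows "unit_interval_measure \<mu>"
proof -
  have sp: "space \<mu> = UNIV" using sets_eq_imp_space_eq[OF assms(1)] by simp
  obtain C where "emeasure \<mu> {0..<1} \<le> ennreal (C * (1 - 0) powr s)"
    using assms(3) unfolding carleson_def by force
  \<comment> \<open>The Carleson bound at t = 0 covers the whole interval; finiteness of \<mu> comes
    from here.\<close>
  then have f: "emeasure \<mu> {0..<1} < \<infinity>" using le_less_trans ennreal_less_top by fastforce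
  have "emeasure \<mu> UNIV = emeasure \<mu> ({0..<1} \<union> (UNIV - {0..<1}))" by simp
  also have "\<dots> \<le> emeasure \<mu> {0..<1} + emeasure \<mu> (UNIV - {0..<1})"
    by (rule emeasure_subadditive) (auto simp: assms(1))
  finally have "emeasure \<mu> (space \<mu>) \<noteq> \<infinity>" using f assms(2) sp by auto
  then show ?thesis
    by (intro unit_interval_measure.intro unit_interval_measure_axioms.intro finite_measureI assms)
qed

theorem theorem5p3:
  fixes \<mu> :: "real measure" and p q \<alpha> \<beta> :: real
  assumes "q > 1" and "0 < p" and "p \<le> q" and "\<alpha> > p - 1" and "\<beta> > q"
    and "sets \<mu> = sets borel" and "emeasure \<mu> (UNIV - {0..<1}) = 0"
    and "cond_W p \<alpha> \<mu>"
  shows "(Hilbert_compact \<mu> \<beta> p \<alpha> q (\<beta> - 1) \<longrightarrow>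
            vanishing_carleson \<mu> ((\<alpha> + 2) / p + (\<beta> + 1) / (q / (q - 1)) - 1))
       \<and> (vanishing_carleson \<mu> (max (\<alpha> + 2 - p) (\<beta> + 1) * (1 / p + 1 / (q / (q - 1)))) \<longrightarrow>
            Hilbert_compact \<mu> \<beta> p \<alpha> q (\<beta> - 1))"
proof -
  obtain s where s: "s > (\<alpha> + 2) / p - 1" "carleson \<mu> s" using cond_W_carleson[OF assms(8,2)] by blast
  interpret unit_interval_measure \<mu> by (rule carleson_finite_measure[OF assms(6,7) s(2)])
  \<comment> \<open>\<open>q / (q - 1)\<close> is the conjugate exponent q'.\<close>
  have conj: "1 / (q / (q - 1)) = 1 - 1 / q" "(\<beta> + 1) / (q / (q - 1)) = (\<beta> + 1) * (1 - 1 / q)"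
    using assms(1) by (simp_all add: field_simps)
  have \<gamma>: "(\<alpha> + 2) / p - 1 > 0" using assms(2,4) by (simp add: field_simps)
  obtain K where K: "\<And>k. mass k \<le> K * (2 powr (- s)) ^ k" by (rule mass_bound_of_carleson[OF s(2)]) (rule that)
  obtain A where "(\<integral>\<^sup>+t. ennreal (indicator {0..<1} t * (1 - t) powr (- ((\<alpha> + 2) / p - 1))) \<partial>\<mu>) \<le> ennreal A"
    by (rule nn_integral_singular_finite[OF K less_imp_le[OF \<gamma>] s(1)]) (rule that)
  then have fin: "(\<integral>\<^sup>+t. ennreal (indicator {0..<1} t * (1 - t) powr (- ((\<alpha> + 2) / p - 1))) \<partial>\<mu>) < \<infinity>"
    by (rule le_less_trans) simp
  have i: "vanishing_carleson \<mu> ((\<alpha> + 2) / p + (\<beta> + 1) / (q / (q - 1)) - 1)" if "Hilbert_compact \<mu> \<beta> p \<alpha> q (\<beta> - 1)"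
  proof -
    have "vanishing_carleson \<mu> ((\<alpha> + 2) / p - 1 + (\<beta> + 1) * (1 - 1 / q))"
      by (rule vanishing_if_Hilbert_compact[OF assms(1,2,4) _ fin that]) (use assms(1,5) in simp)
    moreover have "(\<alpha> + 2) / p - 1 + (\<beta> + 1) * (1 - 1 / q) = (\<alpha> + 2) / p + (\<beta> + 1) / (q / (q - 1)) - 1"
      unfolding conj by simp
    ultimately show ?thesis by simp
  qed
  have ii: "Hilbert_compact \<mu> \<beta> p \<alpha> q (\<beta> - 1)"
    if v: "vanishing_carleson \<mu> (max (\<alpha> + 2 - p) (\<beta> + 1) * (1 / p + 1 / (q / (q - 1))))"
  proof (rule Hilbert_compact_if_decay[OF assms(1-5) refl mass_decay_of_vanishing_carleson[OF v]])
    \<comment> \<open>In this form each summand of N is at most the maximum times 1/p or 1/q', so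
      the exponent in the hypothesis dominates N.\<close>
    have "(\<alpha> + 2) / p - 1 = (\<alpha> + 2 - p) * (1 / p)" using assms(2) by (simp add: field_simps)
    also have "\<dots> \<le> max (\<alpha> + 2 - p) (\<beta> + 1) * (1 / p)" using assms(2) by (intro mult_right_mono) auto
    finally have 1: "(\<alpha> + 2) / p - 1 \<le> max (\<alpha> + 2 - p) (\<beta> + 1) * (1 / p)" .
    have "(\<beta> + 1) * (1 - 1 / q) \<le> max (\<alpha> + 2 - p) (\<beta> + 1) * (1 - 1 / q)"
      using assms(1) by (intro mult_right_mono) auto
    with 1 show "(\<alpha> + 2) / p - 1 + (\<beta> + 1) * (1 - 1 / q) \<le> max (\<alpha> + 2 - p) (\<beta> + 1) * (1 / p + 1 / (q / (q - 1)))"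
      unfolding conj distrib_left by (rule add_mono)
  qed
  show ?thesis using i ii by blast
qed

end
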